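(* Let $\Bbbk$ be a field of characteristic $0$, let $n\ge3$, and let $\Omega\in\Bbbk^{[n+1]}=\Bbbk[t_1,\dots,t_{n+1}]$ be an i.s. potential of degree $\ge n+3$. Then every Nambu-Poisson automorphism of $A_\Omega$ is graded (with respect to the grading $\deg t_i=1$), and $\mathrm{Aut}_{Poi}(Q(A_\Omega))=\mathrm{Aut}_{Poi}(A_\Omega)=\mathrm{Aut}_{Poi}(P_\Omega)$. Further, $\mathrm{Aut}_{Poi}(A_\Omega)$ is a finite subgroup of $GL_{n+1}(\Bbbk)$.
   Context: A Nambu-Poisson algebra ($n$-Lie Poisson algebra) is a commutative $\Bbbk$-algebra $P$ with an $n$-ary $\Bbbk$-multilinear bracket $\{-,\dots,-\}$ that vanishes whenever two arguments are equal, satisfies $\{\{u_1,\dots,u_n\},v_1,\dots,v_{n-1}\}=\sum_{s=1}^n\{u_1,\dots,u_{s-1},\{u_s,v_1,\dots,v_{n-1}\},u_{s+1},\dots,u_n\}$, and satisfies the Leibniz rule in each argument. The bracket of a Nambu-Poisson domain $A$ extends uniquely to its fraction field $Q(A)$. $\mathrm{Aut}_{Poi}(A)$ is the group of $\Bbbk$-algebra automorphisms of $A$ preserving the bracket. An i.s. potential is a homogeneous element $\Omega\in\Bbbk^{[n+1]}$ (with $\deg t_i=1$ for all $i$) such that $\Bbbk^{[n+1]}/(\Omega_{t_1},\dots,\Omega_{t_{n+1}})$ is finite-dimensional over $\Bbbk$, where $\Omega_{t_i}=\partial\Omega/\partial t_i$. $A_\Omega$ denotes $\Bbbk^{[n+1]}$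 with the Nambu-Poisson bracket $\{f_1,\dots,f_n\}=\det\frac{\partial(f_1,\dots,f_n,\Omega)}{\partial(t_1,\dots,t_{n+1})}$ (the Jacobian determinant whose last row is the gradient of $\Omega$), and $P_\Omega=A_\Omega/(\Omega)$ with the induced bracket. The equalities of groups are via the natural maps: automorphisms of $A_\Omega$ extend to $Q(A_\Omega)$, and every automorphism of $A_\Omega$ preserves the ideal $(\Omega)$ and so induces an automorphism of $P_\Omega$; both maps are bijections. $\mathrm{Aut}_{Poi}(A_\Omega)$ is regarded as a subgroup of $GL_{n+1}(\Bbbk)$ by restriction of graded automorphisms to $V=\sum_{s=1}^{n+1}\Bbbk t_s$. *)

theory Defs
  imports
    "HOL-Analysis.Determinants"
    "HOL-Library.Poly_Mapping"
    "HOL-Library.Option_ord"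
    "HOL-Computational_Algebra.Fraction_Field"
    "HOL-Algebra.Algebra"
    "HOL-Algebra.Algebraic_Closure_Type"
begin

section \<open>Nambu-Poisson algebras and their automorphism groups\<close>

text \<open>
  The arity $n$ of the bracket is the cardinality of a finite index type \<open>'i\<close>, and an
  $n$-tuple of arguments is a function on \<open>'i\<close>.
\<close>

record ('k, 'a, 'i) np_algebra = "('k, 'a) module" +
  nbracket :: "('i \<Rightarrow> 'a) \<Rightarrow> 'a"

text \<open>
  In \<open>fundamental_identity\<close> the family \<open>v\<close> supplies $v_1, \dots, v_{n-1}$ in the slots other
  than \<open>r\<close>, and the value of \<open>v\<close> at \<open>r\<close> is irrelevant. The customary identity has \<open>r\<close> equal to
  the first slot; since the bracket is alternating, a different choice of slot multiplies both
  sides by the same sign.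
\<close>

locale nambu_poisson_algebra = algebra R P
  for R (structure) and P :: "('k, 'a, 'i::finite, 'm) np_algebra_scheme" (structure) +
  assumes nbracket_closed:
      "u \<in> UNIV \<rightarrow> carrier P \<Longrightarrow> nbracket P u \<in> carrier P"
    and nbracket_add:
      "\<lbrakk>u \<in> UNIV \<rightarrow> carrier P; x \<in> carrier P; y \<in> carrier P\<rbrakk> \<Longrightarrow>
        nbracket P (u(i := x \<oplus>\<^bsub>P\<^esub> y)) = nbracket P (u(i := x)) \<oplus>\<^bsub>P\<^esub> nbracket P (u(i := y))"
    and nbracket_smult:
      "\<lbrakk>u \<in> UNIV \<rightarrow> carrier P; c \<in> carrier R; x \<in> carrier P\<rbrakk> \<Longrightarrow>
        nbracket P (u(i := c \<odot>\<^bsub>P\<^esub> x)) = c \<odot>\<^bsub>P\<^esub> nbracket P (u(i := x))"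
    and nbracket_alternating:
      "\<lbrakk>u \<in> UNIV \<rightarrow> carrier P; i \<noteq> j; u i = u j\<rbrakk> \<Longrightarrow> nbracket P u = \<zero>\<^bsub>P\<^esub>"
    and fundamental_identity:
      "\<lbrakk>u \<in> UNIV \<rightarrow> carrier P; v \<in> UNIV \<rightarrow> carrier P\<rbrakk> \<Longrightarrow>
        nbracket P (v(r := nbracket P u)) =
        (\<Oplus>\<^bsub>P\<^esub>s\<in>UNIV. nbracket P (u(s := nbracket P (v(r := u s)))))"
    and leibniz:
      "\<lbrakk>u \<in> UNIV \<rightarrow> carrier P; x \<in> carrier P; y \<in> carrier P\<rbrakk> \<Longrightarrow>
        nbracket P (u(i := x \<otimes>\<^bsub>P\<^esub> y)) =
        x \<otimes>\<^bsub>P\<^esub> nbracket P (u(i := y)) \<oplus>\<^bsub>P\<^esub> nbracket P (u(i := x)) \<otimes>\<^bsub>P\<^esub> y"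

text \<open>As in \<^const>\<open>Bij\<close>, automorphisms are taken to be extensional on the carrier.\<close>

definition np_auto :: "('k, 'a, 'i, 'm) np_algebra_scheme \<Rightarrow> ('a \<Rightarrow> 'a) set" where
  "np_auto P = {\<phi> \<in> Bij (carrier P) \<inter> ring_hom P P.
     (\<forall>c. \<forall>x\<in>carrier P. \<phi> (c \<odot>\<^bsub>P\<^esub> x) = c \<odot>\<^bsub>P\<^esub> \<phi> x) \<and>
     (\<forall>u\<in>UNIV \<rightarrow> carrier P. \<phi> (nbracket P u) = nbracket P (\<lambda>i. \<phi> (u i)))}"

definition Aut_Poi :: "('k, 'a, 'i, 'm) np_algebra_scheme \<Rightarrow> ('a \<Rightarrow> 'a) monoid" where
  "Aut_Poi P = BijGroup (carrier P) \<lparr>carrier := np_auto P\<rparr>"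

definition np_quot ::
  "('k, 'a, 'i, 'm) np_algebra_scheme \<Rightarrow> 'a set \<Rightarrow> ('k, 'a set, 'i) np_algebra" where
  "np_quot P I =
    \<lparr>carrier = carrier (P Quot I), monoid.mult = monoid.mult (P Quot I), one = monoid.one (P Quot I),
     ring.zero = ring.zero (P Quot I), ring.add = ring.add (P Quot I),
     module.smult = (\<lambda>c C. \<Union>x\<in>C. I +>\<^bsub>P\<^esub> (c \<odot>\<^bsub>P\<^esub> x)),
     nbracket = (\<lambda>C. \<Union>u\<in>{u. \<forall>i. u i \<in> C i}. I +>\<^bsub>P\<^esub> nbracket P u)\<rparr>"

text \<open>
  The map that \<open>\<phi>\<close> induces on the quotient by a \<open>\<phi>\<close>-stable ideal \<open>I\<close>: it sends $x + I$ to
  $\phi(x + I) = \phi(x) + I$.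
\<close>

definition quot_map ::
  "('k, 'a, 'i, 'm) np_algebra_scheme \<Rightarrow> 'a set \<Rightarrow> ('a \<Rightarrow> 'a) \<Rightarrow> 'a set \<Rightarrow> 'a set" where
  "quot_map P I \<phi> = (\<lambda>C\<in>carrier (np_quot P I). \<phi> ` C)"


section \<open>Polynomials\<close>

text \<open>
  Polynomials in commuting variables \<open>t\<^sub>i\<close> indexed by \<open>'v\<close>; exponent vectors are finitely
  supported functions from \<open>'v\<close> to the naturals.
\<close>

type_synonym ('k, 'v) mpoly = "('v \<Rightarrow>\<^sub>0 nat) \<Rightarrow>\<^sub>0 'k"

definition const :: "'k \<Rightarrow> ('k::comm_ring_1, 'v) mpoly" where
  "const c = Poly_Mapping.single 0 c"

definition var :: "'v \<Rightarrow> ('k::comm_ring_1, 'v) mpoly" where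
  "var i = Poly_Mapping.single (Poly_Mapping.single i 1) 1"

definition partial :: "'v \<Rightarrow> ('k::comm_ring_1, 'v) mpoly \<Rightarrow> ('k, 'v) mpoly" where
  "partial i p = (\<Sum>m\<in>Poly_Mapping.keys p.
     Poly_Mapping.single (m - Poly_Mapping.single i 1)
       (of_nat (Poly_Mapping.lookup m i) * Poly_Mapping.lookup p m))"

definition homogeneous :: "nat \<Rightarrow> ('k::comm_ring_1, 'v::finite) mpoly \<Rightarrow> bool" where
  "homogeneous d p \<longleftrightarrow>
     (\<forall>m\<in>Poly_Mapping.keys p. (\<Sum>i\<in>UNIV. Poly_Mapping.lookup m i) = d)"

definition graded_map ::
  "(('k::comm_ring_1, 'v::finite) mpoly \<Rightarrow> ('k, 'v) mpoly) \<Rightarrow> bool" where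
  "graded_map \<phi> \<longleftrightarrow> (\<forall>d p. homogeneous d p \<longrightarrow> homogeneous d (\<phi> p))"

definition jacobian_ideal :: "('k::comm_ring_1, 'v) mpoly \<Rightarrow> ('k, 'v) mpoly set" where
  "jacobian_ideal \<Omega> = Idl\<^bsub>ring_of_type_algebra\<^esub> (\<Union>i. {partial i \<Omega>})"

text \<open>
  The dimension of the quotient is taken over the image of the constants in it.
\<close>

definition is_potential :: "('k::field, 'v::finite) mpoly \<Rightarrow> bool" where
  "is_potential \<Omega> \<longleftrightarrow> (\<exists>d. homogeneous d \<Omega>) \<and>
     (let J = jacobian_ideal \<Omega>; S = ring_of_type_algebra Quot J in
        ring.finite_dimension S (range (\<lambda>c. J +>\<^bsub>ring_of_type_algebra\<^esub> const c)) (carrier S))"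


section \<open>The algebras attached to a potential\<close>

text \<open>
  For an $n$-element type \<open>'n\<close>, the variables are indexed by \<open>'n option\<close>, with \<open>None\<close> in the role
  of $n+1$. The Jacobian matrix has the gradient of $f_i$ as row \<open>Some i\<close> and the gradient of
  \<open>\<Omega>\<close> as row \<open>None\<close>; rows and columns are indexed by the same type, so that its determinant
  does not depend on an enumeration. The order on \<open>'n\<close> required further down only serves the
  type class instance by which polynomials form an integral domain.
\<close>

definition jacobian_bracket ::
  "('k::comm_ring_1, 'n::finite option) mpoly \<Rightarrow> ('n \<Rightarrow> ('k, 'n option) mpoly) \<Rightarrow>
    ('k, 'n option) mpoly" where
  "jacobian_bracket \<Omega> f =
     det (\<chi> r j. case r of Some i \<Rightarrow> partial j (f i) | None \<Rightarrow> partial j \<Omega>)"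

definition A_alg ::
  "('k::field, 'n::finite option) mpoly \<Rightarrow> ('k, ('k, 'n option) mpoly, 'n) np_algebra" where
  "A_alg \<Omega> = \<lparr>carrier = UNIV, monoid.mult = (*), one = 1, ring.zero = 0, ring.add = (+),
     module.smult = (\<lambda>c p. const c * p), nbracket = jacobian_bracket \<Omega>\<rparr>"

definition P_alg ::
  "('k::field, 'n::finite option) mpoly \<Rightarrow> ('k, ('k, 'n option) mpoly set, 'n) np_algebra" where
  "P_alg \<Omega> = np_quot (A_alg \<Omega>) (PIdl\<^bsub>A_alg \<Omega>\<^esub> \<Omega>)"

definition frac_alg ::
  "(('n::{finite,linorder} \<Rightarrow> ('k::field, 'n option) mpoly fract) \<Rightarrow> ('k, 'n option) mpoly fract) \<Rightarrow>
    ('k, ('k, 'n option) mpoly fract, 'n) np_algebra" where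
  "frac_alg B = \<lparr>carrier = UNIV, monoid.mult = (*), one = 1, ring.zero = 0, ring.add = (+),
     module.smult = (\<lambda>c q. Fract (const c) 1 * q), nbracket = B\<rparr>"

text \<open>The unique Nambu-Poisson bracket on the fraction field extending that of \<^const>\<open>A_alg\<close>.\<close>

definition Q_bracket ::
  "('k::field, 'n::{finite,linorder} option) mpoly \<Rightarrow>
    ('n \<Rightarrow> ('k, 'n option) mpoly fract) \<Rightarrow> ('k, 'n option) mpoly fract" where
  "Q_bracket \<Omega> = (THE B. nambu_poisson_algebra ring_of_type_algebra (frac_alg B) \<and>
     (\<forall>f. B (\<lambda>i. Fract (f i) 1) = Fract (jacobian_bracket \<Omega> f) 1))"

definition Q_alg ::
  "('k::field, 'n::{finite,linorder} option) mpoly \<Rightarrow>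
    ('k, ('k, 'n option) mpoly fract, 'n) np_algebra" where
  "Q_alg \<Omega> = frac_alg (Q_bracket \<Omega>)"

text \<open>
  The extension of an injective ring endomorphism to the fraction field,
  $a / b \mapsto \phi(a) / \phi(b)$.
\<close>

definition frac_map :: "('a::idom \<Rightarrow> 'a) \<Rightarrow> 'a fract \<Rightarrow> 'a fract" where
  "frac_map \<phi> q = (THE r. \<exists>a b. b \<noteq> 0 \<and> q = Fract a b \<and> r = Fract (\<phi> a) (\<phi> b))"

definition GL_group :: "('k::field ^ 'v ^ 'v) monoid" where
  "GL_group = \<lparr>carrier = {M. invertible M}, monoid.mult = (**), one = mat 1\<rparr>"

text \<open>
  The matrix of the restriction of a graded map to the span of the variables, with respect to
  the basis of variables: column \<open>j\<close> holds the coordinates of the image of \<open>t\<^sub>j\<close>.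
\<close>

definition linear_part ::
  "(('k::field, 'v::finite) mpoly \<Rightarrow> ('k, 'v) mpoly) \<Rightarrow> 'k ^ 'v ^ 'v" where
  "linear_part \<phi> = (\<chi> i j. Poly_Mapping.lookup (\<phi> (var j)) (Poly_Mapping.single i 1))"

end

theory Submission
  imports Defs "HOL-Computational_Algebra.Polynomial_Factorial"
begin

text \<open>
  Since the powers of the variables lie in the Jacobian ideal, the gradient of $\Omega$ vanishes
  only at $0$, also for values in an integral domain over $\Bbbk$. The brackets of $n$ of the variables are
  $\pm\Omega_{t_i}$, so an automorphism with $t_j \mapsto x_j$ satisfies that $\pm\Omega_{t_i}(x)$ is
  the bracket of the corresponding $x_j$. If $x$ has degree $a \ge 2$, the left side has a component of degree
  $(d - 1) a$ that exceeds the degree of the right side; hence that component of $x$ vanishes, or lies in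
  $(\Omega)$ in the case of $P_\Omega$. Constant terms vanish by evaluation at $0$. So automorphisms are given by
  matrices $M$ with $\Omega(Mt) = \det M \cdot \Omega(t)$. In the fraction field, a pole of the $x_j$ of
  order $a$ would give a pole of order $(d - 1) a$ on the left and of order at most $n a + 1$ on the right, which
  is impossible for $d \ge n + 3$; this reduces $Q(A_\Omega)$ to $A_\Omega$.

  For finiteness, equivariance of the gradient shows that $\lambda \mapsto \det M \cdot \lambda^{1-d}$ maps
  eigenvalues of $M$, over the algebraic closure, to eigenvalues of $M$; this forces them to be roots of unity of
  bounded order. A unipotent $M$ is trivial, because along its powers the gradient would grow faster than
  equivariance permits. So the group has finite exponent, and Burnside's trace argument applies.
\<close>

section \<open>Ring homomorphisms, derivations and determinants\<close>

text \<open>For P_Omega the vanishing argument puts a top component only into the radical of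
  (\<Omega>), so \<Omega> has to be squarefree; for the fraction field, poles have to be measured.
  Both are questions of factorization in several variables. They are moved to K[X], where K is the
  fraction field and all ideals are principal, by t_j -> t_j + X^(r_j). The powers of X are
  constants for the partial derivatives, so the argument with the Jacobian ideal survives the move;
  suitable weights r make a leading coefficient constant, so divisibility descends again. The
  quotient asks for one more remark: once the images of the variables are linear forms, both sides
  of each bracket relation have degree d - 1 < d, so a congruence modulo \<Omega> between them is an
  equality. Burnside's argument wants one exponent for the whole group. The relation between
  iterated eigenvalues depends on the matrix, hence the factorial that absorbs all possible
  relations.\<close>

locale rhom =
  fixes h :: "'a::comm_ring_1 \<Rightarrow> 'b::comm_ring_1"
  assumes hom_add: "h (x + y) = h x + h y"
    and hom_mult: "h (x * y) = h x * h y"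
    and hom_1: "h 1 = 1"
begin

lemma hom_0: "h 0 = 0"
  using hom_add[of 0 0] by simp

lemma hom_minus: "h (- x) = - h x"
  using hom_add[of x "- x"] hom_0 by (simp add: eq_neg_iff_add_eq_0 add.commute)

lemma hom_diff: "h (x - y) = h x - h y"
  using hom_add[of x "- y"] hom_minus by simp

lemma hom_sum: "h (sum f S) = (\<Sum>i\<in>S. h (f i))"
  by (induction S rule: infinite_finite_induct) (auto simp: hom_0 hom_add)

lemma hom_prod: "h (prod f S) = (\<Prod>i\<in>S. h (f i))"
  by (induction S rule: infinite_finite_induct) (auto simp: hom_1 hom_mult)

lemma hom_power: "h (x ^ m) = h x ^ m"
  by (induction m) (auto simp: hom_1 hom_mult)

lemma hom_of_nat: "h (of_nat m) = of_nat m"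
  by (induction m) (auto simp: hom_1 hom_0 hom_add)

lemma hom_of_int: "h (of_int m) = of_int m"
  by (cases m) (auto simp: hom_of_nat hom_minus hom_diff hom_1)

lemmas homs = hom_0 hom_1 hom_add hom_mult hom_minus hom_diff hom_sum hom_prod hom_power

lemma hom_dvd: "a dvd b \<Longrightarrow> h a dvd h b"
  by (auto simp: dvd_def hom_mult)

end

lemma rhom_comp: "rhom f \<Longrightarrow> rhom g \<Longrightarrow> rhom (\<lambda>x. f (g x))"
  by (simp add: rhom_def)

lemma rhom_id: "rhom (\<lambda>x. x)"
  by (simp add: rhom_def)

locale deriv =
  fixes D :: "'a::comm_ring_1 \<Rightarrow> 'a"
  assumes D_add: "D (x + y) = D x + D y"
    and D_mult: "D (x * y) = x * D y + D x * y"
begin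

lemma D_0: "D 0 = 0"
  using D_add[of 0 0] by simp

lemma D_1: "D 1 = 0"
  using D_mult[of 1 1] by simp

lemma D_minus: "D (- x) = - D x"
  using D_add[of x "- x"] D_0 by (simp add: eq_neg_iff_add_eq_0 add.commute)

lemma D_diff: "D (x - y) = D x - D y"
  using D_add[of x "- y"] D_minus by simp

lemma D_sum: "D (sum f S) = (\<Sum>i\<in>S. D (f i))"
  by (induction S rule: infinite_finite_induct) (auto simp: D_0 D_add)

lemma D_of_nat: "D (of_nat m) = 0"
  by (induction m) (auto simp: D_1 D_0 D_add)

lemma D_of_int: "D (of_int m) = 0"
  by (cases m) (auto simp: D_of_nat D_minus D_diff D_1)

lemma D_prod:
  assumes "finite S"
  shows "D (prod f S) = (\<Sum>s\<in>S. \<Prod>i\<in>S. if i = s then D (f i) else f i)"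
  using assms
proof (induction S)
  case empty
  then show ?case by (simp add: D_1)
next
  case (insert a S)
  have 1: "(\<Prod>i\<in>S. if i = a then D (f i) else f i) = prod f S"
    using insert.hyps by (intro prod.cong) auto
  have 2: "(\<Prod>i\<in>insert a S. if i = s then D (f i) else f i)
      = f a * (\<Prod>i\<in>S. if i = s then D (f i) else f i)" if "s \<in> S" for s
    using insert.hyps that by (subst prod.insert) auto
  show ?case
  proof -
    have "(\<Sum>s\<in>insert a S. \<Prod>i\<in>insert a S. if i = s then D (f i) else f i)
        = D (f a) * prod f S + f a * (\<Sum>s\<in>S. \<Prod>i\<in>S. if i = s then D (f i) else f i)"
      using insert.hyps by (simp add: 1 2 sum_distrib_left del: prod.insert) (simp add: 1)
    then show ?thesis using insert by (simp add: D_mult)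
  qed
qed

end

lemma deriv_pderiv: "deriv (pderiv :: 'a::idom poly \<Rightarrow> 'a poly)"
  by unfold_locales (simp_all add: pderiv_add pderiv_mult algebra_simps)

text \<open>This extends D to polynomials in X by D X = 0. In this way the partial derivatives pass
  through \<open>grad\<close> and \<open>shift\<close>.\<close>

lemma deriv_map_poly:
  assumes "deriv D"
  shows "deriv (map_poly D)"
proof -
  interpret deriv D by fact
  show ?thesis
    by unfold_locales
      (simp_all add: poly_eq_iff coeff_map_poly D_0 D_add coeff_mult D_sum D_mult sum.distrib)
qed

text \<open>Rows are functions, so that replacing a row is a function update; the multilinearity
  lemmas are stated through such updates.\<close>

definition fdet :: "('v::finite \<Rightarrow> 'v \<Rightarrow> 'a::comm_ring_1) \<Rightarrow> 'a" where
  "fdet A = det (\<chi> i j. A i j)"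

lemma fdet_expand: "fdet A = (\<Sum>p | p permutes UNIV. of_int (sign p) * (\<Prod>i\<in>UNIV. A i (p i)))"
  by (simp add: fdet_def det_def)

lemma fdet_row_add:
  "fdet (A(r := (\<lambda>j. a j + b j))) = fdet (A(r := a)) + fdet (A(r := b))"
proof -
  have "(\<chi> i j. (A(r := (\<lambda>j. a j + b j))) i j)
      = (\<chi> i. if i = r then (\<chi> j. a j) + (\<chi> j. b j) else (\<chi> j. A i j))"
    "\<And>c. (\<chi> i j. (A(r := c)) i j) = (\<chi> i. if i = r then (\<chi> j. c j) else (\<chi> j. A i j))"
    by (auto simp: vec_eq_iff)
  then show ?thesis
    unfolding fdet_def by (simp only: det_row_add)
qed

lemma fdet_row_mult: "fdet (A(r := (\<lambda>j. c * a j))) = c * fdet (A(r := a))"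
proof -
  have "(\<chi> i j. (A(r := (\<lambda>j. c * a j))) i j)
      = (\<chi> i. if i = r then c *s (\<chi> j. a j) else (\<chi> j. A i j))"
    "\<And>c. (\<chi> i j. (A(r := c)) i j) = (\<chi> i. if i = r then (\<chi> j. c j) else (\<chi> j. A i j))"
    by (auto simp: vec_eq_iff)
  then show ?thesis
    unfolding fdet_def by (simp only: det_row_mul)
qed

lemma fdet_row_0: "fdet (A(r := (\<lambda>j. 0))) = 0"
  using fdet_row_mult[of A r 0 "\<lambda>j. 0"] by simp

lemma fdet_row_sum: "fdet (A(r := (\<lambda>j. \<Sum>k\<in>S. a k j))) = (\<Sum>k\<in>S. fdet (A(r := a k)))"
proof (induction S rule: infinite_finite_induct)
  case (insert x F)
  have "(\<lambda>j. \<Sum>k\<in>insert x F. a k j) = (\<lambda>j. a x j + (\<Sum>k\<in>F. a k j))"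
    using insert.hyps by simp
  then have "fdet (A(r := (\<lambda>j. \<Sum>k\<in>insert x F. a k j)))
      = fdet (A(r := a x)) + fdet (A(r := (\<lambda>j. \<Sum>k\<in>F. a k j)))"
    using fdet_row_add[of A r "a x"] by metis
  then show ?case using insert by (metis sum.insert)
next
  case (infinite S)
  then show ?case by (simp only: sum.infinite fdet_row_0 not_False_eq_True)
next
  case empty
  show ?case by (simp only: sum.empty fdet_row_0)
qed

lemma fdet_row_lincomb:
  "fdet (A(r := (\<lambda>j. \<Sum>k\<in>S. c k * a k j))) = (\<Sum>k\<in>S. c k * fdet (A(r := a k)))"
  using fdet_row_sum[of A r "\<lambda>k j. c k * a k j" S] by (simp add: fdet_row_mult)

lemma fdet_same: "i \<noteq> j \<Longrightarrow> A i = A j \<Longrightarrow> fdet A = 0"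
  unfolding fdet_def by (rule det_identical_rows[of i j]) (auto simp: row_def vec_eq_iff)

lemma fdet_mult: "fdet (\<lambda>i j. \<Sum>k\<in>UNIV. A i k * B k j) = fdet A * fdet B"
proof -
  have "(\<chi> i j. \<Sum>k\<in>UNIV. A i k * B k j) = (\<chi> i j. A i j) ** (\<chi> i j. B i j)"
    by (simp add: matrix_matrix_mult_def)
  then show ?thesis
    unfolding fdet_def by (simp only: det_mul)
qed

definition unit_row :: "'v \<Rightarrow> 'v \<Rightarrow> 'a::comm_ring_1" where
  "unit_row i j = (if i = j then 1 else 0)"

lemma sum_unit_row: "(\<Sum>k\<in>UNIV. a k * unit_row k j) = a (j :: 'v::finite)"
  by (simp add: unit_row_def if_distrib[of "\<lambda>x. _ * x"] cong: if_cong)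

lemma fdet_unit_row: "fdet (unit_row :: 'v::finite \<Rightarrow> 'v \<Rightarrow> 'a::comm_ring_1) = 1"
proof -
  have "(\<chi> i j. unit_row i j) = (mat 1 :: 'a ^ 'v ^ 'v)"
    by (auto simp: mat_def vec_eq_iff unit_row_def)
  then show ?thesis
    unfolding fdet_def by (simp only: det_I)
qed

lemma fdet_unit_row_upd:
  fixes w :: "'v::finite \<Rightarrow> 'a::comm_ring_1"
  shows "fdet (unit_row(s := w)) = w s"
proof -
  have "fdet (unit_row(s := w)) = fdet (unit_row(s := (\<lambda>j. \<Sum>k\<in>UNIV. w k * unit_row k j)))"
    by (simp add: sum_unit_row)
  also have "\<dots> = (\<Sum>k\<in>UNIV. w k * fdet (unit_row(s := unit_row k)))"
    by (rule fdet_row_lincomb)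
  also have "\<dots> = (\<Sum>k\<in>UNIV. if k = s then w k else 0)"
  proof (intro sum.cong refl)
    fix k
    show "w k * fdet (unit_row(s := unit_row k)) = (if k = s then w k else 0)"
      using fdet_same[of s k "(unit_row :: 'v \<Rightarrow> 'v \<Rightarrow> 'a)(s := unit_row k)"]
        fdet_unit_row[where 'v = 'v and 'a = 'a] by auto
  qed
  finally show ?thesis by simp
qed

lemma fdet_swap:
  assumes "i \<noteq> j"
  shows "fdet (A(i := a, j := b)) = - fdet (A(i := b, j := a))"
proof -
  have "fdet (A(i := (\<lambda>k. a k + b k), j := (\<lambda>k. a k + b k))) = 0"
    using assms by (intro fdet_same[of i j]) auto
  moreover have "fdet (A(i := a, j := a)) = 0" "fdet (A(i := b, j := b)) = 0"
    using assms by (auto intro!: fdet_same[of i j])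
  ultimately show ?thesis
    using assms by (simp add: fdet_row_add fun_upd_twist eq_neg_iff_add_eq_0)
      (simp add: fdet_row_add fun_upd_twist[of j i] add.commute)
qed

lemma (in rhom) hom_fdet: "h (fdet A) = fdet (\<lambda>i j. h (A i j))"
  by (simp add: fdet_expand homs hom_of_int)

lemma (in deriv) D_fdet: "D (fdet A) = (\<Sum>s\<in>UNIV. fdet (A(s := (\<lambda>j. D (A s j)))))"
proof -
  have "D (fdet A) = (\<Sum>p | p permutes UNIV. of_int (sign p) *
      (\<Sum>s\<in>UNIV. \<Prod>i\<in>UNIV. if i = s then D (A i (p i)) else A i (p i)))"
    by (simp add: fdet_expand D_sum D_mult D_of_int D_prod)
  also have "\<dots> = (\<Sum>s\<in>UNIV. \<Sum>p | p permutes UNIV. of_int (sign p) *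
      (\<Prod>i\<in>UNIV. if i = s then D (A i (p i)) else A i (p i)))"
    by (subst sum.swap) (simp add: sum_distrib_left)
  also have "\<dots> = (\<Sum>s\<in>UNIV. fdet (A(s := (\<lambda>j. D (A s j)))))"
    unfolding fdet_expand by (intro sum.cong refl arg_cong2[where f = "(*)"] prod.cong) auto
  finally show ?thesis .
qed

text \<open>The coefficient of $X$ in $\det(A(1 + XC)) = \det A\,\det(1 + XC)$.\<close>

lemma fdet_trace:
  fixes A :: "'v::finite \<Rightarrow> 'v \<Rightarrow> 'a::idom"
  shows "(\<Sum>s\<in>UNIV. fdet (A(s := (\<lambda>k. \<Sum>j\<in>UNIV. A s j * C j k)))) = (\<Sum>s\<in>UNIV. C s s) * fdet A"
proof -
  define E :: "'v \<Rightarrow> 'v \<Rightarrow> 'a poly" where "E = (\<lambda>i j. [:unit_row i j, C i j:])"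
  define B :: "'v \<Rightarrow> 'v \<Rightarrow> 'a poly" where "B = (\<lambda>i j. [:A i j:])"
  interpret pd: deriv "pderiv :: 'a poly \<Rightarrow> _" by (rule deriv_pderiv)
  interpret ev: rhom "\<lambda>p :: 'a poly. poly p 0" by unfold_locales auto
  have pE: "poly (pderiv (E i j)) 0 = C i j" "poly (E i j) 0 = unit_row i j" for i j
    by (auto simp: E_def pderiv_pCons)
  have BE: "(\<Sum>k\<in>UNIV. B i k * E k j) = [:A i j, \<Sum>k\<in>UNIV. A i k * C k j:]" for i j
  proof (rule poly_eqI)
    fix n
    show "coeff (\<Sum>k\<in>UNIV. B i k * E k j) n = coeff [:A i j, \<Sum>k\<in>UNIV. A i k * C k j:] n"
      by (auto simp: coeff_sum B_def E_def coeff_pCons sum_unit_row mult.commute split: nat.split)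
  qed
  have *: "poly (pderiv (fdet F)) 0
      = (\<Sum>s\<in>UNIV. fdet ((\<lambda>i j. poly (F i j) 0)(s := (\<lambda>j. poly (pderiv (F s j)) 0))))"
    for F :: "'v \<Rightarrow> 'v \<Rightarrow> 'a poly"
    unfolding pd.D_fdet ev.hom_sum ev.hom_fdet
    by (intro sum.cong refl arg_cong[where f = fdet]) (auto simp: fun_eq_iff)
  have "poly (pderiv (fdet (\<lambda>i j. \<Sum>k\<in>UNIV. B i k * E k j))) 0 = poly (pderiv (fdet B * fdet E)) 0"
    by (simp only: fdet_mult)
  also have "fdet B = [:fdet A:]"
  proof -
    interpret c: rhom "\<lambda>a :: 'a. [:a:]" by unfold_locales (auto simp: one_pCons)
    show ?thesis unfolding B_def c.hom_fdet ..
  qed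
  finally show ?thesis
    unfolding BE * pderiv_mult
    by (simp add: * pE fdet_unit_row_upd pderiv_pCons)
qed

section \<open>Polynomials\<close>

lemma mpoly_single_induct:
  assumes "\<And>m c. P (Poly_Mapping.single m c)" "\<And>p q. P p \<Longrightarrow> P q \<Longrightarrow> P (p + q)"
  shows "P (p :: 'a \<Rightarrow>\<^sub>0 'b::comm_monoid_add)"
proof (induction p rule: Poly_Mapping.update_induct)
  case const
  show ?case using assms(1)[of undefined 0] by simp
next
  case (update f a b)
  have "Poly_Mapping.update a b f = f + Poly_Mapping.single a b"
    using update.hyps
    by (intro poly_mapping_eqI) (auto simp: lookup_update lookup_add lookup_single in_keys_iff)
  then show ?case using assms update by simp
qed

lemma const_hom: "rhom (const :: 'k::comm_ring_1 \<Rightarrow> ('k, 'v) mpoly)"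
  by unfold_locales (simp_all add: const_def single_add mult_single)

lemma var_power: "var i ^ b = Poly_Mapping.single (Poly_Mapping.single i b) 1"
  by (induction b) (simp_all add: var_def mult_single single_add[symmetric])

lemma mpoly_induct [case_names const var add mult]:
  assumes "\<And>c. P (const c)" "\<And>i. P (var i)"
    "\<And>p q. P p \<Longrightarrow> P q \<Longrightarrow> P (p + q)" "\<And>p q. P p \<Longrightarrow> P q \<Longrightarrow> P (p * q)"
  shows "P (p :: ('k::comm_ring_1, 'v) mpoly)"
proof (induction p rule: mpoly_single_induct)
  case (1 m c)
  show ?case
  proof (induction m arbitrary: c rule: mpoly_single_induct)
    case (1 i b)
    have "P (var i ^ b)"
    proof (induction b)
      case 0
      show ?case using assms(1)[of 1] by (simp add: const_def)
    qed (auto intro: assms)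
    then have "P (const c * var i ^ b)" by (intro assms)
    then show ?case by (simp add: const_def var_power mult_single)
  next
    case (2 m m')
    have "Poly_Mapping.single (m + m') c = Poly_Mapping.single m c * (Poly_Mapping.single m' 1 :: ('k, 'v) mpoly)"
      by (simp add: mult_single)
    then show ?case using assms(4)[OF 2(1) 2(2)] by simp
  qed
next
  case (2 p q)
  then show ?case by (rule assms)
qed

text \<open>Moving the coefficients by \<open>\<kappa>\<close> lets one notion cover values in
  polynomial rings, in the fraction field and in the algebraic closure.\<close>

definition subst :: "('k \<Rightarrow> 'b) \<Rightarrow> ('v \<Rightarrow> 'b) \<Rightarrow> ('k::comm_ring_1, 'v::finite) mpoly \<Rightarrow> 'b::comm_ring_1" where
  "subst \<kappa> x p = (\<Sum>m\<in>Poly_Mapping.keys p. \<kappa> (Poly_Mapping.lookup p m) * (\<Prod>i\<in>UNIV. x i ^ Poly_Mapping.lookup m i))"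

lemma hom_subst: "rhom h \<Longrightarrow> h (subst \<kappa> x p) = subst (\<lambda>c. h (\<kappa> c)) (\<lambda>i. h (x i)) p"
  by (simp add: subst_def rhom.homs)

lemma subst_superset:
  assumes "\<kappa> 0 = 0" "finite S" "Poly_Mapping.keys p \<subseteq> S"
  shows "subst \<kappa> x p = (\<Sum>m\<in>S. \<kappa> (Poly_Mapping.lookup p m) * (\<Prod>i\<in>UNIV. x i ^ Poly_Mapping.lookup m i))"
  unfolding subst_def using assms by (intro sum.mono_neutral_left) (auto simp: in_keys_iff)

lemma subst_single:
  "\<kappa> 0 = 0 \<Longrightarrow> subst \<kappa> x (Poly_Mapping.single m c) = \<kappa> c * (\<Prod>i\<in>UNIV. x i ^ Poly_Mapping.lookup m i)"
  by (subst subst_superset[where S = "{m}"]) auto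

lemma subst_hom:
  fixes \<kappa> :: "'k::comm_ring_1 \<Rightarrow> 'b::comm_ring_1" and x :: "'v::finite \<Rightarrow> 'b"
  assumes "rhom \<kappa>"
  shows "rhom (subst \<kappa> x)"
proof -
  interpret rhom \<kappa> by fact
  have add: "subst \<kappa> x (p + q) = subst \<kappa> x p + subst \<kappa> x q" for p q
  proof -
    let ?S = "Poly_Mapping.keys p \<union> Poly_Mapping.keys q"
    have "Poly_Mapping.keys (p + q) \<subseteq> ?S" by (rule keys_add)
    then show ?thesis
      by (simp add: subst_superset[where \<kappa> = \<kappa> and S = ?S, OF hom_0] lookup_add hom_add distrib_right sum.distrib)
  qed
  have mult: "subst \<kappa> x (p * q) = subst \<kappa> x p * subst \<kappa> x q" for p q
  proof (induction p rule: mpoly_single_induct)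
    case (1 m c)
    show ?case
    proof (induction q rule: mpoly_single_induct)
      case (1 m' c')
      then show ?case
        by (simp add: mult_single subst_single hom_0 hom_mult lookup_add power_add prod.distrib)
    qed (simp add: add distrib_left)
  qed (simp add: add distrib_right)
  have "subst \<kappa> x 1 = 1"
    using subst_single[where \<kappa> = \<kappa> and x = x and m = 0 and c = 1] hom_0 hom_1 by simp
  then show ?thesis
    using add mult by unfold_locales auto
qed

lemma subst_const [simp]: "rhom \<kappa> \<Longrightarrow> subst \<kappa> x (const c) = \<kappa> c"
  by (simp add: const_def subst_single rhom.homs)

lemma subst_var [simp]:
  assumes "rhom \<kappa>"
  shows "subst \<kappa> x (var i) = x i"
proof -
  have "(\<Prod>j\<in>UNIV. x j ^ Poly_Mapping.lookup (Poly_Mapping.single i (1::nat)) j)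
      = (\<Prod>j\<in>UNIV. if i = j then x j else 1)"
    by (intro prod.cong) (auto simp: lookup_single)
  then show ?thesis
    using assms by (simp add: var_def subst_single rhom.homs)
qed

lemma hom_eqI:
  assumes "rhom f" "rhom g" "\<And>c. f (const c) = g (const c)" "\<And>i. f (var i) = g (var i)"
  shows "f p = g p"
  by (induction p rule: mpoly_induct) (use assms in \<open>auto simp: rhom.homs\<close>)

lemma subst_const_var [simp]: "subst const var p = p"
  by (rule hom_eqI[OF subst_hom[OF const_hom] rhom_id]) (auto simp: const_hom)

lemma subst_subst:
  assumes "rhom \<kappa>"
  shows "subst \<kappa> x (subst const y p) = subst \<kappa> (\<lambda>i. subst \<kappa> x (y i)) p"
  by (subst hom_subst[OF subst_hom]) (simp_all add: assms)

lemma lookup_partial: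
  fixes p :: "('k::comm_ring_1, 'v) mpoly"
  shows "Poly_Mapping.lookup (partial i p) m =
    of_nat (Poly_Mapping.lookup m i + 1) * Poly_Mapping.lookup p (m + Poly_Mapping.single i 1)"
proof -
  let ?e = "Poly_Mapping.single i (1::nat)"
  \<comment> \<open>Subtraction of exponents truncates at 0: a monomial free of variable i would be
    sent to itself. The factor \<open>of_nat\<close> of its exponent 0 removes it.\<close>
  have eq: "m' - ?e = m \<and> Poly_Mapping.lookup m' i \<noteq> 0 \<longleftrightarrow> m' = m + ?e" for m' :: "'v \<Rightarrow>\<^sub>0 nat"
    by (auto simp: poly_mapping_eq_iff fun_eq_iff lookup_minus lookup_add lookup_single when_def)
  have "Poly_Mapping.lookup (partial i p) m
      = (\<Sum>m'\<in>Poly_Mapping.keys p. if m' = m + ?e then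
          of_nat (Poly_Mapping.lookup m' i) * Poly_Mapping.lookup p m' else 0)"
    unfolding partial_def lookup_sum
  proof (intro sum.cong refl)
    fix m'
    show "Poly_Mapping.lookup (Poly_Mapping.single (m' - ?e)
        (of_nat (Poly_Mapping.lookup m' i) * Poly_Mapping.lookup p m')) m
      = (if m' = m + ?e then of_nat (Poly_Mapping.lookup m' i) * Poly_Mapping.lookup p m' else 0)"
      using eq[of m'] by (cases "Poly_Mapping.lookup m' i = 0") (auto simp: lookup_single when_def)
  qed
  also have "\<dots> = of_nat (Poly_Mapping.lookup m i + 1) * Poly_Mapping.lookup p (m + ?e)"
    by (auto simp: in_keys_iff lookup_add)
  finally show ?thesis .
qed

lemma partial_add: "partial i (p + q) = partial i p + partial i q"
  by (intro poly_mapping_eqI) (simp add: lookup_partial lookup_add distrib_left)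

lemma partial_single:
  "partial i (Poly_Mapping.single m c) =
    Poly_Mapping.single (m - Poly_Mapping.single i 1) (of_nat (Poly_Mapping.lookup m i) * c)"
  by (cases "c = 0") (simp_all add: partial_def)

lemma deriv_partial: "deriv (partial i :: ('k::comm_ring_1, 'v) mpoly \<Rightarrow> _)"
proof
  fix p q :: "('k, 'v) mpoly"
  let ?e = "Poly_Mapping.single i (1::nat)"
  have e: "a - ?e + b = a + b - ?e" if "Poly_Mapping.lookup a i \<noteq> 0" for a b :: "'v \<Rightarrow>\<^sub>0 nat"
    using that by (auto simp: poly_mapping_eq_iff fun_eq_iff lookup_minus lookup_add lookup_single when_def)
  show "partial i (p * q) = p * partial i q + partial i p * q"
  proof (induction p rule: mpoly_single_induct)
    case (1 a c)
    show ?case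
    proof (induction q rule: mpoly_single_induct)
      case (1 b c')
      have 1: "Poly_Mapping.single a c * partial i (Poly_Mapping.single b c')
          = Poly_Mapping.single (a + b - ?e) (of_nat (Poly_Mapping.lookup b i) * (c * c'))"
        using e[of b a]
        by (cases "Poly_Mapping.lookup b i = 0") (auto simp: partial_single mult_single add.commute algebra_simps)
      have 2: "partial i (Poly_Mapping.single a c) * Poly_Mapping.single b c'
          = Poly_Mapping.single (a + b - ?e) (of_nat (Poly_Mapping.lookup a i) * (c * c'))"
        using e[of a b]
        by (cases "Poly_Mapping.lookup a i = 0") (auto simp: partial_single mult_single algebra_simps)
      show ?case
        unfolding 1 2 by (simp add: partial_single mult_single lookup_add single_add[symmetric] algebra_simps)
    qed (simp add: partial_add algebra_simps)
  qed (simp add: partial_add algebra_simps)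
qed (rule partial_add)

lemma partial_const [simp]: "partial i (const c) = 0"
  by (simp add: const_def partial_single)

lemma partial_var: "partial i (var j) = const (unit_row i j)"
  by (auto simp: var_def const_def unit_row_def partial_single lookup_single)

lemma partial_commute: "partial i (partial j p) = partial j (partial i p)"
  by (cases "i = j") (auto intro!: poly_mapping_eqI simp: lookup_partial lookup_add lookup_single algebra_simps)

text \<open>The chain rule. Besides partial derivatives it is applied to derivations that act on the
  coefficients of polynomials in X.\<close>

lemma deriv_subst:
  assumes "deriv D" "rhom \<kappa>" "\<And>c. D (\<kappa> c) = 0"
  shows "D (subst \<kappa> x p) = (\<Sum>i\<in>UNIV. subst \<kappa> x (partial i p) * D (x i))"
proof -
  interpret deriv D by fact
  interpret s: rhom "subst \<kappa> x" by (rule subst_hom) fact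
  show ?thesis
  proof (induction p rule: mpoly_induct)
    case (const c)
    then show ?case using assms by (simp add: s.homs)
  next
    case (var i)
    have "(\<Sum>j\<in>UNIV. subst \<kappa> x (partial j (var i)) * D (x j)) = (\<Sum>j\<in>UNIV. D (x j) * unit_row j i)"
      using assms(2) by (intro sum.cong) (auto simp: partial_var unit_row_def rhom.homs)
    then show ?case using assms(2) by (simp add: sum_unit_row)
  next
    case (add p q)
    then show ?case
      by (simp add: partial_add s.homs D_add distrib_right sum.distrib)
  next
    case (mult p q)
    then show ?case
      by (simp add: deriv.D_mult[OF deriv_partial] s.homs D_mult distrib_right distrib_left sum.distrib sum_distrib_left mult_ac)
  qed
qed

section \<open>The grading\<close>

text \<open>The homomorphism p(t) -> p(X t). The coefficient of X^e is the homogeneous component of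
  degree e, so total degrees and leading forms become degrees and leading coefficients in one
  variable.\<close>

definition grad :: "('k::comm_ring_1, 'v::finite) mpoly \<Rightarrow> ('k, 'v) mpoly poly" where
  "grad = subst (\<lambda>c. [:const c:]) (\<lambda>i. [:0, var i:])"

lemma const_poly_hom: "rhom \<kappa> \<Longrightarrow> rhom (\<lambda>c. [:\<kappa> c:])"
  by (simp add: rhom_def one_pCons)

lemma grad_hom: "rhom (grad :: ('k::comm_ring_1, 'v::finite) mpoly \<Rightarrow> _)"
  unfolding grad_def by (intro subst_hom const_poly_hom const_hom)

lemma grad_const [simp]: "grad (const c) = [:const c:]"
  by (simp add: grad_def const_poly_hom const_hom)

lemma grad_var [simp]: "grad (var i) = [:0, var i:]"
  by (simp add: grad_def const_poly_hom const_hom)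

lemma poly_grad_1: "poly (grad p) 1 = p"
  by (rule hom_eqI[OF rhom_comp[OF _ grad_hom] rhom_id]) (auto simp: rhom_def)

lemma grad_single:
  "grad (Poly_Mapping.single m c :: ('b::comm_ring_1, 'a::finite) mpoly) =
    monom (Poly_Mapping.single m c) (\<Sum>i\<in>UNIV. Poly_Mapping.lookup m i)"
proof -
  have "[:0, var i:] ^ k = monom ((var i :: ('b, 'a) mpoly) ^ k) k" for i k
    by (induction k) (simp_all add: monom_Suc pCons_one[symmetric] smult_monom mult_monom one_pCons monom_0)
  note pw = this
  have "grad (Poly_Mapping.single m c)
      = [:const c:] * (\<Prod>i\<in>UNIV. monom (var i ^ Poly_Mapping.lookup m i) (Poly_Mapping.lookup m i))"
    unfolding grad_def by (subst subst_single) (simp_all add: const_def pw)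
  also have "(\<Prod>i\<in>S. monom (var i ^ Poly_Mapping.lookup m i) (Poly_Mapping.lookup m i))
      = monom (\<Prod>i\<in>S. var i ^ Poly_Mapping.lookup m i) (\<Sum>i\<in>S. Poly_Mapping.lookup m i)"
    if "finite S" for S
    using that by (induction S) (simp_all add: mult_monom monom_0 one_pCons)
  also have "(\<Prod>i\<in>UNIV. var i ^ Poly_Mapping.lookup m i) = (Poly_Mapping.single m 1 :: ('b, 'a) mpoly)"
    using subst_single[of const "var" m "1 :: 'b"] subst_const_var[of "Poly_Mapping.single m (1 :: 'b)"]
    by (simp add: const_def)
  finally show ?thesis
    by (simp add: smult_monom const_def mult_single)
qed

lemma lookup_coeff_grad:
  "Poly_Mapping.lookup (coeff (grad p) e) m =
    (if (\<Sum>i\<in>UNIV. Poly_Mapping.lookup m i) = e then Poly_Mapping.lookup p m else 0)"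
  by (induction p rule: mpoly_single_induct)
    (auto simp: grad_single rhom.hom_add[OF grad_hom] lookup_add lookup_single when_def)

lemma homogeneous_iff: "homogeneous e p \<longleftrightarrow> grad p = monom p e"
proof
  assume "homogeneous e p"
  then show "grad p = monom p e"
    by (intro poly_eqI poly_mapping_eqI) (auto simp: lookup_coeff_grad homogeneous_def in_keys_iff)
next
  assume *: "grad p = monom p e"
  show "homogeneous e p"
    unfolding homogeneous_def
  proof
    fix m assume "m \<in> Poly_Mapping.keys p"
    moreover have "Poly_Mapping.lookup (coeff (grad p) (\<Sum>i\<in>UNIV. Poly_Mapping.lookup m i)) m = Poly_Mapping.lookup p m"
      by (simp add: lookup_coeff_grad)
    ultimately show "(\<Sum>i\<in>UNIV. Poly_Mapping.lookup m i) = e"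
      unfolding * by (auto simp: in_keys_iff split: if_splits)
  qed
qed

lemma homogeneous_coeff_grad: "homogeneous e (coeff (grad p) e)"
  unfolding homogeneous_def by (auto simp: in_keys_iff lookup_coeff_grad split: if_splits)

lemma homogeneous_partial:
  assumes "homogeneous d p"
  shows "homogeneous (d - 1) (partial i p)"
  unfolding homogeneous_def
proof
  fix m assume "m \<in> Poly_Mapping.keys (partial i p)"
  then have "m + Poly_Mapping.single i 1 \<in> Poly_Mapping.keys p"
    by (auto simp: in_keys_iff lookup_partial)
  then have "(\<Sum>j\<in>UNIV. Poly_Mapping.lookup (m + Poly_Mapping.single i 1) j) = d"
    using assms unfolding homogeneous_def by blast
  then show "(\<Sum>j\<in>UNIV. Poly_Mapping.lookup m j) = d - 1"
    by (simp add: lookup_add sum.distrib lookup_single when_def)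
qed

text \<open>A monomial of positive degree has a positive exponent at some i, and characteristic 0
  keeps its coefficient alive in the i-th partial derivative.\<close>

lemma homogeneous_zero_gradient:
  fixes p :: "('k::{idom, ring_char_0}, 'v::finite) mpoly"
  assumes "homogeneous d p" "d > 0" "\<And>i. partial i p = 0"
  shows "p = 0"
proof (rule ccontr)
  assume "p \<noteq> 0"
  then obtain m where m: "m \<in> Poly_Mapping.keys p" by (metis keys_eq_empty all_not_in_conv)
  then have "(\<Sum>i\<in>UNIV. Poly_Mapping.lookup m i) \<noteq> 0"
    using assms unfolding homogeneous_def by auto
  then obtain i where i: "Poly_Mapping.lookup m i \<noteq> 0" by auto
  let ?e = "Poly_Mapping.single i (1::nat)"
  have me: "m - ?e + ?e = m"
    using i by (auto simp: poly_mapping_eq_iff fun_eq_iff lookup_minus lookup_add lookup_single when_def)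
  have "0 = Poly_Mapping.lookup (partial i p) (m - ?e)"
    using assms by simp
  then show False
    unfolding lookup_partial me using m by (auto simp: in_keys_iff of_nat_neq_0 simp del: of_nat_Suc of_nat_add)
qed

lemma subst_scale:
  assumes "homogeneous e p"
  shows "subst \<kappa> (\<lambda>i. s * x i) p = s ^ e * subst \<kappa> x p"
  using assms unfolding subst_def homogeneous_def sum_distrib_left
  by (intro sum.cong) (auto simp: power_mult_distrib prod.distrib power_sum[symmetric] mult_ac)

lemma subst_zero:
  assumes "homogeneous e p" "e > 0"
  shows "subst \<kappa> (\<lambda>i. 0) p = 0"
  using subst_scale[OF assms(1), of \<kappa> 0 "\<lambda>i. 0"] assms(2) by (simp add: zero_power)

lemma homogeneous_subst:
  assumes "homogeneous e p" "\<And>i. homogeneous 1 (x i)"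
  shows "homogeneous e (subst const x p)"
proof -
  have "grad (subst const x p) = subst (\<lambda>c. [:const c:]) (\<lambda>i. monom 1 1 * [:x i:]) p"
    using assms(2) by (simp add: hom_subst[OF grad_hom] homogeneous_iff mult_monom monom_0[symmetric])
  also have "\<dots> = monom 1 e * subst (\<lambda>c. [:const c:]) (\<lambda>i. [:x i:]) p"
    by (subst subst_scale[OF assms(1)]) (simp add: monom_power)
  also have "subst (\<lambda>c. [:const c:]) (\<lambda>i. [:x i:]) p = [:subst const x p:]"
    using hom_subst[OF const_poly_hom[OF rhom_id], of const x p] by simp
  finally show ?thesis
    by (simp add: homogeneous_iff mult_monom monom_0[symmetric])
qed

text \<open>Differentiating p(X t) releases one factor X; this expresses the drop of the degree by
  one.\<close>

lemma grad_partial: "monom 1 1 * grad (partial i p) = map_poly (partial i) (grad p)"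
proof -
  have "map_poly (partial i) (grad p) = (\<Sum>j\<in>UNIV. grad (partial j p) * map_poly (partial i) [:0, var j:])"
    unfolding grad_def
    by (intro deriv_subst deriv_map_poly deriv_partial const_poly_hom const_hom)
      (simp add: poly_eq_iff coeff_map_poly deriv.D_0[OF deriv_partial] coeff_pCons split: nat.split)
  also have "\<dots> = (\<Sum>j\<in>UNIV. (grad (partial j p) * monom 1 1) * unit_row j i)"
    by (intro sum.cong)
      (auto simp: map_poly_pCons partial_var unit_row_def deriv.D_0[OF deriv_partial] monom_altdef const_def one_pCons)
  also have "\<dots> = grad (partial i p) * monom 1 1"
    by (rule sum_unit_row)
  finally show ?thesis by (simp only: mult.commute)
qed

text \<open>Top coefficients are read off at degree bounds rather than at degrees, so that no cases
  arise when a leading coefficient vanishes.\<close>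

lemma coeff_mult_bounds:
  assumes "degree p \<le> a" "degree q \<le> b"
  shows "coeff (p * q) (a + b) = coeff p a * coeff q b"
proof -
  have "coeff (p * q) (a + b) = (\<Sum>i\<le>a + b. if i = a then coeff p i * coeff q (a + b - i) else 0)"
    unfolding coeff_mult
  proof (intro sum.cong refl)
    fix i
    assume "i \<in> {..a + b}"
    then show "coeff p i * coeff q (a + b - i) = (if i = a then coeff p i * coeff q (a + b - i) else 0)"
      using assms by (cases "i > a") (auto simp: coeff_eq_0)
  qed
  then show ?thesis by simp
qed

lemma degree_mult_bounds:
  "degree p \<le> a \<Longrightarrow> degree q \<le> b \<Longrightarrow> degree (p * q) \<le> a + b"
  using degree_mult_le[of p q] by linarith

lemma power_bounds:
  fixes p :: "'a::comm_ring_1 poly"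
  assumes "degree p \<le> a"
  shows "degree (p ^ k) \<le> k * a \<and> coeff (p ^ k) (k * a) = coeff p a ^ k"
  by (induction k) (auto simp: degree_mult_bounds coeff_mult_bounds assms)

lemma prod_bounds:
  fixes p :: "'i \<Rightarrow> 'a::comm_ring_1 poly"
  assumes "finite S" "\<And>i. i \<in> S \<Longrightarrow> degree (p i) \<le> a i"
  shows "degree (\<Prod>i\<in>S. p i) \<le> (\<Sum>i\<in>S. a i) \<and> coeff (\<Prod>i\<in>S. p i) (\<Sum>i\<in>S. a i) = (\<Prod>i\<in>S. coeff (p i) (a i))"
  using assms by (induction S) (auto simp: degree_mult_bounds coeff_mult_bounds)

text \<open>All monomials of p have the same degree e, so every term has the same bound e * a, and
  the top coefficients combine to a value of p itself.\<close>

lemma subst_bounds: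
  assumes "homogeneous e p" "\<And>i. degree (u i) \<le> a"
  shows "degree (subst (\<lambda>c. [:k c:]) u p) \<le> e * a"
    and "coeff (subst (\<lambda>c. [:k c:]) u p) (e * a) = subst k (\<lambda>i. coeff (u i) a) p"
proof -
  have *: "degree (\<Prod>i\<in>UNIV. u i ^ Poly_Mapping.lookup m i) \<le> e * a \<and>
      coeff (\<Prod>i\<in>UNIV. u i ^ Poly_Mapping.lookup m i) (e * a) = (\<Prod>i\<in>UNIV. coeff (u i) a ^ Poly_Mapping.lookup m i)"
    if "m \<in> Poly_Mapping.keys p" for m
  proof -
    have "(\<Sum>i\<in>UNIV. Poly_Mapping.lookup m i * a) = e * a"
      using that assms(1) by (simp add: homogeneous_def sum_distrib_right[symmetric])
    then show ?thesis
      using prod_bounds[of UNIV "\<lambda>i. u i ^ Poly_Mapping.lookup m i" "\<lambda>i. Poly_Mapping.lookup m i * a"]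
        power_bounds[OF assms(2)] by simp
  qed
  show "degree (subst (\<lambda>c. [:k c:]) u p) \<le> e * a"
    unfolding subst_def using *
    by (intro degree_sum_le) (auto intro: order_trans[OF degree_smult_le])
  show "coeff (subst (\<lambda>c. [:k c:]) u p) (e * a) = subst k (\<lambda>i. coeff (u i) a) p"
    unfolding subst_def using * by (simp add: coeff_sum)
qed

lemma single_1_eq_iff: "Poly_Mapping.single i (Suc 0) = Poly_Mapping.single j (Suc 0) \<longleftrightarrow> i = j"
  by (metis nat.simps(3) lookup_single_eq lookup_single_not_eq)

lemma homogeneous_1_expand:
  assumes "homogeneous 1 p"
  shows "p = (\<Sum>i\<in>UNIV. const (Poly_Mapping.lookup p (Poly_Mapping.single i 1)) * var i)"
proof (rule poly_mapping_eqI)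
  fix m
  have "Poly_Mapping.lookup (\<Sum>i\<in>UNIV. const (Poly_Mapping.lookup p (Poly_Mapping.single i 1)) * var i) m
    = (\<Sum>i\<in>UNIV. if Poly_Mapping.single i 1 = m then Poly_Mapping.lookup p m else 0)"
    by (auto simp: lookup_sum const_def var_def mult_single lookup_single when_def intro!: sum.cong)
  also have "\<dots> = Poly_Mapping.lookup p m"
  proof (cases "\<exists>j. m = Poly_Mapping.single j 1")
    case True
    then show ?thesis by (auto simp: single_1_eq_iff)
  next
    case False
    have "m \<notin> Poly_Mapping.keys p"
    proof
      assume "m \<in> Poly_Mapping.keys p"
      then have s: "(\<Sum>i\<in>UNIV. Poly_Mapping.lookup m i) = 1"
        using assms unfolding homogeneous_def by blast
      then obtain j where j: "Poly_Mapping.lookup m j = 1" "\<And>i. i \<noteq> j \<Longrightarrow> Poly_Mapping.lookup m i = 0"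
        using sum_eq_1_iff[of UNIV "Poly_Mapping.lookup m"] by (auto intro: that)
      then have "m = Poly_Mapping.single j 1"
        by (intro poly_mapping_eqI) (auto simp: lookup_single when_def)
      then show False using False by blast
    qed
    then show ?thesis using False by (auto simp: in_keys_iff intro!: sum.neutral)
  qed
  finally show "Poly_Mapping.lookup p m
      = Poly_Mapping.lookup (\<Sum>i\<in>UNIV. const (Poly_Mapping.lookup p (Poly_Mapping.single i 1)) * var i) m"
    by simp
qed

lemma lookup_linear:
  "Poly_Mapping.lookup (\<Sum>i\<in>UNIV. const (c i) * var i) (Poly_Mapping.single j 1) = c (j :: 'v::finite)"
proof -
  have "Poly_Mapping.lookup (\<Sum>i\<in>UNIV. const (c i) * var i) (Poly_Mapping.single j 1)
      = (\<Sum>i\<in>UNIV. if i = j then c i else 0)"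
    unfolding lookup_sum
  proof (intro sum.cong refl)
    fix i
    show "Poly_Mapping.lookup (const (c i) * var i) (Poly_Mapping.single j 1) = (if i = j then c i else 0)"
      using single_1_eq_iff[of i j] by (auto simp: const_def var_def mult_single lookup_single when_def)
  qed
  then show ?thesis by simp
qed

lemma homogeneous_linear: "homogeneous 1 (\<Sum>i\<in>UNIV. const (c i) * var i)"
proof -
  have "grad (\<Sum>i\<in>UNIV. const (c i) * var i) = (\<Sum>i\<in>UNIV. monom (const (c i) * var i) 1)"
    by (simp add: rhom.homs[OF grad_hom] monom_altdef mult.commute)
  also have "\<dots> = monom (\<Sum>i\<in>UNIV. const (c i) * var i) 1"
    by (simp add: poly_eq_iff coeff_sum)
  finally show ?thesis by (simp add: homogeneous_iff)
qed

section \<open>Isolated singularities\<close>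

lemma ring_type_simps:
  "carrier (ring_of_type_algebra :: 'a::comm_ring_1 ring) = UNIV"
  "x \<oplus>\<^bsub>ring_of_type_algebra\<^esub> y = x + (y :: 'a)"
  "x \<otimes>\<^bsub>ring_of_type_algebra\<^esub> y = x * (y :: 'a)"
  "\<zero>\<^bsub>ring_of_type_algebra\<^esub> = (0 :: 'a)"
  "\<one>\<^bsub>ring_of_type_algebra\<^esub> = (1 :: 'a)"
  by (simp_all add: ring_of_type_algebra_def)

lemma coset_type_eq: "J +>\<^bsub>(ring_of_type_algebra :: 'a::comm_ring_1 ring)\<^esub> p = (\<lambda>h. h + p) ` J"
  by (auto simp: a_r_coset_def' ring_type_simps)

lemma combine_cosets:
  assumes "ideal J (ring_of_type_algebra :: 'a::comm_ring_1 ring)"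
  defines "S \<equiv> ring_of_type_algebra Quot J"
  shows "ring.combine S (map (\<lambda>e. J +>\<^bsub>ring_of_type_algebra\<^esub> a e) es) (map (\<lambda>e. J +>\<^bsub>ring_of_type_algebra\<^esub> b e) es)
    = J +>\<^bsub>ring_of_type_algebra\<^esub> (\<Sum>e\<leftarrow>es. a e * b e)"
proof -
  interpret ideal J "ring_of_type_algebra :: 'a ring" by fact
  have "cring S" unfolding S_def by (intro quotient_is_cring cring_from_type_algebra)
  then interpret S: cring S .
  have h: "(+>\<^bsub>ring_of_type_algebra\<^esub>) J \<in> ring_hom ring_of_type_algebra S"
    unfolding S_def by (rule rcos_ring_hom)
  show ?thesis
  proof (induction es)
    case Nil
    then show ?case
      unfolding list.map S.combine.simps by (simp add: S_def FactRing_def coset_type_eq)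
  next
    case (Cons e es)
    then show ?case
      using ring_hom_memE(2,3)[OF h] by (simp add: ring_type_simps)
  qed
qed

lemma jacobian_ideal_subset:
  "jacobian_ideal \<Omega> \<subseteq> {p. \<exists>h. p = (\<Sum>i\<in>UNIV. h i * partial (i :: 'v::finite) \<Omega>)}"
    (is "_ \<subseteq> ?I")
proof -
  let ?R = "ring_of_type_algebra :: ('a, 'v) mpoly ring"
  interpret R: ring ?R by (rule ring_from_type_algebra)
  have "?I \<noteq> {}" by auto
  moreover have "a + b \<in> ?I" if "a \<in> ?I" "b \<in> ?I" for a b
  proof -
    from that obtain f g where "a = (\<Sum>i\<in>UNIV. f i * partial i \<Omega>)" "b = (\<Sum>i\<in>UNIV. g i * partial i \<Omega>)" by auto
    then have "a + b = (\<Sum>i\<in>UNIV. (f i + g i) * partial i \<Omega>)" by (simp add: distrib_right sum.distrib)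
    then show ?thesis by (auto intro!: exI[of _ "\<lambda>i. f i + g i"])
  qed
  moreover have mul: "a * b \<in> ?I" if "b \<in> ?I" for a b
  proof -
    from that obtain f where "b = (\<Sum>i\<in>UNIV. f i * partial i \<Omega>)" by auto
    then have "a * b = (\<Sum>i\<in>UNIV. (a * f i) * partial i \<Omega>)" by (simp add: sum_distrib_left mult.assoc)
    then show ?thesis by (auto intro!: exI[of _ "\<lambda>i. a * f i"])
  qed
  moreover have "- a \<in> ?I" if "a \<in> ?I" for a
    using mul[OF that, of "- 1"] by simp
  ultimately have "subgroup ?I (add_monoid ?R)"
  proof (intro R.add.subgroupI)
    fix a assume "a \<in> ?I"
    then have "- a \<in> ?I" by fact
    moreover have "\<ominus>\<^bsub>?R\<^esub> a = - a"
      by (rule R.minus_equality) (auto simp: ring_type_simps)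
    ultimately show "\<ominus>\<^bsub>?R\<^esub> a \<in> ?I" by simp
  qed (auto simp: ring_type_simps)
  then have "ideal ?I ?R"
    using mul by (intro idealI R.ring_axioms) (auto simp: ring_type_simps mult.commute)
  moreover have "partial i \<Omega> \<in> ?I" for i
    by (auto intro!: exI[of _ "\<lambda>j. unit_row j i"] simp: unit_row_def if_distrib[of "\<lambda>x. x * _"] cong: if_cong)
  ultimately show ?thesis
    unfolding jacobian_ideal_def by (intro R.genideal_minimal) auto
qed

text \<open>In a quotient of dimension n the powers 1, ..., t_j^n are dependent, which yields a
  nonzero polynomial in t_j inside the ideal. The ideal is generated by forms of one degree, so it
  contains each homogeneous component of this polynomial, and these are multiples of powers of
  t_j.\<close>

lemma power_in_jacobian_ideal:
  fixes \<Omega> :: "('k::field, 'v::finite) mpoly"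
  assumes "is_potential \<Omega>" "homogeneous d \<Omega>"
  shows "\<exists>m h. var j ^ m = (\<Sum>i\<in>UNIV. h i * partial i \<Omega>)"
proof -
  let ?R = "ring_of_type_algebra :: ('k, 'v) mpoly ring"
  let ?k = "ring_of_type_algebra :: 'k ring"
  define J where "J = jacobian_ideal \<Omega>"
  define S where "S = ?R Quot J"
  define c where "c = (\<lambda>p. J +>\<^bsub>?R\<^esub> p)"
  note J_sub = jacobian_ideal_subset[of \<Omega>, folded J_def]
  interpret R: cring ?R by (rule cring_from_type_algebra)
  have J: "ideal J ?R" unfolding J_def jacobian_ideal_def by (rule R.genideal_ideal) (simp add: ring_type_simps)
  interpret J: ideal J ?R by fact
  have "cring S" unfolding S_def by (intro J.quotient_is_cring cring_from_type_algebra)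
  then interpret S: cring S .
  have hc: "c \<in> ring_hom ?R S"
    unfolding S_def c_def by (rule J.rcos_ring_hom)
  have c0: "c p = \<zero>\<^bsub>S\<^esub> \<Longrightarrow> p \<in> J" for p
    using J.a_rcos_self[of p] by (simp add: c_def S_def FactRing_def ring_type_simps)
  show ?thesis
  proof (cases "\<one>\<^bsub>S\<^esub> = \<zero>\<^bsub>S\<^esub>")
    \<comment> \<open>The quotient is trivial, and t_j^0 = 1 lies in the ideal. Only otherwise do
      the constants form a subfield of it.\<close>
    case True
    then have "1 \<in> J"
      using c0[of 1] ring_hom_memE(4)[OF hc] by (simp add: ring_type_simps)
    then obtain h where "1 = (\<Sum>i\<in>UNIV. h i * partial i \<Omega>)" using J_sub by blast
    then have "var j ^ 0 = (\<Sum>i\<in>UNIV. h i * partial i \<Omega>)" by simp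
    then show ?thesis by (intro exI)
  next
    case False
    have hom: "ring_hom_ring ?k S (\<lambda>x. c (const x))"
    proof (intro ring_hom_ringI ring_from_type_algebra S.ring_axioms)
      fix x y :: 'k
      show "c (const x) \<in> carrier S"
        using ring_hom_memE(1)[OF hc] by (simp add: ring_type_simps)
      show "c (const (x \<otimes>\<^bsub>?k\<^esub> y)) = c (const x) \<otimes>\<^bsub>S\<^esub> c (const y)"
        using ring_hom_memE(2)[OF hc, of "const x" "const y"]
        by (simp add: ring_type_simps rhom.hom_mult[OF const_hom])
      show "c (const (x \<oplus>\<^bsub>?k\<^esub> y)) = c (const x) \<oplus>\<^bsub>S\<^esub> c (const y)"
        using ring_hom_memE(3)[OF hc, of "const x" "const y"]
        by (simp add: ring_type_simps rhom.hom_add[OF const_hom])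
      show "c (const \<one>\<^bsub>?k\<^esub>) = \<one>\<^bsub>S\<^esub>"
        using ring_hom_memE(4)[OF hc] by (simp add: ring_type_simps rhom.hom_1[OF const_hom])
    qed
    have K: "subfield (range (\<lambda>x. c (const x))) S"
      using ring_hom_ring.img_is_subfield(2)[OF hom field.carrier_is_subfield[OF field_from_type_algebra] False]
      by (simp add: ring_type_simps)
    obtain n where n: "S.dimension n (range (\<lambda>x. c (const x))) (carrier S)"
      using assms(1) unfolding is_potential_def Let_def J_def[symmetric] S_def[symmetric] c_def[symmetric]
        S.finite_dimension_def by auto
    define Us where "Us = map (\<lambda>e. c (var j ^ e)) [0..<Suc n]"
    have Us: "set Us \<subseteq> carrier S"
      using ring_hom_memE(1)[OF hc] by (auto simp: Us_def ring_type_simps)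
    have "\<not> S.independent (range (\<lambda>x. c (const x))) Us"
      using S.independent_length_le_dimension[OF K n _ Us] by (auto simp: Us_def)
    then obtain Ks where Ks: "length Ks = length Us" "S.combine Ks Us = \<zero>\<^bsub>S\<^esub>"
        "set Ks \<subseteq> range (\<lambda>x. c (const x))" "set Ks \<noteq> {\<zero>\<^bsub>S\<^esub>}"
      using S.dependent_imp_non_trivial_combine[OF K Us] by metis
    have "\<forall>e\<in>{..<Suc n}. \<exists>x. Ks ! e = c (const x)"
      using Ks(1,3) by (auto simp: Us_def dest!: subsetD[OF _ nth_mem])
    then obtain a where a: "\<And>e. e < Suc n \<Longrightarrow> Ks ! e = c (const (a e))"
      by (metis lessThan_iff)
    have KsE: "Ks = map (\<lambda>e. c (const (a e))) [0..<Suc n]"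
      using Ks(1) a by (intro nth_equalityI) (auto simp: Us_def simp del: upt_Suc)
    have "\<exists>e<Suc n. a e \<noteq> 0"
    proof (rule ccontr)
      assume "\<not> ?thesis"
      then have "set Ks = {\<zero>\<^bsub>S\<^esub>}"
        using R.a_rcos_zero[OF J, of 0] J.additive_subgroup_axioms[THEN additive_subgroup.zero_closed]
        by (auto simp: KsE ring_type_simps rhom.hom_0[OF const_hom] c_def S_def FactRing_def simp del: upt_Suc)
      then show False using Ks(4) by blast
    qed
    then obtain e where e: "e < Suc n" "a e \<noteq> 0" by blast
    define q where "q = (\<Sum>e<Suc n. const (a e) * var j ^ e)"
    have "S.combine Ks Us = c q"
      unfolding KsE Us_def c_def S_def q_def
      by (subst combine_cosets[OF J]) (simp add: sum_list_distinct_conv_sum_set atLeast0LessThan del: upt_Suc)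
    then have "q \<in> J" using Ks(2) c0 by metis
    then obtain h where h: "q = (\<Sum>i\<in>UNIV. h i * partial i \<Omega>)" using J_sub by blast
    \<comment> \<open>The component of h_i that multiplication by a partial derivative, a form of
      degree d - 1, moves to degree e.\<close>
    define b where "b = (\<lambda>i. if e < d - 1 then 0 else coeff (grad (h i)) (e - (d - 1)))"
    have "coeff (grad q) e = (\<Sum>i<Suc n. if i = e then const (a i) * var j ^ i else 0)"
      unfolding q_def rhom.homs[OF grad_hom] coeff_sum
    proof (intro sum.cong refl)
      fix i
      have "[:0, var j:] ^ i = monom ((var j :: ('k, 'v) mpoly) ^ i) i"
        by (induction i) (simp_all add: monom_Suc pCons_one[symmetric] smult_monom mult_monom one_pCons monom_0)
      then show "coeff (grad (const (a i)) * grad (var j) ^ i) e = (if i = e then const (a i) * var j ^ i else 0)"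
        by simp
    qed
    also have "\<dots> = const (a e) * var j ^ e" using e by simp
    finally have "const (a e) * var j ^ e = coeff (grad q) e" ..
    also have "\<dots> = (\<Sum>i\<in>UNIV. b i * partial i \<Omega>)"
      unfolding h rhom.homs[OF grad_hom] coeff_sum
    proof (intro sum.cong refl)
      fix i
      have "grad (partial i \<Omega>) = monom (partial i \<Omega>) (d - 1)"
        using homogeneous_partial[OF assms(2)] by (simp add: homogeneous_iff)
      then have "coeff (grad (h i) * grad (partial i \<Omega>)) e = coeff (monom (partial i \<Omega>) (d - 1) * grad (h i)) e"
        by (simp only: mult.commute)
      also have "\<dots> = b i * partial i \<Omega>"
        by (simp add: b_def coeff_monom_mult)
      finally show "coeff (grad (h i) * grad (partial i \<Omega>)) e = b i * partial i \<Omega>" .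
    qed
    finally have "const (inverse (a e)) * (const (a e) * var j ^ e)
        = const (inverse (a e)) * (\<Sum>i\<in>UNIV. b i * partial i \<Omega>)" by simp
    moreover have "const (inverse (a e)) * (const (a e) * var j ^ e) = var j ^ e"
      using e(2) by (simp add: mult.assoc[symmetric] rhom.hom_mult[OF const_hom, symmetric] rhom.hom_1[OF const_hom])
    ultimately have "var j ^ e = (\<Sum>i\<in>UNIV. (const (inverse (a e)) * b i) * partial i \<Omega>)"
      by (simp add: sum_distrib_left mult.assoc)
    then show ?thesis by (intro exI)
  qed
qed

section \<open>The Jacobian bracket\<close>

lemma case_option_upd_None: "(case_option Y f)(None := Z) = case_option Z f"
  by (auto simp: fun_eq_iff split: option.split)

lemma case_option_upd_Some: "(case_option Y f)(Some i := z) = case_option Y (f(i := z))"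
  by (auto simp: fun_eq_iff split: option.split)

text \<open>The indices other than i, listed along \<open>'n\<close>: \<open>None\<close> takes over
  the slot of i. For i = \<open>Some l\<close> the rows differ from the unit matrix with one row
  replaced by a single transposition, which is the origin of the sign \<open>sg i\<close>.\<close>

definition coords :: "'n option \<Rightarrow> 'n \<Rightarrow> 'n option" where
  "coords i k = (if i = Some k then None else Some k)"

definition sg :: "'n option \<Rightarrow> 'a::comm_ring_1" where
  "sg i = (if i = None then 1 else - 1)"

lemma sg_sg [simp]: "sg i * sg i = 1" "sg i * (sg i * x) = x"
  by (auto simp: sg_def)

lemma (in rhom) hom_sg [simp]: "h (sg i) = sg i"
  by (simp add: sg_def homs)

lemma fdet_coords:
  "fdet (case_option Y (\<lambda>k. unit_row (coords i k))) = sg i * (Y i :: 'a::comm_ring_1)"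
proof (cases i)
  case None
  then have "case_option Y (\<lambda>k. unit_row (coords i k)) = (unit_row :: 'b option \<Rightarrow> 'b option \<Rightarrow> 'a)(None := Y)"
    by (auto simp: fun_eq_iff coords_def split: option.split)
  then show ?thesis using None by (simp only: fdet_unit_row_upd) (simp add: sg_def)
next
  case (Some l)
  have 1: "case_option Y (\<lambda>k. unit_row (coords i k))
      = (unit_row :: 'b option \<Rightarrow> 'b option \<Rightarrow> 'a)(Some l := unit_row None, None := Y)"
    using Some by (auto simp: fun_eq_iff coords_def split: option.split)
  have 2: "fdet (unit_row(Some l := unit_row None, None := Y)) = - fdet (unit_row(Some l := Y, None := unit_row None))"
    by (rule fdet_swap) simp
  have 3: "unit_row(Some l := Y, None := unit_row None) = unit_row(Some l := Y)"
    by (rule ext) simp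
  show ?thesis unfolding 1 2 unfolding 3 fdet_unit_row_upd using Some by (simp add: sg_def)
qed

lemma jacobian_bracket_fdet:
  "jacobian_bracket \<Omega> f = fdet (case_option (\<lambda>j. partial j \<Omega>) (\<lambda>k j. partial j (f k)))"
  unfolding jacobian_bracket_def fdet_def
  by (rule arg_cong[where f = det]) (auto simp: vec_eq_iff split: option.split)

lemma jacobian_bracket_coords: "jacobian_bracket \<Omega> (\<lambda>k. var (coords i k)) = sg i * partial i \<Omega>"
proof -
  have "(\<lambda>k j. partial j (var (coords i k) :: ('b, 'a option) mpoly)) = (\<lambda>k. unit_row (coords i k))" for i
    by (auto simp: fun_eq_iff partial_var unit_row_def rhom.homs[OF const_hom])
  then show ?thesis by (simp only: jacobian_bracket_fdet fdet_coords)
qed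

lemma jacobian_bracket_upd:
  "jacobian_bracket \<Omega> (f(i := c))
    = fdet ((case_option (\<lambda>j. partial j \<Omega>) (\<lambda>k j. partial j (f k)))(Some i := (\<lambda>j. partial j c)))"
  unfolding jacobian_bracket_fdet
  by (rule arg_cong[where f = fdet]) (auto simp: fun_eq_iff split: option.split)

lemma jacobian_bracket_add:
  "jacobian_bracket \<Omega> (f(i := a + b)) = jacobian_bracket \<Omega> (f(i := a)) + jacobian_bracket \<Omega> (f(i := b))"
  unfolding jacobian_bracket_upd partial_add by (rule fdet_row_add)

lemma jacobian_bracket_mult:
  "jacobian_bracket \<Omega> (f(i := a * b)) = a * jacobian_bracket \<Omega> (f(i := b)) + b * jacobian_bracket \<Omega> (f(i := a))"
proof -
  have "partial j (a * b) = a * partial j b + b * partial j a" for j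
    by (simp add: deriv.D_mult[OF deriv_partial] mult.commute)
  then show ?thesis
    unfolding jacobian_bracket_upd fdet_row_mult[symmetric] fdet_row_add[symmetric] by simp
qed

lemma jacobian_bracket_potential: "jacobian_bracket \<Omega> (f(i := \<Omega>)) = 0"
  unfolding jacobian_bracket_fdet by (rule fdet_same[of None "Some i"]) auto

text \<open>A bracket with an entry \<Omega> has two equal rows, so by the Leibniz rule an entry may
  be changed by a multiple of \<Omega>. The induction changes one slot at a time.\<close>

lemma jacobian_bracket_cong_mod:
  assumes "\<And>i. \<Omega> dvd f i - g i"
  shows "\<Omega> dvd jacobian_bracket \<Omega> f - jacobian_bracket \<Omega> g"
proof -
  have "\<Omega> dvd jacobian_bracket \<Omega> (\<lambda>i. if i \<in> S then f i else g i) - jacobian_bracket \<Omega> g" if "finite S" for S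
    using that
  proof (induction S)
    case (insert i S)
    let ?u = "\<lambda>i. if i \<in> S then f i else g i"
    obtain h where "f i = g i + \<Omega> * h" using assms[of i] by (auto simp: dvd_def algebra_simps)
    then have "(\<lambda>j. if j \<in> insert i S then f j else g j) = ?u(i := g i + \<Omega> * h)" by auto
    then have "jacobian_bracket \<Omega> (\<lambda>j. if j \<in> insert i S then f j else g j)
        = jacobian_bracket \<Omega> (?u(i := g i)) + \<Omega> * jacobian_bracket \<Omega> (?u(i := h))"
      by (simp only: jacobian_bracket_add jacobian_bracket_mult jacobian_bracket_potential) simp
    also have "?u(i := g i) = ?u" using insert.hyps by auto
    finally have "jacobian_bracket \<Omega> (\<lambda>j. if j \<in> insert i S then f j else g j) - jacobian_bracket \<Omega> g
        = (jacobian_bracket \<Omega> ?u - jacobian_bracket \<Omega> g) + \<Omega> * jacobian_bracket \<Omega> (?u(i := h))"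
      by (simp only: algebra_simps)
    then show ?case
      using dvd_add[OF insert.IH dvd_triv_left] by (simp only:)
  qed simp
  from this[of UNIV] show ?thesis by simp
qed

lemma subst_cong_mod:
  fixes w :: "'a::comm_ring_1"
  assumes "rhom \<kappa>" "\<And>i. w dvd x i - y i"
  shows "w dvd subst \<kappa> x p - subst \<kappa> y p"
proof -
  interpret x: rhom "subst \<kappa> x" by (rule subst_hom) fact
  interpret y: rhom "subst \<kappa> y" by (rule subst_hom) fact
  show ?thesis
proof (induction p rule: mpoly_induct)
  case (add p q)
  have "subst \<kappa> x (p + q) - subst \<kappa> y (p + q)
      = (subst \<kappa> x p - subst \<kappa> y p) + (subst \<kappa> x q - subst \<kappa> y q)"
    by (simp add: x.hom_add y.hom_add)
  then show ?case using dvd_add[OF add] by (simp only:)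
next
  case (mult p q)
  have "subst \<kappa> x (p * q) - subst \<kappa> y (p * q)
      = subst \<kappa> x p * (subst \<kappa> x q - subst \<kappa> y q) + (subst \<kappa> x p - subst \<kappa> y p) * subst \<kappa> y q"
    by (simp add: x.hom_mult y.hom_mult algebra_simps)
  then show ?case using mult by (simp only: dvd_add dvd_mult dvd_mult2)
qed (use assms in \<open>simp_all\<close>)
qed

lemma degree_fdet:
  fixes A :: "'v::finite \<Rightarrow> 'v \<Rightarrow> 'a::comm_ring_1 poly"
  assumes "\<And>r j. degree (A r j) \<le> b r"
  shows "degree (fdet A) \<le> (\<Sum>r\<in>UNIV. b r)"
  unfolding fdet_expand
proof (intro degree_sum_le)
  fix p
  have "degree (\<Prod>i\<in>UNIV. A i (p i)) \<le> (\<Sum>r\<in>UNIV. b r)"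
    using prod_bounds[of UNIV "\<lambda>i. A i (p i)" b] assms by simp
  moreover have "of_int (sign p) * (\<Prod>i\<in>UNIV. A i (p i)) = smult (of_int (sign p)) (\<Prod>i\<in>UNIV. A i (p i))"
    by (simp add: of_int_poly)
  ultimately show "degree (of_int (sign p) * (\<Prod>i\<in>UNIV. A i (p i))) \<le> (\<Sum>r\<in>UNIV. b r)"
    using order_trans[OF degree_smult_le] by simp
qed (simp add: finite_permutations)

lemma degree_grad_partial:
  assumes "degree (grad p) \<le> Suc a"
  shows "degree (grad (partial i p)) \<le> a"
proof (rule degree_le, intro allI impI)
  fix k assume "a < k"
  have "coeff (grad (partial i p)) k = coeff (monom 1 1 * grad (partial i p)) (Suc k)"
    by (simp add: coeff_monom_mult)
  also have "\<dots> = partial i (coeff (grad p) (Suc k))"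
    unfolding grad_partial by (simp add: coeff_map_poly deriv.D_0[OF deriv_partial])
  also have "coeff (grad p) (Suc k) = 0"
    using assms \<open>a < k\<close> by (intro coeff_eq_0) simp
  finally show "coeff (grad (partial i p)) k = 0" by (simp add: deriv.D_0[OF deriv_partial])
qed

lemma sum_UNIV_option: "(\<Sum>i\<in>UNIV. f i) = f None + (\<Sum>i\<in>UNIV. f (Some (i :: 'n::finite)))"
  by (simp add: UNIV_option_conv sum.reindex)

section \<open>Reduction to linear maps\<close>

definition ev0 :: "('k::comm_ring_1, 'v::finite) mpoly \<Rightarrow> 'k" where
  "ev0 = subst (\<lambda>c. c) (\<lambda>_. 0)"

lemma ev0_hom: "rhom (ev0 :: ('k::comm_ring_1, 'v::finite) mpoly \<Rightarrow> 'k)"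
  unfolding ev0_def by (intro subst_hom rhom_id)

lemma ev0_homogeneous: "homogeneous e p \<Longrightarrow> e > 0 \<Longrightarrow> ev0 p = 0"
  unfolding ev0_def by (rule subst_zero)

lemma coeff_grad_0: "coeff (grad p) 0 = const (ev0 p)"
proof -
  have "poly (grad p) 0 = const (ev0 p)"
    by (rule hom_eqI[OF rhom_comp[OF _ grad_hom] rhom_comp[OF const_hom ev0_hom]])
      (auto simp: rhom_def ev0_def rhom_id rhom.hom_0[OF const_hom])
  then show ?thesis by (simp add: poly_0_coeff_0)
qed

text \<open>Every component of a multiple of w has degree at least d.\<close>

lemma homogeneous_dvd_0:
  fixes w :: "('k::comm_ring_1, 'v::finite) mpoly"
  assumes "homogeneous d w" "homogeneous e p" "e < d" "w dvd p"
  shows "p = 0"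
proof -
  obtain q where "p = w * q" using assms(4) by (auto simp: dvd_def)
  then have "coeff (grad p) e = coeff (monom w d * grad q) e"
    using assms(1) by (simp add: rhom.hom_mult[OF grad_hom] homogeneous_iff)
  then show ?thesis
    using assms(2,3) by (simp add: homogeneous_iff coeff_monom_mult)
qed

text \<open>Images of the variables are the columns, as in \<open>linear_part\<close>, so that
  composition of maps is the product of matrices in the same order.\<close>

definition lin :: "'k::comm_ring_1 ^ 'v ^ 'v \<Rightarrow> 'v \<Rightarrow> ('k, 'v::finite) mpoly" where
  "lin M j = (\<Sum>i\<in>UNIV. const (M $ i $ j) * var i)"

definition phi :: "'k::comm_ring_1 ^ 'v ^ 'v \<Rightarrow> ('k, 'v::finite) mpoly \<Rightarrow> ('k, 'v) mpoly" where
  "phi M = subst const (lin M)"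

lemma phi_hom: "rhom (phi M :: ('k::comm_ring_1, 'v::finite) mpoly \<Rightarrow> _)"
  unfolding phi_def by (intro subst_hom const_hom)

lemma phi_const [simp]: "phi M (const c) = const c"
  by (simp add: phi_def const_hom)

lemma phi_var [simp]: "phi M (var j) = lin M j"
  by (simp add: phi_def const_hom)

lemma homogeneous_lin: "homogeneous 1 (lin M j)"
  unfolding lin_def by (rule homogeneous_linear)

lemma homogeneous_phi: "homogeneous e p \<Longrightarrow> homogeneous e (phi M p)"
  unfolding phi_def by (rule homogeneous_subst[OF _ homogeneous_lin])

lemma partial_lin: "partial l (lin M j) = const (M $ l $ j)"
proof -
  have "partial l (lin M j) = (\<Sum>i\<in>UNIV. const (M $ i $ j) * unit_row i l)"
    unfolding lin_def deriv.D_sum[OF deriv_partial] deriv.D_mult[OF deriv_partial]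
    by (intro sum.cong) (auto simp: partial_var unit_row_def rhom.homs[OF const_hom])
  then show ?thesis by (simp only: sum_unit_row)
qed

lemma partial_phi: "partial l (phi M p) = (\<Sum>i\<in>UNIV. phi M (partial i p) * const (M $ l $ i))"
  unfolding phi_def using deriv_subst[OF deriv_partial const_hom, of l "lin M" p]
  by (simp add: partial_lin)

locale potential =
  fixes \<Omega> :: "('k::field_char_0, 'n::{finite,linorder} option) mpoly" and d :: nat
  assumes card_ge: "CARD('n) \<ge> 3" and pot: "is_potential \<Omega>" and hom\<Omega>: "homogeneous d \<Omega>"
    and d_ge: "d \<ge> CARD('n) + 3"
begin

text \<open>\<open>rel w x\<close> says that $t_i \mapsto x_i$ preserves the brackets of the coordinates modulo $w$.
  It is used with $w = 0$ for $A_\Omega$ and with $w = \Omega$ for $P_\Omega$.\<close>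

definition rel :: "('k, 'n option) mpoly \<Rightarrow> ('n option \<Rightarrow> ('k, 'n option) mpoly) \<Rightarrow> bool" where
  "rel w x \<longleftrightarrow> (\<forall>i. w dvd sg i * subst const x (partial i \<Omega>) - jacobian_bracket \<Omega> (\<lambda>k. x (coords i k)))"

lemma d_gt: "d - 1 > 0" "d > 0" "d - 1 > CARD('n)" "d > 1"
  using d_ge card_ge by auto

lemma hom_partial: "homogeneous (d - 1) (partial i \<Omega>)"
  by (rule homogeneous_partial[OF hom\<Omega>])

lemma grad_partial_potential: "grad (partial i \<Omega>) = monom (partial i \<Omega>) (d - 1)"
  using hom_partial homogeneous_iff by blast

text \<open>Substitution into the expression of a power of t_j by the partial derivatives. It is
  used with w = 0, where it says that the gradient vanishes only at 0, with w = \<Omega>, and with w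
  a prime or a denominator in K[X].\<close>

lemma dvd_power_if_dvd_partials:
  assumes "rhom \<kappa>" "\<And>i. w dvd subst \<kappa> x (partial i \<Omega>)"
  shows "\<exists>m. w dvd x j ^ m"
proof -
  interpret s: rhom "subst \<kappa> x" by (rule subst_hom) fact
  obtain m h where "var j ^ m = (\<Sum>i\<in>UNIV. h i * partial i \<Omega>)"
    using power_in_jacobian_ideal[OF pot hom\<Omega>] by blast
  then have "subst \<kappa> x (var j ^ m) = (\<Sum>i\<in>UNIV. subst \<kappa> x (h i) * subst \<kappa> x (partial i \<Omega>))"
    by (simp add: s.homs)
  moreover have "w dvd \<dots>" using assms(2) by (intro dvd_sum dvd_mult)
  ultimately have "w dvd subst \<kappa> x (var j ^ m)" by (simp only:)
  then show ?thesis using assms(1) by (auto simp: s.hom_power)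
qed

lemma zero_if_partials_zero:
  fixes x :: "'n option \<Rightarrow> 'b::idom"
  assumes "rhom \<kappa>" "\<And>i. subst \<kappa> x (partial i \<Omega>) = 0"
  shows "x j = 0"
  using dvd_power_if_dvd_partials[OF assms(1), of 0 x j] assms(2) by (auto simp: power_eq_0_iff)

lemma potential_nonzero: "\<Omega> \<noteq> 0"
proof
  assume "\<Omega> = 0"
  then have "var (None :: 'n option) = (0 :: ('k, 'n option) mpoly)"
    using zero_if_partials_zero[OF const_hom, of "var"]
    by (simp add: deriv.D_0[OF deriv_partial])
  then have "Poly_Mapping.lookup (var (None :: 'n option) :: ('k, 'n option) mpoly) (Poly_Mapping.single None 1) = 0"
    by simp
  then show False by (simp add: var_def)
qed

lemma rel_cong:
  assumes w: "w = 0 \<or> w = \<Omega>" and "rel w x" "\<And>i. w dvd x i - y i"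
  shows "rel w y"
  unfolding rel_def
proof
  fix i
  let ?A = "subst const x (partial i \<Omega>)" and ?B = "subst const y (partial i \<Omega>)"
  let ?C = "jacobian_bracket \<Omega> (\<lambda>k. x (coords i k))" and ?D = "jacobian_bracket \<Omega> (\<lambda>k. y (coords i k))"
  have 1: "w dvd sg i * ?A - ?C" using assms(2) by (simp add: rel_def)
  have 2: "w dvd sg i * (?A - ?B)"
    by (intro dvd_mult subst_cong_mod const_hom assms(3))
  have 3: "w dvd ?C - ?D"
  proof (cases "w = 0")
    case True
    then have "x = y" using assms(3) by (auto simp: fun_eq_iff)
    then show ?thesis by simp
  next
    case False
    then show ?thesis using w assms(3) by (intro jacobian_bracket_cong_mod[THEN dvd_trans[rotated]]) auto
  qed
  have "sg i * ?B - ?D = (sg i * ?A - ?C) - sg i * (?A - ?B) + (?C - ?D)"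
    by (simp add: algebra_simps)
  then show "w dvd sg i * ?B - ?D"
    using dvd_add[OF dvd_diff[OF 1 2] 3] by (simp only:)
qed

text \<open>In the bracket, the gradient row has degree d - 1 and each of the n other rows at most
  a. Since d - 1 > n and a > 0, the total (d - 1) + n a stays below N = (d - 1)(a + 1), so in degree
  N only the gradient at the top components is left. As w is homogeneous, a multiple of w has
  components that are multiples of w.\<close>

lemma dvd_top_components:
  assumes w: "homogeneous d w" and rel: "rel w x"
    and deg: "\<And>i. degree (grad (x i)) \<le> Suc a" and "a > 0"
  shows "w dvd subst const (\<lambda>i. coeff (grad (x i)) (Suc a)) (partial i \<Omega>)"
proof -
  define N where "N = (d - 1) * Suc a"
  obtain g where g: "sg i * subst const x (partial i \<Omega>) - jacobian_bracket \<Omega> (\<lambda>k. x (coords i k)) = w * g"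
    using rel by (auto simp: rel_def dvd_def)
  have 1: "coeff (grad (subst const x (partial i \<Omega>))) N
      = subst const (\<lambda>i. coeff (grad (x i)) (Suc a)) (partial i \<Omega>)"
    unfolding N_def by (simp only: hom_subst[OF grad_hom] grad_const) (rule subst_bounds[OF hom_partial deg])
  define A where "A = (\<lambda>r j. grad (case_option (\<lambda>j. partial j \<Omega>) (\<lambda>k j. partial j (x (coords i k))) r j))"
  have "degree (A r j) \<le> case_option (d - 1) (\<lambda>_. a) r" for r j
    unfolding A_def
    by (cases r) (auto simp: grad_partial_potential degree_monom_le intro!: degree_grad_partial deg)
  then have "degree (fdet A) \<le> (\<Sum>r\<in>UNIV. case_option (d - 1) (\<lambda>_ :: 'n. a) r)"
    by (rule degree_fdet)
  also have "fdet A = grad (jacobian_bracket \<Omega> (\<lambda>k. x (coords i k)))"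
    unfolding jacobian_bracket_fdet rhom.hom_fdet[OF grad_hom] A_def ..
  also have "(\<Sum>r\<in>UNIV. case_option (d - 1) (\<lambda>_ :: 'n. a) r) = (d - 1) + CARD('n) * a"
    by (simp add: sum_UNIV_option)
  also have "\<dots> < N"
    using mult_strict_right_mono[OF d_gt(3) \<open>a > 0\<close>] by (simp only: N_def mult_Suc_right add_less_cancel_left)
  finally have 2: "coeff (grad (jacobian_bracket \<Omega> (\<lambda>k. x (coords i k)))) N = 0"
    by (rule coeff_eq_0)
  have "grad (sg i :: ('k, 'n option) mpoly) = [:sg i:]"
    by (cases i) (simp_all add: sg_def rhom.homs[OF grad_hom] one_pCons)
  then have "sg i * subst const (\<lambda>i. coeff (grad (x i)) (Suc a)) (partial i \<Omega>)
      = coeff (grad (sg i * subst const x (partial i \<Omega>) - jacobian_bracket \<Omega> (\<lambda>k. x (coords i k)))) N"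
    by (simp add: rhom.hom_diff[OF grad_hom] rhom.hom_mult[OF grad_hom] 1 2)
  also have "\<dots> = coeff (monom w d * grad g) N"
    using w by (simp only: g rhom.hom_mult[OF grad_hom] homogeneous_iff)
  also have "w dvd \<dots>"
    by (simp only: coeff_monom_mult) auto
  finally have "w dvd sg i * (sg i * subst const (\<lambda>i. coeff (grad (x i)) (Suc a)) (partial i \<Omega>))"
    by (rule dvd_mult)
  then show ?thesis by simp
qed

text \<open>Some power of each top component is a multiple of w, so by \<open>rad\<close> the
  component itself is. Subtracting it changes neither the class modulo w nor \<open>rel\<close>, and
  lowers the degree.\<close>

lemma reduce_degree:
  assumes w: "w = 0 \<or> w = \<Omega>" and rad: "\<And>f m. w dvd f ^ m \<Longrightarrow> w dvd f"
    and "rel w x" "\<And>i. degree (grad (x i)) \<le> Suc a"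
  shows "\<exists>y. (\<forall>i. w dvd x i - y i) \<and> (\<forall>i. degree (grad (y i)) \<le> 1)"
  using assms(3,4)
proof (induction a arbitrary: x)
  case 0
  then show ?case by (intro exI[of _ x]) auto
next
  case (Suc a)
  have homw: "homogeneous d w"
    using w hom\<Omega> by (auto simp: homogeneous_def)
  define t where "t = (\<lambda>i. coeff (grad (x i)) (Suc (Suc a)))"
  have "w dvd t j" for j
    using dvd_power_if_dvd_partials[OF const_hom, of w t j]
      dvd_top_components[OF homw Suc.prems(1,2)] rad unfolding t_def by blast
  moreover have "degree (grad (x i - t i)) \<le> Suc a" for i
  proof (rule degree_le, intro allI impI)
    fix k assume "Suc a < k"
    have "grad (t i) = monom (t i) (Suc (Suc a))"
      unfolding t_def homogeneous_iff[symmetric] by (rule homogeneous_coeff_grad)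
    then show "coeff (grad (x i - t i)) k = 0"
      using \<open>Suc a < k\<close> Suc.prems(2)[of i]
      by (cases "k = Suc (Suc a)") (auto simp: rhom.hom_diff[OF grad_hom] t_def intro!: coeff_eq_0)
  qed
  moreover have "rel w (\<lambda>i. x i - t i)"
    using \<open>\<And>j. w dvd t j\<close> by (intro rel_cong[OF w Suc.prems(1)]) simp
  ultimately obtain y where y: "\<And>i. w dvd x i - t i - y i" "\<And>i. degree (grad (y i)) \<le> 1"
    using Suc.IH[of "\<lambda>i. x i - t i"] by blast
  have "w dvd x i - y i" for i
    using dvd_add[OF \<open>\<And>j. w dvd t j\<close> y(1), of i i] by simp
  then show ?case using y(2) by blast
qed

lemma ev0_bracket: "ev0 (jacobian_bracket \<Omega> f) = 0"
proof -
  have "ev0 (jacobian_bracket \<Omega> f) = fdet ((case_option (\<lambda>_. 0) (\<lambda>k j. ev0 (partial j (f k))))(None := (\<lambda>_. 0)))"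
    unfolding jacobian_bracket_fdet rhom.hom_fdet[OF ev0_hom]
    by (rule arg_cong[where f = fdet])
      (auto simp: fun_eq_iff ev0_homogeneous[OF hom_partial d_gt(1)] split: option.split)
  then show ?thesis by (simp only: fdet_row_0)
qed

text \<open>For linear forms both sides of the relation are forms of degree d - 1, and a form of
  that degree divisible by w is 0. So the relation modulo w becomes exact, which is why
  automorphisms of the quotient lift.\<close>

lemma rel_linear:
  assumes w: "w = 0 \<or> w = \<Omega>" and rad: "\<And>f m. w dvd f ^ m \<Longrightarrow> w dvd f" and "rel w x"
  shows "\<exists>M. (\<forall>i. w dvd x i - lin M i) \<and> rel 0 (lin M)"
proof -
  have homw: "homogeneous d w"
    using w hom\<Omega> by (auto simp: homogeneous_def)
  define a where "a = (\<Sum>i\<in>UNIV. degree (grad (x i)))"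
  have "degree (grad (x i)) \<le> Suc a" for i
    unfolding a_def by (intro le_SucI member_le_sum) auto
  then have "\<exists>y. (\<forall>i. w dvd x i - y i) \<and> (\<forall>i. degree (grad (y i)) \<le> 1)"
    by (intro reduce_degree[OF w _ assms(3)]) (rule rad)
  then obtain y where y: "\<And>i. w dvd x i - y i" "\<And>i. degree (grad (y i)) \<le> 1"
    by blast
  have rel: "rel w y" by (rule rel_cong[OF w assms(3) y(1)])
  \<comment> \<open>At 0 the gradient row of each bracket vanishes, and so does w. Hence the
    gradient of \<Omega> vanishes at the vector of constant terms.\<close>
  have "ev0 (y j) = 0" for j
  proof (rule zero_if_partials_zero[OF rhom_id])
    fix i
    obtain g where g: "sg i * subst const y (partial i \<Omega>) - jacobian_bracket \<Omega> (\<lambda>k. y (coords i k)) = w * g"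
      using rel by (auto simp: rel_def dvd_def)
    have "ev0 w = 0" by (rule ev0_homogeneous[OF homw d_gt(2)])
    then have "sg i * ev0 (subst const y (partial i \<Omega>)) = 0"
      using arg_cong[OF g, of ev0] by (simp add: rhom.homs[OF ev0_hom] rhom.hom_sg[OF ev0_hom] ev0_bracket)
    then have "ev0 (subst const y (partial i \<Omega>)) = 0"
      by (metis sg_sg(2) mult_zero_right)
    then show "subst (\<lambda>x. x) (\<lambda>j. ev0 (y j)) (partial i \<Omega>) = 0"
      by (simp add: hom_subst[OF ev0_hom]) (simp add: ev0_def rhom_id)
  qed
  then have "homogeneous 1 (y i)" for i
  proof -
    have "coeff (grad (y i)) k = coeff (monom (coeff (grad (y i)) 1) 1) k" for k
      using y(2)[of i] \<open>ev0 (y i) = 0\<close>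
      by (cases "k = 0"; cases "k = 1") (auto simp: coeff_grad_0 rhom.hom_0[OF const_hom] intro!: coeff_eq_0)
    then have "grad (y i) = monom (coeff (grad (y i)) 1) 1" by (intro poly_eqI)
    moreover from this have "y i = coeff (grad (y i)) 1"
      using poly_grad_1[of "y i"] by (simp add: poly_monom) (metis mult_1 poly_monom power_one mult.right_neutral)
    ultimately show ?thesis by (simp add: homogeneous_iff)
  qed
  then have "y j = lin (\<chi> i j. Poly_Mapping.lookup (y j) (Poly_Mapping.single i 1)) j" for j
    unfolding lin_def vec_lambda_beta by (intro homogeneous_1_expand)
  then obtain M where M: "y = lin M" by blast
  have "rel 0 (lin M)"
    unfolding rel_def
  proof
    fix i
    have "jacobian_bracket \<Omega> (\<lambda>k. lin M (coords i k))
        = fdet (case_option (\<lambda>j. partial j \<Omega>) (\<lambda>k j. const (M $ j $ coords i k)))"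
      by (simp only: jacobian_bracket_fdet partial_lin)
    then have "grad (jacobian_bracket \<Omega> (\<lambda>k. lin M (coords i k)))
        = fdet (\<lambda>r j. grad (case_option (\<lambda>j. partial j \<Omega>) (\<lambda>k j. const (M $ j $ coords i k)) r j))"
      by (simp only: rhom.hom_fdet[OF grad_hom])
    also have "(\<lambda>r j. grad (case_option (\<lambda>j. partial j \<Omega>) (\<lambda>k j. const (M $ j $ coords i k)) r j))
        = (case_option (\<lambda>j. 0) (\<lambda>k j. [:const (M $ j $ coords i k):]))(None := (\<lambda>j. monom 1 (d - 1) * [:partial j \<Omega>:]))"
      by (auto simp: fun_eq_iff grad_partial_potential mult_monom monom_0[symmetric] split: option.split)
    also have "fdet \<dots> = monom 1 (d - 1) *
        fdet ((case_option (\<lambda>j. 0) (\<lambda>k j. [:const (M $ j $ coords i k):]))(None := (\<lambda>j. [:partial j \<Omega>:])))"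
      by (rule fdet_row_mult)
    also have "(case_option (\<lambda>j. 0) (\<lambda>k j. [:const (M $ j $ coords i k):]))(None := (\<lambda>j. [:partial j \<Omega>:]))
      = (\<lambda>r j. [:case_option (\<lambda>j. partial j \<Omega>) (\<lambda>k j. const (M $ j $ coords i k)) r j:])"
      by (auto simp: fun_eq_iff split: option.split)
    finally have "grad (jacobian_bracket \<Omega> (\<lambda>k. lin M (coords i k)))
       = monom (jacobian_bracket \<Omega> (\<lambda>k. lin M (coords i k))) (d - 1)"
      by (simp only: rhom.hom_fdet[OF const_poly_hom[OF rhom_id], symmetric] jacobian_bracket_fdet partial_lin)
        (simp add: monom_0[symmetric] mult_monom)
    then have 1: "homogeneous (d - 1) (jacobian_bracket \<Omega> (\<lambda>k. lin M (coords i k)))"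
      by (simp add: homogeneous_iff)
    have "homogeneous (d - 1) (subst const (lin M) (partial i \<Omega>))"
      by (intro homogeneous_subst hom_partial homogeneous_lin)
    then have "homogeneous (d - 1) (sg i * subst const (lin M) (partial i \<Omega>) - jacobian_bracket \<Omega> (\<lambda>k. lin M (coords i k)))"
      using 1 by (cases i) (auto simp: homogeneous_iff sg_def rhom.homs[OF grad_hom] poly_eq_iff)
    then show "0 dvd sg i * subst const (lin M) (partial i \<Omega>) - jacobian_bracket \<Omega> (\<lambda>k. lin M (coords i k))"
      using homogeneous_dvd_0[OF homw] rel[unfolded M rel_def] d_gt by (metis diff_less zero_less_one dvd_refl)
  qed
  then show ?thesis using y(1) M by blast
qed

end

section \<open>Linear automorphisms\<close>

lemma phi_linear:
  "phi M (\<Sum>j\<in>UNIV. const (c $ j) * var j) = (\<Sum>i\<in>UNIV. const ((M *v c) $ i) * var i)"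
proof -
  have "phi M (\<Sum>j\<in>UNIV. const (c $ j) * var j)
      = (\<Sum>j\<in>UNIV. \<Sum>i\<in>UNIV. const (M $ i $ j * c $ j) * var i)"
    by (simp add: rhom.homs[OF phi_hom] lin_def sum_distrib_left rhom.homs[OF const_hom] mult_ac)
  also have "\<dots> = (\<Sum>i\<in>UNIV. \<Sum>j\<in>UNIV. const (M $ i $ j * c $ j) * var i)"
    by (rule sum.swap)
  also have "\<dots> = (\<Sum>i\<in>UNIV. const ((M *v c) $ i) * var i)"
    by (simp add: matrix_vector_mult_def rhom.homs[OF const_hom] sum_distrib_right)
  finally show ?thesis .
qed

lemma phi_phi: "phi M (phi N p) = phi (M ** N) p"
proof (rule hom_eqI[OF rhom_comp[OF phi_hom phi_hom] phi_hom])
  fix j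
  have "lin N j = (\<Sum>i\<in>UNIV. const (column j N $ i) * var i)"
    by (simp add: lin_def column_def)
  then have "phi M (lin N j) = (\<Sum>i\<in>UNIV. const ((M *v column j N) $ i) * var i)"
    by (simp only: phi_linear)
  then show "phi M (phi N (var j)) = phi (M ** N) (var j)"
    by (simp add: lin_def matrix_vector_mult_def matrix_matrix_mult_def column_def)
qed simp

lemma phi_mat_1 [simp]: "phi (mat 1) p = p"
proof -
  have "lin (mat 1) j = (var j :: ('b, 'a) mpoly)" for j
  proof -
    have "lin (mat 1) j = (\<Sum>i\<in>UNIV. if i = j then var i else (0 :: ('b, 'a) mpoly))"
      unfolding lin_def by (intro sum.cong) (auto simp: mat_def rhom.homs[OF const_hom])
    then show ?thesis by simp
  qed
  then have "lin (mat 1) = (var :: 'a \<Rightarrow> ('b, 'a) mpoly)" by (rule ext)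
  then show ?thesis unfolding phi_def by simp
qed

lemma lookup_lin: "Poly_Mapping.lookup (lin M j) (Poly_Mapping.single i 1) = M $ i $ j"
  unfolding lin_def by (rule lookup_linear)

lemma linear_part_phi: "linear_part (phi M) = M"
  using lookup_lin[of M] by (simp add: linear_part_def vec_eq_iff)

lemma phi_eq_iff: "phi (M :: 'k::field ^ 'v::finite ^ 'v) = phi N \<longleftrightarrow> M = N"
  by (auto dest: arg_cong[where f = linear_part] simp: linear_part_phi)

lemma inj_imp_invertible:
  fixes M :: "'k::field ^ 'v::finite ^ 'v"
  assumes "\<And>c. (\<Sum>i\<in>UNIV. const ((M *v c) $ i) * var i) = 0 \<Longrightarrow> (\<Sum>i\<in>UNIV. const (c $ i) * var i :: ('k, 'v) mpoly) = 0"
  shows "invertible M"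
proof -
  have "c = 0" if "M *v c = 0" for c
  proof -
    have "(\<Sum>i\<in>UNIV. const ((M *v c) $ i) * var i) = (0 :: ('k, 'v) mpoly)"
      using that by (simp add: rhom.homs[OF const_hom])
    from assms[OF this] have "(\<Sum>i\<in>UNIV. const (c $ i) * var i) = (0 :: ('k, 'v) mpoly)" .
    then show ?thesis
      using lookup_linear[of "\<lambda>i. c $ i"] by (simp add: vec_eq_iff)
  qed
  then show ?thesis
    using matrix_left_invertible_ker[of M] invertible_left_inverse[of M] by blast
qed

lemma const_eq_0_iff [simp]: "const c = 0 \<longleftrightarrow> c = 0"
  by (metis const_def lookup_single_eq lookup_zero single_zero)

definition linear_auts :: "('k::field, 'v::finite) mpoly \<Rightarrow> ('k ^ 'v ^ 'v) set" where
  "linear_auts \<Omega> = {M. invertible M \<and> phi M \<Omega> = const (det M) * \<Omega>}"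

lemma linear_auts_mult: "M \<in> linear_auts \<Omega> \<Longrightarrow> N \<in> linear_auts \<Omega> \<Longrightarrow> M ** N \<in> linear_auts \<Omega>"
  by (simp add: linear_auts_def phi_phi[symmetric] rhom.hom_mult[OF phi_hom] det_mul
      rhom.hom_mult[OF const_hom] invertible_mult mult_ac)

lemma linear_auts_1: "mat 1 \<in> linear_auts \<Omega>"
  by (simp add: linear_auts_def rhom.hom_1[OF const_hom] invertible_def)

lemma linear_auts_inv:
  assumes "M \<in> linear_auts \<Omega>" "M ** N = mat 1"
  shows "N \<in> linear_auts \<Omega>"
proof -
  have N: "N ** M = mat 1" using assms(2) by (simp add: matrix_left_right_inverse)
  have inv: "invertible N" using N assms(2) by (auto simp: invertible_def)
  have "\<Omega> = phi N (phi M \<Omega>)" by (simp add: phi_phi N)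
  also have "\<dots> = const (det M) * phi N \<Omega>"
    using assms(1) by (simp add: linear_auts_def rhom.hom_mult[OF phi_hom])
  finally have "const (det N) * \<Omega> = const (det N) * (const (det M) * phi N \<Omega>)"
    by (rule arg_cong)
  also have "\<dots> = const (det N * det M) * phi N \<Omega>"
    by (simp add: rhom.hom_mult[OF const_hom] mult.assoc)
  also have "det N * det M = 1" by (simp add: det_mul[symmetric] N)
  finally show ?thesis using inv by (simp add: linear_auts_def rhom.hom_1[OF const_hom])
qed

text \<open>Multiplication by det M turns the gradient row into the gradient of
  \<open>phi M \<Omega>\<close>. Then the chain rule applies to all rows alike and splits off the
  transpose of M, whose determinant cancels the factor.\<close>

lemma jacobian_bracket_phi:
  fixes \<Omega> :: "('k::field_char_0, 'n::{finite,linorder} option) mpoly"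
  assumes "M \<in> linear_auts \<Omega>"
  shows "jacobian_bracket \<Omega> (\<lambda>i. phi M (f i)) = phi M (jacobian_bracket \<Omega> f)"
proof -
  let ?\<delta> = "const (det M) :: ('k, 'n option) mpoly"
  let ?Z = "\<lambda>r j. phi M (case_option (\<lambda>j. partial j \<Omega>) (\<lambda>k j. partial j (f k)) r j)"
  have \<Omega>: "phi M \<Omega> = ?\<delta> * \<Omega>" and "det M \<noteq> 0"
    using assms by (auto simp: linear_auts_def invertible_det_nz)
  have d: "?\<delta> * partial l \<Omega> = partial l (phi M \<Omega>)" for l
    unfolding \<Omega> by (simp add: deriv.D_mult[OF deriv_partial])
  have "?\<delta> * jacobian_bracket \<Omega> (\<lambda>i. phi M (f i))
      = fdet ((case_option (\<lambda>j. partial j \<Omega>) (\<lambda>k j. partial j (phi M (f k))))(None := (\<lambda>j. ?\<delta> * partial j \<Omega>)))"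
    unfolding fdet_row_mult unfolding case_option_upd_None jacobian_bracket_fdet ..
  also have "(case_option (\<lambda>j. partial j \<Omega>) (\<lambda>k j. partial j (phi M (f k))))(None := (\<lambda>j. ?\<delta> * partial j \<Omega>))
      = (\<lambda>r j. \<Sum>i\<in>UNIV. ?Z r i * const (transpose M $ i $ j))"
    unfolding d by (auto simp: fun_eq_iff partial_phi transpose_def split: option.split)
  also have "fdet \<dots> = fdet ?Z * fdet (\<lambda>i j. const (transpose M $ i $ j))"
    by (rule fdet_mult)
  also have "fdet (\<lambda>i j. const (transpose M $ i $ j)) = ?\<delta>"
    unfolding rhom.hom_fdet[OF const_hom, symmetric] by (simp add: fdet_def det_transpose)
  also have "fdet ?Z = phi M (jacobian_bracket \<Omega> f)"
    unfolding jacobian_bracket_fdet rhom.hom_fdet[OF phi_hom] ..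
  finally have "?\<delta> * jacobian_bracket \<Omega> (\<lambda>i. phi M (f i)) = ?\<delta> * phi M (jacobian_bracket \<Omega> f)"
    by (simp add: mult.commute)
  moreover have "?\<delta> \<noteq> 0"
    using \<open>det M \<noteq> 0\<close> by simp
  ultimately show ?thesis by simp
qed

context potential begin

text \<open>Splitting the transpose of M off the bracket identifies \<Omega>_{t_i}(M t) with det M
  times the i-th entry of the inverse of M applied to the gradient. So \<Omega>(M t) and det M *
  \<Omega> have the same gradient, and they are forms of the same positive degree.\<close>

lemma rel_0_linear_auts:
  assumes "rel 0 (lin M)" "invertible M"
  shows "M \<in> linear_auts \<Omega>"
proof -
  let ?\<delta> = "const (det M) :: ('k, 'n option) mpoly"
  obtain N where N: "M ** N = mat 1" using assms(2) by (auto simp: invertible_def)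
  \<comment> \<open>Chosen so that Y times the transpose of M is the gradient row; then every row of
    the bracket has the factor in common.\<close>
  define Y where "Y = (\<lambda>l. \<Sum>k\<in>UNIV. partial k \<Omega> * const (N $ l $ k))"
  have Y: "(\<Sum>l\<in>UNIV. Y l * const (transpose M $ l $ j)) = partial j \<Omega>" for j
  proof -
    have "(\<Sum>l\<in>UNIV. Y l * const (transpose M $ l $ j))
        = (\<Sum>l\<in>UNIV. \<Sum>k\<in>UNIV. partial k \<Omega> * const (M $ j $ l * N $ l $ k))"
      by (simp add: Y_def transpose_def sum_distrib_left rhom.homs[OF const_hom] mult_ac)
    also have "\<dots> = (\<Sum>k\<in>UNIV. partial k \<Omega> * const ((M ** N) $ j $ k))"
      by (subst sum.swap) (simp add: matrix_matrix_mult_def rhom.homs[OF const_hom] sum_distrib_left)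
    also have "\<dots> = (\<Sum>k\<in>UNIV. partial k \<Omega> * unit_row k j)"
      unfolding N by (intro sum.cong) (auto simp: mat_def unit_row_def rhom.homs[OF const_hom])
    finally show ?thesis by (simp only: sum_unit_row)
  qed
  have key: "phi M (partial i \<Omega>) = ?\<delta> * Y i" for i
  proof -
    have "sg i * phi M (partial i \<Omega>) = jacobian_bracket \<Omega> (\<lambda>k. lin M (coords i k))"
      using assms(1) by (simp add: rel_def phi_def)
    also have "\<dots> = fdet (\<lambda>r j. \<Sum>l\<in>UNIV. case_option Y (\<lambda>k. unit_row (coords i k)) r l * const (transpose M $ l $ j))"
      unfolding jacobian_bracket_fdet
    proof (intro arg_cong[where f = fdet] ext)
      fix r j
      show "case_option (\<lambda>j. partial j \<Omega>) (\<lambda>k j. partial j (lin M (coords i k))) r j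
        = (\<Sum>l\<in>UNIV. case_option Y (\<lambda>k. unit_row (coords i k)) r l * const (transpose M $ l $ j))"
      proof (cases r)
        case (Some k)
        have "(\<Sum>l\<in>UNIV. unit_row (coords i k) l * const (transpose M $ l $ j))
            = (\<Sum>l\<in>UNIV. (const (transpose M $ l $ j) :: ('k, 'n option) mpoly) * unit_row l (coords i k))"
          by (intro sum.cong) (auto simp: unit_row_def)
        also have "\<dots> = const (M $ j $ coords i k)"
          by (simp only: sum_unit_row) (simp add: transpose_def)
        finally show ?thesis using Some by (simp add: partial_lin)
      qed (simp add: Y)
    qed
    also have "\<dots> = fdet (case_option Y (\<lambda>k. unit_row (coords i k))) * fdet (\<lambda>i j. const (transpose M $ i $ j))"
      by (rule fdet_mult)
    also have "\<dots> = sg i * (?\<delta> * Y i)"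
      unfolding fdet_coords rhom.hom_fdet[OF const_hom, symmetric]
      by (simp add: fdet_def det_transpose mult_ac)
    finally have "sg i * (sg i * phi M (partial i \<Omega>)) = sg i * (sg i * (?\<delta> * Y i))"
      by (rule arg_cong)
    then show ?thesis by (simp only: sg_sg)
  qed
  let ?D = "phi M \<Omega> - ?\<delta> * \<Omega>"
  have "homogeneous d ?D"
    using hom\<Omega> homogeneous_phi[OF hom\<Omega>, of M]
    by (auto simp: homogeneous_iff rhom.homs[OF grad_hom] poly_eq_iff)
  moreover have "partial l ?D = 0" for l
  proof -
    have "partial l (phi M \<Omega>) = ?\<delta> * (\<Sum>i\<in>UNIV. Y i * const (transpose M $ i $ l))"
      unfolding partial_phi key by (simp add: sum_distrib_left transpose_def mult_ac)
    then show ?thesis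
      unfolding Y by (simp add: deriv.D_diff[OF deriv_partial] deriv.D_mult[OF deriv_partial])
  qed
  ultimately have "?D = 0"
    using homogeneous_zero_gradient d_gt(2) by blast
  then show ?thesis using assms(2) by (simp add: linear_auts_def)
qed

lemma linear_auts_gradient:
  assumes "M \<in> linear_auts \<Omega>"
  shows "(\<Sum>i\<in>UNIV. phi M (partial i \<Omega>) * const (M $ l $ i)) = const (det M) * partial l \<Omega>"
proof -
  have "partial l (phi M \<Omega>) = const (det M) * partial l \<Omega>"
    using assms by (simp add: linear_auts_def deriv.D_mult[OF deriv_partial])
  then show ?thesis by (simp add: partial_phi)
qed

end

section \<open>Derivations of fraction fields\<close>

abbreviation emb :: "'a::idom \<Rightarrow> 'a fract" where "emb a \<equiv> Fract a 1"

lemma emb_hom: "rhom emb"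
  by unfold_locales (simp_all add: One_fract_def)

lemma emb_eq_iff [simp]: "emb a = emb b \<longleftrightarrow> a = b"
  by (simp add: eq_fract)

lemma emb_eq_0_iff [simp]: "emb a = 0 \<longleftrightarrow> a = 0"
  by (simp add: Zero_fract_def eq_fract)

lemma Fract_mult_emb: "b \<noteq> 0 \<Longrightarrow> emb b * Fract a b = emb a"
  by (simp add: eq_fract)

lemma rhom_nonzero:
  fixes h :: "'a::field \<Rightarrow> 'b::comm_ring_1"
  assumes "rhom h" "x \<noteq> 0" "(1 :: 'b) \<noteq> 0"
  shows "h x \<noteq> 0"
  using rhom.hom_mult[OF assms(1), of x "inverse x"] rhom.hom_1[OF assms(1)] assms(2,3) by auto

definition fderiv :: "('a::idom \<Rightarrow> 'a) \<Rightarrow> 'a fract \<Rightarrow> 'a fract" where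
  "fderiv D q = (THE r. \<exists>a b. b \<noteq> 0 \<and> q = Fract a b \<and> r = Fract (D a * b - a * D b) (b * b))"

lemma fderiv_Fract:
  assumes "deriv D" "b \<noteq> 0"
  shows "fderiv D (Fract a b) = Fract (D a * b - a * D b) (b * b)"
  unfolding fderiv_def
proof (rule the_equality)
  fix r assume "\<exists>c e. e \<noteq> 0 \<and> Fract a b = Fract c e \<and> r = Fract (D c * e - c * D e) (e * e)"
  then obtain c e where e: "e \<noteq> 0" "Fract a b = Fract c e" "r = Fract (D c * e - c * D e) (e * e)" by blast
  interpret deriv D by fact
  have eq: "a * e = c * b" using e assms by (simp add: eq_fract)
  have "a * D e + D a * e = c * D b + D c * b"
    using arg_cong[OF eq, of D] by (simp add: D_mult)
  then have D: "D c * b = a * D e + D a * e - c * D b" by (simp add: algebra_simps)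
  have "(D c * e - c * D e) * (b * b) - (D a * b - a * D b) * (e * e)
      = e * b * (D c * b - (a * D e + D a * e - c * D b)) + (D e * b + e * D b) * (a * e - c * b)"
    by (simp add: algebra_simps)
  then have "(D c * e - c * D e) * (b * b) = (D a * b - a * D b) * (e * e)"
    using eq D by simp
  then show "r = Fract (D a * b - a * D b) (b * b)"
    using e assms by (simp add: eq_fract)
qed (use assms in blast)

lemma fderiv_emb [simp]: "deriv D \<Longrightarrow> fderiv D (emb a) = emb (D a)"
  by (simp add: fderiv_Fract deriv.D_1)

lemma deriv_fderiv:
  fixes D :: "'a::idom \<Rightarrow> 'a"
  assumes "deriv D"
  shows "deriv (fderiv D)"
proof
  interpret deriv D by fact
  fix x y :: "'a fract"
  obtain a b c e where x: "x = Fract a b" "b \<noteq> 0" and y: "y = Fract c e" "e \<noteq> 0"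
    by (meson Fract_cases)
  show "fderiv D (x + y) = fderiv D x + fderiv D y"
    using x(2) y(2) unfolding x(1) y(1)
    by (simp add: fderiv_Fract[OF assms] eq_fract D_add D_mult) (simp add: algebra_simps)
  show "fderiv D (x * y) = x * fderiv D y + fderiv D x * y"
    using x(2) y(2) unfolding x(1) y(1)
    by (simp add: fderiv_Fract[OF assms] eq_fract D_mult) (simp add: algebra_simps)
qed

lemma deriv_zero_if_zero_emb:
  assumes "deriv T" "\<And>a. T (emb a) = 0"
  shows "T q = 0"
proof -
  obtain a b where q: "q = Fract a b" "b \<noteq> 0" by (meson Fract_cases)
  then have "T (emb b * q) = 0" using assms(2) by (simp add: Fract_mult_emb del: mult_fract)
  then have "emb b * T q = 0" using assms by (simp add: deriv.D_mult)
  then show ?thesis using q(2) by simp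
qed

text \<open>The commutator of two derivations is a derivation, and this one vanishes on the embedded
  domain.\<close>

lemma fderiv_commute:
  assumes "deriv D" "deriv E" "\<And>a. D (E a) = E (D a)"
  shows "fderiv D (fderiv E q) = fderiv E (fderiv D q)"
proof -
  interpret D: deriv "fderiv D" by (rule deriv_fderiv) fact
  interpret E: deriv "fderiv E" by (rule deriv_fderiv) fact
  have "fderiv D (fderiv E q) - fderiv E (fderiv D q) = 0"
  proof (rule deriv_zero_if_zero_emb[where T = "\<lambda>q. fderiv D (fderiv E q) - fderiv E (fderiv D q)"])
    show "deriv (\<lambda>q. fderiv D (fderiv E q) - fderiv E (fderiv D q))"
      by unfold_locales (simp_all add: D.D_add E.D_add D.D_mult E.D_mult algebra_simps)
  qed (simp add: assms)
  then show ?thesis by simp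
qed

text \<open>Clearing denominators slot by slot.\<close>

lemma multiderivation_eqI:
  fixes B1 B2 :: "('n::finite \<Rightarrow> 'a::idom fract) \<Rightarrow> 'b::idom"
  assumes "rhom h"
    and B1: "\<And>u i x y. B1 (u(i := x * y)) = h x * B1 (u(i := y)) + B1 (u(i := x)) * h y"
    and B2: "\<And>u i x y. B2 (u(i := x * y)) = h x * B2 (u(i := y)) + B2 (u(i := x)) * h y"
    and emb: "\<And>f. B1 (\<lambda>i. emb (f i)) = B2 (\<lambda>i. emb (f i))"
  shows "B1 u = B2 u"
proof -
  \<comment> \<open>\<open>S\<close> holds the slots in which proper fractions are still
    allowed.\<close>
  have "B1 u = B2 u" if "finite S" "\<And>i. i \<notin> S \<Longrightarrow> u i \<in> range emb" for S u
    using that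
  proof (induction S arbitrary: u)
    case empty
    then have "\<forall>i. \<exists>a. u i = emb a" by blast
    then obtain f where f: "\<And>i. u i = emb (f i)" by metis
    then have "u = (\<lambda>i. emb (f i))" by (rule ext)
    then show ?case using emb[of f] by (simp only:)
  next
    case (insert i S)
    obtain a b where ab: "u i = Fract a b" "b \<noteq> 0" by (meson Fract_cases)
    have eq: "B1 (u(i := emb c)) = B2 (u(i := emb c))" for c
      using insert.prems by (intro insert.IH) auto
    have u: "u(i := u i) = u" by simp
    have prod: "emb b * u i = emb a" unfolding ab(1) by (rule Fract_mult_emb) (rule ab)
    \<comment> \<open>The Leibniz rule for b * (a / b) = a expresses the value at a / b by values
      with elements of the domain in slot i.\<close>
    have "h (emb b) * B1 u + B1 (u(i := emb b)) * h (u i) = B1 (u(i := emb a))"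
      using B1[of u i "emb b" "u i"] unfolding prod u by (rule sym)
    moreover have "h (emb b) * B2 u + B2 (u(i := emb b)) * h (u i) = B2 (u(i := emb a))"
      using B2[of u i "emb b" "u i"] unfolding prod u by (rule sym)
    ultimately have "h (emb b) * B1 u = h (emb b) * B2 u"
      unfolding eq by (metis add_right_cancel)
    moreover have "h (emb b) \<noteq> 0" using ab(2) by (intro rhom_nonzero[OF assms(1)]) simp_all
    ultimately show ?case by simp
  qed
  from this[of UNIV] show ?thesis by simp
qed

section \<open>The fundamental identity\<close>

locale comm_derivs =
  fixes \<D> :: "'v::finite \<Rightarrow> 'a::idom \<Rightarrow> 'a"
  assumes derivs: "deriv (\<D> i)" and commute: "\<D> i (\<D> j a) = \<D> j (\<D> i a)" and two: "(2 :: 'a) \<noteq> 0"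
begin

definition jac :: "('v \<Rightarrow> 'a) \<Rightarrow> 'a" where
  "jac f = fdet (\<lambda>r j. \<D> j (f r))"

lemma jac_upd: "jac (f(r := a)) = fdet ((\<lambda>r j. \<D> j (f r))(r := (\<lambda>j. \<D> j a)))"
  unfolding jac_def by (rule arg_cong[where f = fdet]) (auto simp: fun_eq_iff)

lemma jac_add: "jac (f(r := a + b)) = jac (f(r := a)) + jac (f(r := b))"
  unfolding jac_upd deriv.D_add[OF derivs] by (rule fdet_row_add)

lemma jac_mult: "jac (f(r := a * b)) = a * jac (f(r := b)) + b * jac (f(r := a))"
proof -
  have "\<D> j (a * b) = a * \<D> j b + b * \<D> j a" for j
    by (simp add: deriv.D_mult[OF derivs] mult.commute)
  then show ?thesis
    unfolding jac_upd fdet_row_mult[symmetric] fdet_row_add[symmetric] by simp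
qed

lemma jac_same: "r \<noteq> s \<Longrightarrow> f r = f s \<Longrightarrow> jac f = 0"
  unfolding jac_def by (rule fdet_same[of r s]) auto

lemma jac_0: "jac (f(r := 0)) = 0"
  unfolding jac_upd deriv.D_0[OF derivs] by (rule fdet_row_0)

definition cofac :: "('v \<Rightarrow> 'a) \<Rightarrow> 'v \<Rightarrow> 'v \<Rightarrow> 'a" where
  "cofac v r j = fdet ((\<lambda>r j. \<D> j (v r))(r := unit_row j))"

lemma jac_expand: "jac (v(r := g)) = (\<Sum>j\<in>UNIV. \<D> j g * cofac v r j)"
proof -
  have "jac (v(r := g)) = fdet ((\<lambda>r j. \<D> j (v r))(r := (\<lambda>k. \<Sum>j\<in>UNIV. \<D> j g * unit_row j k)))"
    unfolding jac_upd sum_unit_row ..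
  also have "\<dots> = (\<Sum>j\<in>UNIV. \<D> j g * cofac v r j)"
    unfolding cofac_def by (rule fdet_row_lincomb)
  finally show ?thesis .
qed

text \<open>The Piola identity: cofactors of a Jacobian matrix are divergence free. Second
  derivatives are symmetric in j and k, the determinant with unit rows j and k is antisymmetric, so
  their sum equals its own negative; here \<open>two\<close> enters.\<close>

lemma cofac_divergence: "(\<Sum>j\<in>UNIV. \<D> j (cofac v r j)) = 0"
proof -
  define A where "A = (\<lambda>r j. \<D> j (v r))"
  have "(\<Sum>j\<in>UNIV. fdet ((A(r := unit_row j))(s := (\<lambda>k. \<D> j ((A(r := unit_row j)) s k))))) = 0" for s
  proof (cases "s = r")
    case True
    have "(\<lambda>k. \<D> j ((A(r := unit_row j)) s k)) = (\<lambda>k. 0)" for j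
      using True by (auto simp: unit_row_def deriv.D_0[OF derivs] deriv.D_1[OF derivs])
    then show ?thesis by (simp only: fdet_row_0) simp
  next
    case False
    define E where "E = (\<lambda>j k. fdet (A(r := unit_row j, s := unit_row k)))"
    define H where "H = (\<lambda>j k. \<D> j (\<D> k (v s)))"
    define T where "T = (\<Sum>j\<in>UNIV. \<Sum>k\<in>UNIV. H j k * E j k)"
    have E: "E j k = - E k j" for j k
      unfolding E_def using False by (intro fdet_swap) auto
    have "T = (\<Sum>k\<in>UNIV. \<Sum>j\<in>UNIV. H j k * E j k)"
      unfolding T_def by (rule sum.swap)
    also have "\<dots> = (\<Sum>k\<in>UNIV. \<Sum>j\<in>UNIV. - (H k j * E k j))"
    proof (intro sum.cong refl)
      fix j k
      show "H j k * E j k = - (H k j * E k j)"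
        using E[of j k] commute[of j k "v s"] by (simp add: H_def)
    qed
    also have "\<dots> = - T" unfolding T_def by (simp add: sum_negf)
    finally have "2 * T = 0" by simp
    then have "T = 0" using two by simp
    moreover have "fdet ((A(r := unit_row j))(s := (\<lambda>k. \<D> j ((A(r := unit_row j)) s k)))) = (\<Sum>k\<in>UNIV. H j k * E j k)" for j
    proof -
      have "(\<lambda>k. \<D> j ((A(r := unit_row j)) s k)) = (\<lambda>k. \<Sum>l\<in>UNIV. H j l * unit_row l k)"
        using False by (auto simp: sum_unit_row A_def H_def)
      then show ?thesis unfolding E_def by (simp only: fdet_row_lincomb)
    qed
    ultimately show ?thesis unfolding T_def by simp
  qed
  then have "(\<Sum>s\<in>UNIV. \<Sum>j\<in>UNIV. fdet ((A(r := unit_row j))(s := (\<lambda>k. \<D> j ((A(r := unit_row j)) s k))))) = 0"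
    by simp
  then show ?thesis
    unfolding cofac_def deriv.D_fdet[OF derivs] A_def[symmetric] by (subst sum.swap)
qed

text \<open>By cofactor expansion, g -> \<open>jac (v(r := g))\<close> is the vector field with
  components c_j. The right side differentiates the rows of \<open>jac u\<close> along the field and
  adds a term in the derivatives of c, which by \<open>fdet_trace\<close> is the divergence of c
  times \<open>jac u\<close>, hence 0.\<close>

lemma jac_fundamental: "jac (v(r := jac u)) = (\<Sum>s\<in>UNIV. jac (u(s := jac (v(r := u s)))))"
proof -
  define U where "U = (\<lambda>r j. \<D> j (u r))"
  define c where "c = cofac v r"
  have "jac (u(s := jac (v(r := u s)))) = (\<Sum>j\<in>UNIV. c j * fdet (U(s := (\<lambda>k. \<D> j (U s k)))))
      + fdet (U(s := (\<lambda>k. \<Sum>j\<in>UNIV. U s j * \<D> k (c j))))" for s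
  proof -
    have "\<D> k (jac (v(r := u s))) = (\<Sum>j\<in>UNIV. c j * \<D> j (U s k)) + (\<Sum>j\<in>UNIV. U s j * \<D> k (c j))" for k
      unfolding jac_expand c_def[symmetric]
      by (simp add: deriv.D_sum[OF derivs] deriv.D_mult[OF derivs] sum.distrib U_def commute[of k] mult.commute)
    then have "jac (u(s := jac (v(r := u s))))
        = fdet (U(s := (\<lambda>k. (\<Sum>j\<in>UNIV. c j * \<D> j (U s k)) + (\<Sum>j\<in>UNIV. U s j * \<D> k (c j)))))"
      unfolding jac_upd[of u s] U_def[symmetric] by simp
    then show ?thesis by (simp only: fdet_row_add fdet_row_lincomb)
  qed
  then have "(\<Sum>s\<in>UNIV. jac (u(s := jac (v(r := u s)))))
      = (\<Sum>s\<in>UNIV. \<Sum>j\<in>UNIV. c j * fdet (U(s := (\<lambda>k. \<D> j (U s k)))))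
        + (\<Sum>s\<in>UNIV. fdet (U(s := (\<lambda>k. \<Sum>j\<in>UNIV. U s j * \<D> k (c j)))))"
    by (simp only: sum.distrib)
  also have "(\<Sum>s\<in>UNIV. fdet (U(s := (\<lambda>k. \<Sum>j\<in>UNIV. U s j * \<D> k (c j))))) = (\<Sum>s\<in>UNIV. \<D> s (c s)) * fdet U"
    by (rule fdet_trace)
  also have "(\<Sum>s\<in>UNIV. \<D> s (c s)) = 0" unfolding c_def by (rule cofac_divergence)
  also have "(\<Sum>s\<in>UNIV. \<Sum>j\<in>UNIV. c j * fdet (U(s := (\<lambda>k. \<D> j (U s k)))))
      = (\<Sum>j\<in>UNIV. c j * \<D> j (jac u))"
    by (subst sum.swap) (simp only: jac_def U_def[symmetric] deriv.D_fdet[OF derivs] sum_distrib_left)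
  also have "\<dots> = jac (v(r := jac u))"
    unfolding jac_expand c_def by (simp add: mult.commute)
  finally show ?thesis by (simp only: mult_zero_left add_0_right)
qed

end

section \<open>Divisibility in polynomial rings\<close>

text \<open>Polynomials over a field form a principal ideal domain: a nonzero element of least
  degree generates the ideal.\<close>

lemma bezout_family:
  fixes F :: "'i::finite \<Rightarrow> 'a::field poly"
  assumes "F i0 \<noteq> 0"
  shows "\<exists>g c. g \<noteq> 0 \<and> g = (\<Sum>i\<in>UNIV. c i * F i) \<and> (\<forall>i. g dvd F i)"
proof -
  define I where "I = range (\<lambda>c. \<Sum>i\<in>UNIV. c i * F i)"
  have F: "F i \<in> I" for i
    unfolding I_def
    by (rule range_eqI[of _ _ "\<lambda>j. unit_row i j"]) (simp add: unit_row_def if_distrib[of "\<lambda>x. x * _"] cong: if_cong)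
  have diff: "a - q * b \<in> I" if ab: "a \<in> I" "b \<in> I" for a b q
  proof -
    from ab obtain f h where "a = (\<Sum>i\<in>UNIV. f i * F i)" "b = (\<Sum>i\<in>UNIV. h i * F i)"
      by (auto simp: I_def)
    then have "a - q * b = (\<Sum>i\<in>UNIV. (f i - q * h i) * F i)"
      by (simp add: sum_subtractf sum_distrib_left algebra_simps)
    then show ?thesis unfolding I_def by (intro range_eqI)
  qed
  define P where "P = (\<lambda>n. \<exists>g\<in>I. g \<noteq> 0 \<and> degree g = n)"
  have "P (degree (F i0))" unfolding P_def using F assms by blast
  then have "P (LEAST n. P n)" by (rule LeastI)
  then obtain g where g: "g \<in> I" "g \<noteq> 0" "degree g = (LEAST n. P n)"
    unfolding P_def by blast
  have "g dvd f" if "f \<in> I" for f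
  proof -
    have "f mod g = f - (f div g) * g" by (simp add: minus_div_mult_eq_mod)
    then have "f mod g \<in> I" using diff[OF that g(1)] by simp
    moreover have "f mod g = 0 \<or> degree (f mod g) < degree g"
      using g(2) by (rule degree_mod_less)
    moreover have "\<not> P n" if "n < degree g" for n
      using that g(3) not_less_Least by metis
    ultimately have "f mod g = 0" unfolding P_def by blast
    then show ?thesis by (simp add: mod_eq_0_iff_dvd)
  qed
  then show ?thesis using F g(1,2) by (auto simp: I_def)
qed

lemma prime_divisor_exists_field_poly:
  fixes b :: "'a::field poly"
  assumes "b \<noteq> 0" "\<not> is_unit b"
  shows "\<exists>p. prime_elem p \<and> p dvd b"
  using assms
proof (induction "degree b" arbitrary: b rule: less_induct)
  case less
  show ?case
  proof (cases "Factorial_Ring.irreducible b")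
    case True
    then have "prime_elem b" by (rule field_poly_irreducible_imp_prime)
    then show ?thesis by (intro exI[of _ b]) simp
  next
    case False
    then obtain p q where pq: "b = p * q" "\<not> is_unit p" "\<not> is_unit q"
      using less.prems unfolding Factorial_Ring.irreducible_def by blast
    have "p \<noteq> 0" "q \<noteq> 0" using less.prems(1) unfolding pq(1) by simp_all
    then have "degree p < degree b"
      using pq is_unit_iff_degree[of q] by (simp add: degree_mult_eq)
    then obtain r where "prime_elem r" "r dvd p" using less.hyps \<open>p \<noteq> 0\<close> pq(2) by blast
    then have "r dvd b" unfolding pq(1) by (intro dvd_mult2)
    then show ?thesis using \<open>prime_elem r\<close> by blast
  qed
qed

text \<open>Split off a prime h, p = h * q. The cofactor q divides f by induction and is coprime to
  h since p is squarefree, so the product divides f.\<close>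

lemma squarefree_dvd_power:
  fixes p f :: "'a::field poly"
  assumes "p \<noteq> 0" "\<And>h. h * h dvd p \<Longrightarrow> is_unit h" "p dvd f ^ m"
  shows "p dvd f"
  using assms(1,2,3)
proof (induction "degree p" arbitrary: p rule: less_induct)
  case less
  show ?case
  proof (cases "is_unit p")
    case False
    then obtain h where h: "prime_elem h" "h dvd p"
      using prime_divisor_exists_field_poly less.prems(1) by blast
    then obtain q where q: "p = h * q" by blast
    have "q \<noteq> 0" "h \<noteq> 0" using q less.prems by auto
    have "\<not> is_unit h" using h(1) by (rule prime_elem_not_unit)
    then have "degree q < degree p"
      using \<open>h \<noteq> 0\<close> \<open>q \<noteq> 0\<close> is_unit_iff_degree[of h] by (simp add: q degree_mult_eq)
    moreover have "is_unit k" if "k * k dvd q" for k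
      using that less.prems(2)[of k] by (simp add: q)
    moreover have "q dvd f ^ m" using less.prems(3) by (simp add: q) (metis dvd_mult_right)
    ultimately have "q dvd f" using less.hyps \<open>q \<noteq> 0\<close> by blast
    have "h dvd f" using less.prems(3) h by (metis dvd_trans prime_elem_dvd_power)
    \<comment> \<open>The pair h, q as a family over \<open>unit option\<close>, to which
      \<open>bezout_family\<close> applies.\<close>
    define F where "F = case_option h (\<lambda>_ :: unit. q)"
    obtain g c where g: "g \<noteq> 0" "g = (\<Sum>i\<in>UNIV. c i * F i)" "\<And>i. g dvd F i"
      using bezout_family[of F None] \<open>h \<noteq> 0\<close> unfolding F_def by auto
    have "is_unit g"
    proof (rule ccontr)
      assume "\<not> is_unit g"
      have "g dvd h" "g dvd q" using g(3)[of None] g(3)[of "Some ()"] by (auto simp: F_def)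
      then have "h dvd g"
        using h(1) \<open>\<not> is_unit g\<close> by (metis dvd_def dvd_mult_unit_iff prime_elem_imp_irreducible irreducibleD' prime_elem_not_zeroI)
      then have "h dvd q" using \<open>g dvd q\<close> by (rule dvd_trans)
      then have "h * h dvd p" unfolding q by simp
      then show False using less.prems(2) \<open>\<not> is_unit h\<close> by blast
    qed
    have "g * f = c None * (h * f) + c (Some ()) * (q * f)"
      unfolding g(2) F_def by (simp add: sum_UNIV_option algebra_simps UNIV_unit)
    moreover have "p dvd h * f" "p dvd q * f"
      using \<open>q dvd f\<close> \<open>h dvd f\<close> by (auto simp: q mult_dvd_mono mult.commute[of h])
    ultimately have "p dvd g * f" by simp
    then show ?thesis using \<open>is_unit g\<close> by (simp add: dvd_mult_unit_iff')
  qed auto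
qed

text \<open>Positive integer weights off finitely many hyperplanes. If the new one contains r, then
  r is multiplied by N and increased by 1 at a coordinate where a is nonzero. N exceeds every |b_l|,
  so sums that were nonzero stay so.\<close>

lemma separating_weights:
  fixes T :: "('v::finite \<Rightarrow> int) set"
  assumes "finite T" "\<And>a. a \<in> T \<Longrightarrow> a \<noteq> (\<lambda>_. 0)"
  shows "\<exists>r. (\<forall>j. r j > 0) \<and> (\<forall>a\<in>T. (\<Sum>j\<in>UNIV. a j * int (r j)) \<noteq> 0)"
  using assms
proof (induction T)
  case empty
  then show ?case by (intro exI[of _ "\<lambda>_. 1"]) auto
next
  case (insert a T)
  then obtain r where r: "\<And>j. r j > 0" "\<And>b. b \<in> T \<Longrightarrow> (\<Sum>j\<in>UNIV. b j * int (r j)) \<noteq> 0"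
    by blast
  show ?case
  proof (cases "(\<Sum>j\<in>UNIV. a j * int (r j)) = 0")
    case False
    then show ?thesis using r by (intro exI[of _ r]) auto
  next
    case True
    obtain l where l: "a l \<noteq> 0" using insert.prems by (auto simp: fun_eq_iff)
    define N where "N = Suc (nat (\<Sum>b\<in>T. \<bar>b l\<bar>))"
    define r' where "r' = (\<lambda>j. N * r j + (if j = l then 1 else 0))"
    have r': "(\<Sum>j\<in>UNIV. b j * int (r' j)) = int N * (\<Sum>j\<in>UNIV. b j * int (r j)) + b l" for b
    proof -
      have "(\<Sum>j\<in>UNIV. b j * int (r' j)) = (\<Sum>j\<in>UNIV. int N * (b j * int (r j)) + (if j = l then b j else 0))"
        unfolding r'_def by (intro sum.cong) (auto simp: algebra_simps)
      then show ?thesis by (simp add: sum.distrib sum_distrib_left)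
    qed
    have "(\<Sum>j\<in>UNIV. b j * int (r' j)) \<noteq> 0" if "b \<in> T" for b
    proof -
      let ?s = "\<Sum>j\<in>UNIV. b j * int (r j)"
      have "\<bar>b l\<bar> \<le> (\<Sum>b\<in>T. \<bar>b l\<bar>)"
        using that insert.hyps(1) by (intro member_le_sum) auto
      then have "\<bar>b l\<bar> < int N" unfolding N_def by linarith
      also have "\<dots> \<le> \<bar>int N * ?s\<bar>"
        using mult_left_mono[of 1 "\<bar>?s\<bar>" "int N"] r(2)[OF that] by (simp add: abs_mult)
      finally show ?thesis unfolding r' by linarith
    qed
    moreover have "(\<Sum>j\<in>UNIV. a j * int (r' j)) \<noteq> 0" unfolding r' True using l by simp
    moreover have "r' j > 0" for j using r(1)[of j] by (simp add: r'_def N_def)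
    ultimately show ?thesis by (intro exI[of _ r']) auto
  qed
qed

text \<open>The substitution $t_j \mapsto t_j + X^{r_j}$. For suitable weights $r$ it turns a given nonzero
  polynomial into one whose leading coefficient in $X$ is a constant, and it commutes with the
  coefficientwise action of the partial derivatives.\<close>

definition shift :: "('v \<Rightarrow> nat) \<Rightarrow> ('k::comm_ring_1, 'v::finite) mpoly \<Rightarrow> ('k, 'v) mpoly poly" where
  "shift r = subst (\<lambda>c. [:const c:]) (\<lambda>j. [:var j:] + monom 1 (r j))"

lemma shift_hom: "rhom (shift r :: ('k::comm_ring_1, 'v::finite) mpoly \<Rightarrow> _)"
  unfolding shift_def by (intro subst_hom const_poly_hom const_hom)

lemma shift_const [simp]: "shift r (const c) = [:const c:]"
  by (simp add: shift_def const_poly_hom const_hom)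

lemma shift_var [simp]: "shift r (var j) = [:var j:] + monom 1 (r j)"
  by (simp add: shift_def const_poly_hom const_hom)

lemma poly_shift_0:
  assumes "\<And>j. r j > 0"
  shows "poly (shift r p) 0 = p"
  by (rule hom_eqI[OF rhom_comp[OF _ shift_hom] rhom_id])
    (use assms in \<open>auto simp: rhom_def poly_monom zero_power\<close>)

text \<open>As in Noether normalization: the weights separate the exponent vectors of p, so one
  monomial alone attains the highest power of X, and there t_j + X^(r_j) contributes the coefficient
  1.\<close>

lemma shift_lead_coeff:
  fixes p :: "('k::comm_ring_1, 'v::finite) mpoly"
  assumes "p \<noteq> 0"
  shows "\<exists>r c. (\<forall>j. r j > 0) \<and> c \<noteq> 0 \<and> lead_coeff (shift r p) = const c"
proof -
  let ?K = "Poly_Mapping.keys p"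
  define T where "T = (\<lambda>(m, m') j. int (Poly_Mapping.lookup m j) - int (Poly_Mapping.lookup m' j)) ` {(m, m') \<in> ?K \<times> ?K. m \<noteq> m'}"
  have "finite T" unfolding T_def
    by (rule finite_imageI, rule finite_subset[of _ "?K \<times> ?K"]) auto
  moreover have "a \<noteq> (\<lambda>_. 0)" if "a \<in> T" for a
    using that by (auto simp: T_def fun_eq_iff poly_mapping_eq_iff)
  ultimately obtain r where r: "\<And>j. r j > 0" "\<And>a. a \<in> T \<Longrightarrow> (\<Sum>j\<in>UNIV. a j * int (r j)) \<noteq> 0"
    using separating_weights[of T] by blast
  define wt where "wt = (\<lambda>m. \<Sum>j\<in>UNIV. Poly_Mapping.lookup m j * r j)"
  have inj: "wt m \<noteq> wt m'" if "m \<in> ?K" "m' \<in> ?K" "m \<noteq> m'" for m m'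
  proof
    assume "wt m = wt m'"
    then have "int (wt m) - int (wt m') = 0" by simp
    then have "(\<Sum>j\<in>UNIV. (int (Poly_Mapping.lookup m j) - int (Poly_Mapping.lookup m' j)) * int (r j)) = 0"
      by (simp add: wt_def left_diff_distrib sum_subtractf)
    moreover have "(\<lambda>j. int (Poly_Mapping.lookup m j) - int (Poly_Mapping.lookup m' j)) \<in> T"
      unfolding T_def using that by (intro image_eqI[of _ _ "(m, m')"]) auto
    ultimately show False using r(2) by blast
  qed
  have "?K \<noteq> {}" using assms by simp
  then have "Max (wt ` ?K) \<in> wt ` ?K" by (intro Max_in) simp_all
  then obtain m where "m \<in> ?K" "wt m = Max (wt ` ?K)" by auto
  then have m: "m \<in> ?K" "\<And>m'. m' \<in> ?K \<Longrightarrow> wt m' \<le> wt m" by simp_all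
  define u where "u = (\<lambda>j. [:var j:] + monom 1 (r j) :: ('k, 'v) mpoly poly)"
  define t where "t = (\<lambda>m. \<Prod>j\<in>UNIV. u j ^ Poly_Mapping.lookup m j)"
  have t: "degree (t m) \<le> wt m \<and> coeff (t m) (wt m) = 1" for m
  proof -
    have "degree (u j) \<le> r j" for j
      unfolding u_def by (intro degree_add_le) (auto simp: degree_monom_le)
    moreover have "coeff (u j) (r j) = 1" for j
      using r(1)[of j] by (cases "r j") (auto simp: u_def)
    ultimately have "degree (u j ^ k) \<le> k * r j \<and> coeff (u j ^ k) (k * r j) = 1" for j k
      using power_bounds[of "u j" "r j" k] by simp
    then show ?thesis
      unfolding t_def wt_def
      using prod_bounds[of UNIV "\<lambda>j. u j ^ Poly_Mapping.lookup m j" "\<lambda>j. Poly_Mapping.lookup m j * r j"] by simp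
  qed
  have s: "shift r p = (\<Sum>m\<in>?K. [:const (Poly_Mapping.lookup p m):] * t m)"
    unfolding shift_def subst_def t_def u_def ..
  have top: "coeff (shift r p) (wt m) = const (Poly_Mapping.lookup p m)"
  proof -
    have "coeff (shift r p) (wt m) = (\<Sum>m'\<in>?K. if m' = m then const (Poly_Mapping.lookup p m) else 0)"
      unfolding s coeff_sum
    proof (intro sum.cong refl)
      fix m' assume "m' \<in> ?K"
      then have "m' \<noteq> m \<Longrightarrow> coeff (t m') (wt m) = 0"
        using inj[of m' m] m t[of m'] by (intro coeff_eq_0) (metis le_neq_implies_less le_less_trans)
      then show "coeff ([:const (Poly_Mapping.lookup p m'):] * t m') (wt m) = (if m' = m then const (Poly_Mapping.lookup p m) else 0)"
        using t[of m] by auto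
    qed
    then show ?thesis using m(1) by simp
  qed
  have ne: "Poly_Mapping.lookup p m \<noteq> 0" using m(1) by (simp add: in_keys_iff)
  have "degree (shift r p) \<le> wt m"
    unfolding s using t m(2)
    by (intro degree_sum_le) (auto intro: order_trans[OF degree_smult_le] order_trans)
  moreover have "degree (shift r p) \<ge> wt m"
    using top ne by (intro le_degree) simp
  ultimately have "lead_coeff (shift r p) = const (Poly_Mapping.lookup p m)"
    using top by simp
  then show ?thesis using ne r(1) by blast
qed

abbreviation shiftq :: "('v \<Rightarrow> nat) \<Rightarrow> ('k::field, 'v::{finite,linorder}) mpoly \<Rightarrow> ('k, 'v) mpoly fract poly" where
  "shiftq r p \<equiv> map_poly emb (shift r p)"

lemma map_poly_hom:
  assumes "rhom h"
  shows "rhom (map_poly h)"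
proof
  interpret rhom h by fact
  fix p q
  show "map_poly h (p + q) = map_poly h p + map_poly h q"
    by (rule poly_eqI) (simp add: coeff_map_poly hom_0 hom_add)
  show "map_poly h (p * q) = map_poly h p * map_poly h q"
    by (rule poly_eqI) (simp add: coeff_map_poly hom_0 coeff_mult hom_sum hom_mult)
  show "map_poly h 1 = 1"
    by (rule poly_eqI) (simp add: coeff_map_poly hom_0 hom_1)
qed

lemma emb_0 [simp]: "emb 0 = 0" and emb_1 [simp]: "emb 1 = 1"
  by (simp_all add: rhom.homs[OF emb_hom])

lemmas map_poly_emb_hom = map_poly_hom[OF emb_hom]

lemma shiftq_hom: "rhom (shiftq r)"
  by (rule rhom_comp[OF map_poly_emb_hom shift_hom])

lemma shiftq_subst: "shiftq r (subst const x p) = subst (\<lambda>c. [:emb (const c):]) (\<lambda>j. shiftq r (x j)) p"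
  by (simp add: hom_subst[OF shiftq_hom] map_poly_pCons)

lemma shiftq_eq_0_iff:
  assumes "\<And>j. r j > 0"
  shows "shiftq r p = 0 \<longleftrightarrow> p = 0"
proof
  assume "shiftq r p = 0"
  then have "shift r p = 0" by (auto simp: poly_eq_iff coeff_map_poly)
  then show "p = 0" using poly_shift_0[of r p] assms by simp
qed (simp add: rhom.hom_0[OF shiftq_hom])

text \<open>Pseudo-division by \<open>shift r q\<close> multiplies only by powers of the constant
  leading coefficient. Its remainder is 0 over the fraction field, since the degree is too small,
  and hence 0; setting X = 0 recovers q and p.\<close>

lemma dvd_if_shiftq_dvd:
  fixes q p :: "('k::field, 'v::{finite,linorder}) mpoly"
  assumes r: "\<And>j. r j > 0" and c: "c \<noteq> 0" "lead_coeff (shift r q) = const c"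
    and dvd: "shiftq r q dvd shiftq r p"
  shows "q dvd p"
proof -
  have ne: "shift r q \<noteq> 0" using c by auto
  obtain s t where st: "pseudo_divmod (shift r p) (shift r q) = (s, t)" by fastforce
  define k where "k = Suc (degree (shift r p)) - degree (shift r q)"
  have div: "smult (const c ^ k) (shift r p) = shift r q * s + t"
      "t = 0 \<or> degree t < degree (shift r q)"
    using pseudo_divmod[OF ne st] c(2) by (auto simp: k_def)
  interpret m: rhom "map_poly emb :: ('k, 'v) mpoly poly \<Rightarrow> _" by (rule map_poly_emb_hom)
  have deg: "degree (map_poly emb u) = degree u" for u :: "('k, 'v) mpoly poly"
    by (rule degree_map_poly) (simp add:)
  have "map_poly emb t = map_poly emb [:const c ^ k:] * shiftq r p - shiftq r q * map_poly emb s"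
    unfolding m.hom_mult[symmetric] m.hom_diff[symmetric] using div(1) by simp
  also have "shiftq r q dvd \<dots>"
    using dvd by (intro dvd_diff dvd_mult dvd_triv_left)
  finally have "map_poly emb t = 0"
    using div(2) deg[of t] deg[of "shift r q"] by (metis dvd_imp_degree_le leD m.hom_0)
  then have "t = 0" by (auto simp: poly_eq_iff coeff_map_poly)
  then have "poly (smult (const c ^ k) (shift r p)) 0 = poly (shift r q * s) 0"
    using div(1) by simp
  then have eq: "const c ^ k * p = q * poly s 0"
    using poly_shift_0[of r p] poly_shift_0[of r q] r by simp
  have "p = const (inverse c ^ k) * (const c ^ k * p)"
    using c(1) by (simp add: mult.assoc[symmetric] rhom.hom_power[OF const_hom] rhom.hom_mult[OF const_hom, symmetric]
        rhom.hom_1[OF const_hom] power_mult_distrib[symmetric])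
  also have "\<dots> = q * (const (inverse c ^ k) * poly s 0)"
    unfolding eq by (simp add: mult_ac)
  finally show ?thesis by (rule dvdI)
qed

lemma shiftq_partial:
  fixes p :: "('k::field, 'v::{finite,linorder}) mpoly"
  shows "map_poly (fderiv (partial l)) (shiftq r p) = shiftq r (partial l p)"
proof -
  let ?D = "map_poly (fderiv (partial l))"
  let ?k = "\<lambda>c. [:emb (const c):]"
  have D: "deriv ?D" by (intro deriv_map_poly deriv_fderiv deriv_partial)
  have 0: "fderiv (partial l) 0 = 0" by (rule deriv.D_0[OF deriv_fderiv[OF deriv_partial]])
  have s: "shiftq r q = subst ?k (\<lambda>j. shiftq r (var j)) q" for q :: "('k, 'v) mpoly"
    using shiftq_subst[of r "var" q] by simp
  have "?D (shiftq r p) = (\<Sum>j\<in>UNIV. subst ?k (\<lambda>j. shiftq r (var j)) (partial j p) * ?D (shiftq r (var j)))"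
    by (subst s, rule deriv_subst[OF D const_poly_hom[OF rhom_comp[OF emb_hom const_hom]]])
      (simp add: poly_eq_iff coeff_map_poly 0 coeff_pCons deriv_partial split: nat.split)
  also have "\<dots> = (\<Sum>j\<in>UNIV. shiftq r (partial j p) * unit_row j l)"
  proof (intro sum.cong refl)
    fix j
    have "?D (shiftq r (var j :: ('k, 'v) mpoly)) = unit_row j l"
      by (auto simp: poly_eq_iff coeff_map_poly 0 coeff_pCons deriv_partial partial_var unit_row_def
          rhom.homs[OF const_hom] deriv.D_0[OF deriv_partial] deriv.D_1[OF deriv_partial] deriv.D_add[OF deriv_partial] split: nat.split)
    then show "subst ?k (\<lambda>j. shiftq r (var j)) (partial j p) * ?D (shiftq r (var j)) = shiftq r (partial j p) * unit_row j l"
      by (subst s[symmetric]) simp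
  qed
  finally show ?thesis by (simp only: sum_unit_row)
qed

lemma const_fract_poly_hom: "rhom (\<lambda>c. [:emb (const c :: ('k::field, 'v::{finite,linorder}) mpoly):])"
  by (rule const_poly_hom[OF rhom_comp[OF emb_hom const_hom]])

section \<open>The potential is squarefree\<close>

context potential begin

text \<open>A prime whose square divides the shifted \<Omega> divides its partial derivatives, hence
  each t_j + X^(r_j). Two of these have no common prime, as X can be eliminated.\<close>

lemma radical:
  assumes "\<Omega> dvd f ^ m"
  shows "\<Omega> dvd f"
proof -
  obtain r c where r: "\<And>j. r j > 0" and c: "c \<noteq> 0" "lead_coeff (shift r \<Omega>) = const c"
    using shift_lead_coeff[OF potential_nonzero] by blast
  interpret s: rhom "shiftq r :: ('k, 'n option) mpoly \<Rightarrow> _" by (rule shiftq_hom)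
  let ?P = "shiftq r \<Omega>"
  have "?P \<noteq> 0" using shiftq_eq_0_iff[of r \<Omega>] r potential_nonzero by simp
  have sqf: "is_unit h" if h: "h * h dvd ?P" for h
  proof (rule ccontr)
    assume "\<not> is_unit h"
    moreover have "h \<noteq> 0" using h \<open>?P \<noteq> 0\<close> by auto
    ultimately obtain p where p: "prime_elem p" "p dvd h"
      using prime_divisor_exists_field_poly by blast
    have "p * p dvd ?P" using mult_dvd_mono[OF p(2) p(2)] h by (rule dvd_trans)
    then obtain u where u: "?P = p * (p * u)" by (auto simp: dvd_def mult.assoc)
    have "p dvd shiftq r (partial l \<Omega>)" for l
    proof -
      interpret D: deriv "map_poly (fderiv (partial l)) :: ('k, 'n option) mpoly fract poly \<Rightarrow> _"
        by (intro deriv_map_poly deriv_fderiv deriv_partial)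
      have "shiftq r (partial l \<Omega>) = p * (map_poly (fderiv (partial l)) (p * u)) + map_poly (fderiv (partial l)) p * (p * u)"
        unfolding shiftq_partial[symmetric] u by (rule D.D_mult)
      then show ?thesis by simp
    qed
    then have "p dvd subst (\<lambda>c. [:emb (const c):]) (\<lambda>j. shiftq r (var j)) (partial l \<Omega>)" for l
      by (simp only: shiftq_subst[symmetric] subst_const_var)
    then have "\<exists>m. p dvd shiftq r (var j) ^ m" for j
      by (rule dvd_power_if_dvd_partials[OF const_fract_poly_hom])
    then have pv: "p dvd shiftq r (var j)" for j
      using p(1) prime_elem_dvd_power by blast
    have pp: "p dvd monom 1 (r j * e) - [:emb ((- var j) ^ e):]" for j e
    proof -
      have "shiftq r (var j :: ('k, 'n option) mpoly) = monom 1 (r j) - [:emb (- var j):]"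
        by (simp add: rhom.hom_add[OF map_poly_emb_hom] map_poly_pCons map_poly_monom)
      then have "shiftq r (var j :: ('k, 'n option) mpoly) dvd monom 1 (r j) ^ e - [:emb (- var j):] ^ e"
        by (simp only: power_diff_sumr2 dvd_triv_left)
      moreover have "[:emb (- var j):] ^ e = [:emb ((- var j) ^ e :: ('k, 'n option) mpoly):]"
        using rhom.hom_power[OF const_poly_hom[OF emb_hom]] by metis
      moreover have "monom 1 (r j) ^ e = (monom 1 (r j * e) :: ('k, 'n option) mpoly fract poly)"
        by (simp add: monom_power)
      ultimately show ?thesis using dvd_trans[OF pv] by (simp only:)
    qed
    let ?j = "Some undefined :: 'n option"
    \<comment> \<open>Modulo p, X^(r_j) is -t_j. Raising this for two indices to crossed exponents
      eliminates X and leaves a constant of K[X] divisible by p.\<close>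
    let ?c = "(- var ?j) ^ r None - (- var None) ^ r ?j :: ('k, 'n option) mpoly"
    have "p dvd (monom 1 (r None * r ?j) - [:emb ((- var None) ^ r ?j):])
        - (monom 1 (r ?j * r None) - [:emb ((- var ?j) ^ r None):])"
      by (rule dvd_diff[OF pp pp])
    also have "\<dots> = [:emb ?c:]"
      by (simp add: mult.commute rhom.hom_diff[OF emb_hom] del: diff_fract)
    finally have "p dvd [:emb ?c:]" .
    moreover have "?c \<noteq> 0"
    proof
      assume "?c = 0"
      \<comment> \<open>Evaluation at t_None = 0 with the other variables 1; the positive weight
        makes the second term vanish.\<close>
      moreover have "subst (\<lambda>c. c) (\<lambda>j. if j = None then 0 else 1) ?c = (- 1) ^ r None"
        using r by (simp add: rhom.homs[OF subst_hom[OF rhom_id]] rhom_id zero_power)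
      ultimately show False
        by (simp only: rhom.hom_0[OF subst_hom[OF rhom_id]]) simp
    qed
    then have "is_unit [:emb ?c:]" by (intro is_unit_triv) (simp only: emb_eq_0_iff not_False_eq_True)
    ultimately have "is_unit p" by (rule dvd_trans)
    then show False using p(1) by (simp add: prime_elem_def)
  qed
  have "?P dvd shiftq r f ^ m"
    using s.hom_dvd[OF assms] by (simp add: s.hom_power)
  then have "?P dvd shiftq r f"
    using squarefree_dvd_power[OF \<open>?P \<noteq> 0\<close> sqf] by blast
  then show ?thesis
    by (rule dvd_if_shiftq_dvd[OF r c])
qed

end

text \<open>The rows share w up to the factors z_k, so a term that uses w in two rows vanishes, and
  all rows but one contribute b. This saves n - 1 of the 2n powers of the denominator that the
  quotient rule produces.\<close>

lemma power_dvd_fdet: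
  fixes b :: "'a::comm_ring_1" and z :: "'n::finite \<Rightarrow> 'a"
  shows "b ^ (CARD('n) - 1) dvd fdet (case_option e (\<lambda>k l. b * u k l - z k * w l))"
proof -
  \<comment> \<open>Rows in S are still unexpanded, the others are prescribed by R. Expanding row i
    replaces it by u_i with a factor b, or by w with a factor -z_i.\<close>
  define M where "M = (\<lambda>S R. fdet (case_option e (\<lambda>k. if k \<in> S then (\<lambda>l. b * u k l - z k * w l) else R k)))"
  have step: "M (insert i S) R = b * M S (R(i := u i)) - z i * M S (R(i := w))" if "i \<notin> S" for i S R
  proof -
    define A where "A = case_option e (\<lambda>k. if k \<in> S then (\<lambda>l. b * u k l - z k * w l) else R k)"
    have A: "M S (R(i := x)) = fdet (A(Some i := x))" for x
      unfolding M_def A_def using that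
      by (intro arg_cong[where f = fdet]) (auto simp: fun_eq_iff split: option.split)
    have "M (insert i S) R = fdet (A(Some i := (\<lambda>l. b * u i l + (- z i) * w l)))"
      unfolding M_def A_def
      by (intro arg_cong[where f = fdet]) (auto simp: fun_eq_iff split: option.split)
    then show ?thesis unfolding A fdet_row_add fdet_row_mult by simp
  qed
  \<comment> \<open>Once one row is w, taking w from another row gives 0, so each remaining row
    contributes b.\<close>
  have w: "b ^ card S dvd M S R" if "finite S" "k \<notin> S" "R k = w" for S R k
    using that
  proof (induction S arbitrary: R)
    case (insert i S)
    have "M S (R(i := w)) = 0"
      unfolding M_def using insert.prems insert.hyps
      by (intro fdet_same[of "Some i" "Some k"]) auto
    moreover have "b ^ card S dvd M S (R(i := u i))"
      using insert.prems by (intro insert.IH) auto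
    ultimately show ?case
      using insert.hyps by (simp add: step mult_dvd_mono)
  qed simp
  have "b ^ (card S - 1) dvd M S R" if "finite S" for S R
    using that
  proof (induction S arbitrary: R)
    case (insert i S)
    have "b ^ card S dvd M S (R(i := w))"
      using insert.hyps by (intro w[of _ i]) auto
    moreover have "b ^ card S dvd b * M S (R(i := u i))"
    proof (cases "S = {}")
      case False
      then have "card S = Suc (card S - 1)" using insert.hyps by (simp add: card_gt_0_iff)
      then show ?thesis using mult_dvd_mono[OF dvd_refl[of b] insert.IH[of "R(i := u i)"]] by (metis power_Suc)
    qed simp
    ultimately show ?case
      using insert.hyps by (simp add: step)
  qed simp
  from this[of UNIV] show ?thesis by (simp add: M_def)
qed

lemma fdet_scale_rows: "fdet (\<lambda>r j. c r * A r j) = (\<Prod>r\<in>UNIV. c r) * fdet A"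
  unfolding fdet_expand by (simp add: prod.distrib sum_distrib_left mult_ac)

lemma prod_UNIV_option: "(\<Prod>i\<in>UNIV. f i) = f None * (\<Prod>i\<in>UNIV. f (Some (i :: 'n::finite)))"
  by (simp add: UNIV_option_conv prod.reindex)

definition Q_jac :: "('k::field, 'n::{finite,linorder} option) mpoly \<Rightarrow>
    ('n \<Rightarrow> ('k, 'n option) mpoly fract) \<Rightarrow> ('k, 'n option) mpoly fract" where
  "Q_jac \<Omega> u = fdet (case_option (\<lambda>j. fderiv (partial j) (emb \<Omega>)) (\<lambda>k j. fderiv (partial j) (u k)))"

section \<open>Poles of the images of the variables\<close>

context potential begin

text \<open>The central estimate: a pole of order $a > 0$ of the $x_i$ along a prime would have to satisfy
  $(d - 1) a \<le> n a + 1$. Instead of prime divisors, the proof uses the greatest common divisor of numerators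
  and denominator after the substitution \<^const>\<open>shift\<close>.\<close>

lemma polynomial_if_rel:
  assumes rel: "\<And>i. sg i * subst (\<lambda>c. emb (const c)) x (partial i \<Omega>) = Q_jac \<Omega> (\<lambda>k. x (coords i k))"
  shows "x j \<in> range emb"
proof -
  let ?n = "CARD('n)"
  have "\<forall>j. \<exists>a b. b \<noteq> 0 \<and> x j = Fract a b" by (meson Fract_cases)
  then obtain a0 b0 where ab: "\<And>j. b0 j \<noteq> 0" "\<And>j. x j = Fract (a0 j) (b0 j)" by metis
  define D where "D = (\<Prod>j\<in>UNIV. b0 j)"
  define y where "y = (\<lambda>j. a0 j * (\<Prod>i\<in>UNIV - {j}. b0 i))"
  have "D \<noteq> 0" using ab by (simp add: D_def)
  have x: "x j = Fract (y j) D" for j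
    using ab \<open>D \<noteq> 0\<close> by (simp add: eq_fract y_def D_def prod.remove[of UNIV j] mult_ac)
  define t where "t = Fract 1 D"
  have Dt: "emb D * t = 1" unfolding t_def Fract_mult_emb[OF \<open>D \<noteq> 0\<close>] by (rule emb_1)
  have xt: "x j = t * emb (y j)" for j by (simp add: x t_def)
  \<comment> \<open>Numerators by the quotient rule. Each of the n rows has denominator D^2, hence
    the exponent 2n in \<open>eq\<close>.\<close>
  define V where "V = (\<lambda>i. fdet (case_option (\<lambda>l. partial l \<Omega>)
      (\<lambda>k l. D * partial l (y (coords i k)) - y (coords i k) * partial l D)))"
  have eq: "sg i * (D ^ (2 * ?n) * subst const y (partial i \<Omega>)) = D ^ (d - 1) * V i" for i
  proof -
    have "subst (\<lambda>c. emb (const c)) x (partial i \<Omega>) = t ^ (d - 1) * emb (subst const y (partial i \<Omega>))"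
      using subst_scale[OF hom_partial, of "\<lambda>c. emb (const c)" t "\<lambda>j. emb (y j)" i]
      by (simp only: xt[symmetric] hom_subst[OF emb_hom])
    moreover have "Q_jac \<Omega> (\<lambda>k. x (coords i k)) = (t ^ 2) ^ ?n * emb (V i)"
    proof -
      have "fderiv (partial l) (x j) = t ^ 2 * emb (D * partial l (y j) - y j * partial l D)" for l j
        unfolding x using \<open>D \<noteq> 0\<close>
        by (simp add: fderiv_Fract deriv_partial t_def power2_eq_square mult.commute)
      then have "Q_jac \<Omega> (\<lambda>k. x (coords i k)) = fdet (\<lambda>r l. case_option 1 (\<lambda>_. t ^ 2) r *
          emb (case_option (\<lambda>l. partial l \<Omega>) (\<lambda>k l. D * partial l (y (coords i k)) - y (coords i k) * partial l D) r l))"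
        unfolding Q_jac_def
        by (intro arg_cong[where f = fdet]) (auto simp: fun_eq_iff deriv_partial split: option.split)
      then show ?thesis
        unfolding fdet_scale_rows V_def rhom.hom_fdet[OF emb_hom] by (simp add: prod_UNIV_option)
    qed
    ultimately have "sg i * (t ^ (d - 1) * emb (subst const y (partial i \<Omega>))) = t ^ (2 * ?n) * emb (V i)"
      using rel[of i] by (simp add: power_mult)
    then have "emb D ^ (d - 1) * emb D ^ (2 * ?n) * (sg i * (t ^ (d - 1) * emb (subst const y (partial i \<Omega>))))
        = emb D ^ (d - 1) * emb D ^ (2 * ?n) * (t ^ (2 * ?n) * emb (V i))" by simp
    moreover have "emb D ^ m * t ^ m = 1" for m
      by (simp only: power_mult_distrib[symmetric] Dt power_one)
    ultimately have "sg i * (emb D ^ (2 * ?n) * emb (subst const y (partial i \<Omega>))) = emb D ^ (d - 1) * emb (V i)"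
      by (metis (no_types, opaque_lifting) mult.assoc mult.commute mult.left_neutral)
    then have "emb (sg i * (D ^ (2 * ?n) * subst const y (partial i \<Omega>))) = emb (D ^ (d - 1) * V i)"
      by (simp only: rhom.homs[OF emb_hom] rhom.hom_sg[OF emb_hom])
    then show ?thesis by simp
  qed
  obtain r c where r: "\<And>j. r j > 0" and c: "c \<noteq> 0" "lead_coeff (shift r D) = const c"
    using shift_lead_coeff[OF \<open>D \<noteq> 0\<close>] by blast
  let ?s = "shiftq r :: ('k, 'n option) mpoly \<Rightarrow> _"
  let ?\<Delta> = "\<lambda>l. map_poly (fderiv (partial l)) :: ('k, 'n option) mpoly fract poly \<Rightarrow> _"
  let ?\<kappa> = "\<lambda>c. [:emb (const c):]"
  interpret s: rhom ?s by (rule shiftq_hom)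
  have \<Delta>: "deriv (?\<Delta> l)" for l by (intro deriv_map_poly deriv_fderiv deriv_partial)
  have "?s D \<noteq> 0" using shiftq_eq_0_iff[of r D] r \<open>D \<noteq> 0\<close> by simp
  \<comment> \<open>g is a greatest common divisor of the denominator and the numerators, so the
    fractions z_j / b below are reduced; the coefficients e certify this in
    \<open>bz\<close>.\<close>
  then obtain g e where g: "g \<noteq> 0" "g = (\<Sum>i\<in>UNIV. e i * case_option (?s D) (\<lambda>j. ?s (y j)) i)"
      "\<And>i. g dvd case_option (?s D) (\<lambda>j. ?s (y j)) i"
    using bezout_family[of "case_option (?s D) (\<lambda>j. ?s (y j))" None] by auto
  obtain b where b: "?s D = g * b" using g(3)[of None] by (auto simp: dvd_def)
  have "\<forall>j. \<exists>z. ?s (y j) = g * z" using g(3)[of "Some _"] by (auto simp: dvd_def)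
  then obtain z where z: "\<And>j. ?s (y j) = g * z j" by metis
  have "b \<noteq> 0" using b \<open>?s D \<noteq> 0\<close> by auto
  have bz: "1 = e None * b + (\<Sum>j\<in>UNIV. e (Some j) * z j)"
  proof -
    have "g * 1 = g * (e None * b + (\<Sum>j\<in>UNIV. e (Some j) * z j))"
      using g(2) by (subst (1) g(2)) (simp add: sum_UNIV_option b z algebra_simps sum_distrib_left)
    then show ?thesis using g(1) by (simp only: mult_cancel_left) simp
  qed
  have "b dvd subst ?\<kappa> z (partial i \<Omega>)" for i
  proof -
    define u where "u = (\<lambda>k l. ?\<Delta> l (z (coords i k)))"
    define w where "w = (\<lambda>l. ?\<Delta> l b)"
    define E where "E = case_option (\<lambda>l. ?s (partial l \<Omega>)) (\<lambda>k l. b * u k l - z (coords i k) * w l)"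
    have row: "?s D * ?\<Delta> l (?s (y j)) - ?s (y j) * ?\<Delta> l (?s D) = g ^ 2 * (b * ?\<Delta> l (z j) - z j * ?\<Delta> l b)" for l j
      unfolding b z deriv.D_mult[OF \<Delta>] by (simp add: algebra_simps power2_eq_square)
    have "?s (V i) = fdet (\<lambda>q l. case_option 1 (\<lambda>_. g ^ 2) q * E q l)"
      unfolding V_def s.hom_fdet
    proof (intro arg_cong[where f = fdet] ext)
      fix q l
      show "?s (case_option (\<lambda>l. partial l \<Omega>) (\<lambda>k l. D * partial l (y (coords i k)) - y (coords i k) * partial l D) q l)
          = case_option 1 (\<lambda>_. g ^ 2) q * E q l"
        using row[of l] by (cases q) (simp_all add: E_def u_def w_def s.hom_diff s.hom_mult shiftq_partial[symmetric])
    qed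
    then have V: "?s (V i) = g ^ (2 * ?n) * fdet E"
      by (simp add: fdet_scale_rows prod_UNIV_option power_mult)
    obtain W where W: "fdet E = b ^ (?n - 1) * W"
      using power_dvd_fdet[of b "\<lambda>l. ?s (partial l \<Omega>)" u "\<lambda>k. z (coords i k)" w] unfolding E_def dvd_def by blast
    have "?s (subst const y (partial i \<Omega>)) = g ^ (d - 1) * subst ?\<kappa> z (partial i \<Omega>)"
      using subst_scale[OF hom_partial, of ?\<kappa> g z i] by (simp only: shiftq_subst z)
    moreover have "sg i * (?s D ^ (2 * ?n) * ?s (subst const y (partial i \<Omega>))) = ?s D ^ (d - 1) * ?s (V i)"
      using arg_cong[OF eq[of i], of ?s] by (simp only: s.homs s.hom_sg)
    ultimately have "sg i * ((g * b) ^ (2 * ?n) * (g ^ (d - 1) * subst ?\<kappa> z (partial i \<Omega>)))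
        = (g * b) ^ (d - 1) * (g ^ (2 * ?n) * (b ^ (?n - 1) * W))"
      by (simp only: b V W)
    then have "g ^ (2 * ?n + (d - 1)) * (sg i * (b ^ (2 * ?n) * subst ?\<kappa> z (partial i \<Omega>)))
        = g ^ (2 * ?n + (d - 1)) * (b ^ (d - 1) * b ^ (?n - 1) * W)"
      by (simp add: power_mult_distrib power_add mult_ac)
    then have "sg i * (b ^ (2 * ?n) * subst ?\<kappa> z (partial i \<Omega>)) = b ^ (d - 1) * b ^ (?n - 1) * W"
      using g(1) by (simp only: mult_cancel_left power_eq_0_iff) simp
    \<comment> \<open>After division by b^(2n) there remains b^(d - n - 2), whose exponent is
      positive because d >= n + 3. In terms of poles this bounds the right side by (n + 1) a, which
      agrees with n a + 1 in the decisive case a = 1.\<close>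
    also have "b ^ (d - 1) * b ^ (?n - 1) = b ^ (2 * ?n) * (b * b ^ (d - ?n - 3))"
    proof -
      have "(d - 1) + (?n - 1) = 2 * ?n + (1 + (d - ?n - 3))"
        using d_ge card_ge by simp
      then have "b ^ ((d - 1) + (?n - 1)) = b ^ (2 * ?n + (1 + (d - ?n - 3)))"
        by (rule arg_cong)
      then show ?thesis by (simp only: power_add power_one_right)
    qed
    finally have "b ^ (2 * ?n) * (sg i * subst ?\<kappa> z (partial i \<Omega>)) = b ^ (2 * ?n) * (b * (b ^ (d - ?n - 3) * W))"
      by (simp add: mult_ac)
    then have "sg i * subst ?\<kappa> z (partial i \<Omega>) = b * (b ^ (d - ?n - 3) * W)"
      using \<open>b \<noteq> 0\<close> by (simp only: mult_cancel_left power_eq_0_iff) simp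
    then have "b dvd sg i * subst ?\<kappa> z (partial i \<Omega>)" by simp
    then have "b dvd sg i * (sg i * subst ?\<kappa> z (partial i \<Omega>))" by (rule dvd_mult)
    then show ?thesis by simp
  qed
  then have pw: "\<exists>m. b dvd z j ^ m" for j
    by (rule dvd_power_if_dvd_partials[OF const_fract_poly_hom])
  \<comment> \<open>A prime divisor of b would divide every z_j, against \<open>bz\<close>. That b
    is a unit means that, after the shift, D divides every numerator.\<close>
  have "is_unit b"
  proof (rule ccontr)
    assume "\<not> is_unit b"
    then obtain p where p: "prime_elem p" "p dvd b"
      using prime_divisor_exists_field_poly \<open>b \<noteq> 0\<close> by blast
    have pz: "p dvd z j" for j
    proof -
      obtain m where "b dvd z j ^ m" using pw by blast
      with p(2) have "p dvd z j ^ m" by (rule dvd_trans)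
      then show ?thesis by (rule prime_elem_dvd_power[OF p(1)])
    qed
    have "p dvd e None * b + (\<Sum>j\<in>UNIV. e (Some j) * z j)"
      by (intro dvd_add dvd_sum dvd_mult p(2) pz)
    then have "p dvd 1" unfolding bz[symmetric] .
    then show False using p(1) by (simp add: prime_elem_def)
  qed
  then have "?s D dvd ?s (y j)"
    unfolding b z by (simp add: mult_dvd_mono unit_imp_dvd)
  then have "D dvd y j" by (rule dvd_if_shiftq_dvd[OF r c])
  then obtain q where "y j = D * q" by (auto simp: dvd_def)
  then have "x j = emb q" unfolding x using \<open>D \<noteq> 0\<close> by (simp add: eq_fract mult.commute)
  then show ?thesis by blast
qed

end

section \<open>Automorphisms of the polynomial algebra\<close>

lemma np_auto_A_alg:
  "\<phi> \<in> np_auto (A_alg \<Omega>) \<longleftrightarrow> bij \<phi> \<and> rhom \<phi> \<and> (\<forall>c p. \<phi> (const c * p) = const c * \<phi> p) \<and>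
    (\<forall>f. \<phi> (jacobian_bracket \<Omega> f) = jacobian_bracket \<Omega> (\<lambda>i. \<phi> (f i)))"
  by (auto simp: np_auto_def A_alg_def Bij_def ring_hom_def rhom_def)

lemma phi_inverse:
  assumes "M \<in> linear_auts \<Omega>"
  shows "\<exists>N\<in>linear_auts \<Omega>. M ** N = mat 1 \<and> N ** M = mat 1"
proof -
  obtain N where N: "M ** N = mat 1" "N ** M = mat 1"
    using assms by (auto simp: linear_auts_def invertible_def)
  then show ?thesis using linear_auts_inv[OF assms] by blast
qed

lemma bij_phi:
  assumes "M \<in> linear_auts \<Omega>"
  shows "bij (phi M)"
proof -
  obtain N where "M ** N = mat 1" "N ** M = mat 1" using phi_inverse[OF assms] by blast
  then show ?thesis by (intro o_bij[of "phi N"]) (auto simp: fun_eq_iff phi_phi)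
qed

context potential begin

text \<open>Injectivity is asked only of linear forms, which gives invertibility of M. There it can
  be met also for w = \<Omega>, since a linear form divisible by \<Omega> is 0.\<close>

lemma linear_if_rel:
  assumes w: "w = 0 \<or> w = \<Omega>" and rel: "rel w x"
    and inj: "\<And>p. homogeneous 1 p \<Longrightarrow> w dvd subst const x p \<Longrightarrow> p = 0"
  shows "\<exists>M\<in>linear_auts \<Omega>. \<forall>p. w dvd subst const x p - phi M p"
proof -
  have "w dvd f" if "w dvd f ^ m" for f m
    using w that radical by auto
  then obtain M where M: "\<And>i. w dvd x i - lin M i" "rel 0 (lin M)"
    using rel_linear[OF w _ rel] by blast
  have cong: "w dvd subst const x p - phi M p" for p
    unfolding phi_def by (intro subst_cong_mod const_hom M)
  have "invertible M"
  proof (rule inj_imp_invertible)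
    fix c
    assume *: "(\<Sum>i\<in>UNIV. const ((M *v c) $ i) * var i) = (0 :: ('k, 'n option) mpoly)"
    let ?p = "\<Sum>i\<in>UNIV. const (c $ i) * var i :: ('k, 'n option) mpoly"
    have "phi M ?p = 0" unfolding phi_linear by (rule *)
    then have "w dvd subst const x ?p" using cong[of ?p] by simp
    then show "?p = 0" by (rule inj[OF homogeneous_linear])
  qed
  then show ?thesis using rel_0_linear_auts[OF M(2)] cong by blast
qed

lemma np_auto_A: "np_auto (A_alg \<Omega>) = phi ` linear_auts \<Omega>"
proof (intro equalityI subsetI)
  fix \<phi> assume "\<phi> \<in> np_auto (A_alg \<Omega>)"
  then have \<phi>: "bij \<phi>" "rhom \<phi>" "\<And>c p. \<phi> (const c * p) = const c * \<phi> p"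
      "\<And>f. \<phi> (jacobian_bracket \<Omega> f) = jacobian_bracket \<Omega> (\<lambda>i. \<phi> (f i))"
    by (auto simp: np_auto_A_alg)
  interpret \<phi>: rhom \<phi> by fact
  define x where "x = (\<lambda>j. \<phi> (var j))"
  have const: "\<phi> (const c) = const c" for c using \<phi>(3)[of c 1] by (simp add: \<phi>.hom_1)
  have sub: "\<phi> p = subst const x p" for p
    by (rule hom_eqI[OF \<phi>(2) subst_hom[OF const_hom]]) (simp_all add: const const_hom x_def)
  have "rel 0 x"
    unfolding rel_def
  proof
    fix i
    have "sg i * \<phi> (partial i \<Omega>) = jacobian_bracket \<Omega> (\<lambda>k. x (coords i k))"
      using \<phi>(4)[of "\<lambda>k. var (coords i k)"] unfolding jacobian_bracket_coords x_def
      by (simp add: \<phi>.hom_mult)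
    then show "0 dvd sg i * subst const x (partial i \<Omega>) - jacobian_bracket \<Omega> (\<lambda>k. x (coords i k))"
      by (simp add: sub)
  qed
  moreover have "p = 0" if "0 dvd subst const x p" for p
  proof -
    have "\<phi> p = \<phi> 0" using that by (simp add: sub[symmetric] \<phi>.hom_0)
    then show ?thesis using bij_is_inj[OF \<phi>(1)] by (simp add: inj_eq)
  qed
  ultimately obtain M where M: "M \<in> linear_auts \<Omega>" "\<forall>p. 0 dvd subst const x p - phi M p"
    using linear_if_rel[of 0 x] by blast
  then have "\<phi> = phi M" by (auto simp: fun_eq_iff sub)
  then show "\<phi> \<in> phi ` linear_auts \<Omega>" using M(1) by blast
next
  fix \<phi> assume "\<phi> \<in> phi ` linear_auts \<Omega>"
  then obtain M where M: "M \<in> linear_auts \<Omega>" "\<phi> = phi M" by blast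
  then show "\<phi> \<in> np_auto (A_alg \<Omega>)"
    by (simp add: np_auto_A_alg bij_phi phi_hom rhom.hom_mult[OF phi_hom] jacobian_bracket_phi)
qed

end

section \<open>The fraction field\<close>

lemma frac_map_Fract:
  assumes "rhom \<phi>" "inj \<phi>" "b \<noteq> 0"
  shows "frac_map \<phi> (Fract a b) = Fract (\<phi> a) (\<phi> b)"
  unfolding frac_map_def
proof (rule the_equality)
  fix r assume "\<exists>c e. e \<noteq> 0 \<and> Fract a b = Fract c e \<and> r = Fract (\<phi> c) (\<phi> e)"
  then obtain c e where e: "e \<noteq> 0" "Fract a b = Fract c e" "r = Fract (\<phi> c) (\<phi> e)" by blast
  then have "a * e = c * b" using assms(3) by (simp add: eq_fract)
  then have "\<phi> a * \<phi> e = \<phi> c * \<phi> b" by (metis rhom.hom_mult[OF assms(1)])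
  moreover have "\<phi> b \<noteq> 0" "\<phi> e \<noteq> 0"
    using assms(3) e(1) injD[OF assms(2), of _ 0] rhom.hom_0[OF assms(1)] by metis+
  ultimately show "r = Fract (\<phi> a) (\<phi> b)" using e(3) by (simp add: eq_fract)
qed (use assms(3) in blast)

lemma frac_map_hom:
  fixes \<phi> :: "'a::idom \<Rightarrow> 'a"
  assumes "rhom \<phi>" "inj \<phi>"
  shows "rhom (frac_map \<phi>)"
proof
  interpret rhom \<phi> by fact
  fix x y :: "'a fract"
  obtain a b where x: "x = Fract a b" "b \<noteq> 0" by (meson Fract_cases)
  obtain c e where y: "y = Fract c e" "e \<noteq> 0" by (meson Fract_cases)
  have ne: "\<phi> b \<noteq> 0" "\<phi> e \<noteq> 0"
    using x(2) y(2) injD[OF assms(2), of _ 0] hom_0 by metis+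
  have F: "frac_map \<phi> (Fract u v) = Fract (\<phi> u) (\<phi> v)" if "v \<noteq> 0" for u v
    using frac_map_Fract[OF assms that] by simp
  show "frac_map \<phi> (x + y) = frac_map \<phi> x + frac_map \<phi> y"
    using x(2) y(2) ne unfolding x(1) y(1) by (simp add: F homs)
  show "frac_map \<phi> (x * y) = frac_map \<phi> x * frac_map \<phi> y"
    using x(2) y(2) unfolding x(1) y(1) by (simp add: F homs)
  show "frac_map \<phi> 1 = 1"
    unfolding One_fract_def using F[of 1 1] by (simp only: hom_1) simp
qed

lemma comm_derivs_fderiv:
  "comm_derivs (\<lambda>j. fderiv (partial j) :: ('k::field_char_0, 'n::{finite,linorder} option) mpoly fract \<Rightarrow> _)"
proof (rule comm_derivs.intro)
  have "emb (2 :: ('k, 'n option) mpoly) \<noteq> 0" by (simp del: emb_1)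
  moreover have "emb (2 :: ('k, 'n option) mpoly) = 2"
    using rhom.hom_of_nat[OF emb_hom, of 2] by simp
  ultimately show "(2 :: ('k, 'n option) mpoly fract) \<noteq> 0" by simp
qed (auto intro!: deriv_fderiv fderiv_commute deriv_partial partial_commute)

lemma frac_alg_simps:
  "carrier (frac_alg B) = UNIV" "x \<oplus>\<^bsub>frac_alg B\<^esub> y = x + y" "x \<otimes>\<^bsub>frac_alg B\<^esub> y = x * y"
  "\<zero>\<^bsub>frac_alg B\<^esub> = 0" "\<one>\<^bsub>frac_alg B\<^esub> = 1" "c \<odot>\<^bsub>frac_alg B\<^esub> x = emb (const c) * x" "nbracket (frac_alg B) = B"
  by (simp_all add: frac_alg_def)

lemma algebra_frac_alg: "algebra ring_of_type_algebra (frac_alg B)"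
proof (rule algebraI)
  have "\<exists>y. x + y = 0" for x :: "('a, 'b option) mpoly fract"
    using add.right_inverse by blast
  then show "cring (frac_alg B)"
    by unfold_locales (auto simp: frac_alg_simps algebra_simps Units_def)
  have h: "emb (const (a + b)) = emb (const a) + emb (const b)" "emb (const (a * b)) = emb (const a) * emb (const b)"
    "emb (const (1 :: 'a)) = 1" for a b :: 'a
    by (simp_all only: rhom.homs[OF rhom_comp[OF emb_hom const_hom]])
  show "cring (ring_of_type_algebra :: 'a ring)" by (rule cring_from_type_algebra)
qed (auto simp: frac_alg_simps ring_type_simps algebra_simps rhom.homs[OF const_hom] rhom.homs[OF emb_hom]
      simp del: mult_fract add_fract)

lemma finsum_type_sum:
  fixes G :: "('a::comm_monoid_add, 'm) ring_scheme"
  assumes "abelian_monoid G" "ring.add G = (+)" "carrier G = UNIV" "ring.zero G = 0" "finite S"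
  shows "finsum G f S = sum f S"
proof -
  interpret abelian_monoid G by fact
  show ?thesis
    using assms(5) by (induction S) (simp_all add: assms(2-4) Pi_def)
qed

lemma Q_jac_emb: "Q_jac \<Omega> (\<lambda>i. emb (f i)) = emb (jacobian_bracket \<Omega> f)"
  unfolding Q_jac_def jacobian_bracket_fdet rhom.hom_fdet[OF emb_hom]
  by (intro arg_cong[where f = fdet]) (auto simp: fun_eq_iff deriv_partial split: option.split)

lemma nambu_poisson_Q_jac:
  fixes \<Omega> :: "('k::field_char_0, 'n::{finite,linorder} option) mpoly"
  shows "nambu_poisson_algebra ring_of_type_algebra (frac_alg (Q_jac \<Omega>))"
proof -
  interpret algebra ring_of_type_algebra "frac_alg (Q_jac \<Omega>)" by (rule algebra_frac_alg)
  interpret D: comm_derivs "\<lambda>j. fderiv (partial j) :: ('k, 'n option) mpoly fract \<Rightarrow> _"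
    by (rule comm_derivs_fderiv)
  have jac: "Q_jac \<Omega> u = D.jac (case_option (emb \<Omega>) u)" for u
    unfolding Q_jac_def D.jac_def
    by (intro arg_cong[where f = fdet]) (auto simp: fun_eq_iff split: option.split)
  have upd: "Q_jac \<Omega> (u(i := x)) = D.jac ((case_option (emb \<Omega>) u)(Some i := x))" for u i x
    by (simp only: jac case_option_upd_Some)
  have const: "D.jac (f(r := emb (const c))) = 0" for f r c
    unfolding D.jac_upd by (simp add: deriv_partial fdet_row_0)
  show ?thesis
  proof
    fix u v :: "'n \<Rightarrow> ('k, 'n option) mpoly fract" and x y and i j r :: 'n and c :: 'k
    show "nbracket (frac_alg (Q_jac \<Omega>)) (u(i := x \<oplus>\<^bsub>frac_alg (Q_jac \<Omega>)\<^esub> y))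
        = nbracket (frac_alg (Q_jac \<Omega>)) (u(i := x)) \<oplus>\<^bsub>frac_alg (Q_jac \<Omega>)\<^esub> nbracket (frac_alg (Q_jac \<Omega>)) (u(i := y))"
      unfolding frac_alg_simps upd by (rule D.jac_add)
    show "nbracket (frac_alg (Q_jac \<Omega>)) (u(i := c \<odot>\<^bsub>frac_alg (Q_jac \<Omega>)\<^esub> x))
        = c \<odot>\<^bsub>frac_alg (Q_jac \<Omega>)\<^esub> nbracket (frac_alg (Q_jac \<Omega>)) (u(i := x))"
      unfolding frac_alg_simps upd D.jac_mult const by simp
    show "nbracket (frac_alg (Q_jac \<Omega>)) (u(i := x \<otimes>\<^bsub>frac_alg (Q_jac \<Omega>)\<^esub> y))
        = x \<otimes>\<^bsub>frac_alg (Q_jac \<Omega>)\<^esub> nbracket (frac_alg (Q_jac \<Omega>)) (u(i := y))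
          \<oplus>\<^bsub>frac_alg (Q_jac \<Omega>)\<^esub> nbracket (frac_alg (Q_jac \<Omega>)) (u(i := x)) \<otimes>\<^bsub>frac_alg (Q_jac \<Omega>)\<^esub> y"
      unfolding frac_alg_simps upd D.jac_mult by (simp only: mult.commute)
    show "nbracket (frac_alg (Q_jac \<Omega>)) u = \<zero>\<^bsub>frac_alg (Q_jac \<Omega>)\<^esub>" if "i \<noteq> j" "u i = u j"
      unfolding frac_alg_simps jac using that by (intro D.jac_same[of "Some i" "Some j"]) auto
    show "nbracket (frac_alg (Q_jac \<Omega>)) (v(r := nbracket (frac_alg (Q_jac \<Omega>)) u)) =
        (\<Oplus>\<^bsub>frac_alg (Q_jac \<Omega>)\<^esub>s\<in>UNIV. nbracket (frac_alg (Q_jac \<Omega>)) (u(s := nbracket (frac_alg (Q_jac \<Omega>)) (v(r := u s)))))"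
    proof -
      let ?u = "case_option (emb \<Omega>) u" and ?v = "case_option (emb \<Omega>) v"
      \<comment> \<open>The identity in n + 1 slots has an extra summand, that of the slot holding
        \<Omega>. It vanishes because a bracket with an entry \<Omega> is 0.\<close>
      have "D.jac (?v(Some r := emb \<Omega>)) = 0"
        by (rule D.jac_same[of None "Some r"]) auto
      then have 0: "D.jac (?u(None := D.jac (?v(Some r := ?u None)))) = 0"
        by (simp only: option.case D.jac_0)
      have "Q_jac \<Omega> (v(r := Q_jac \<Omega> u)) = D.jac (?v(Some r := D.jac ?u))"
        by (simp only: upd jac[of u])
      also have "\<dots> = (\<Sum>s\<in>UNIV. D.jac (?u(s := D.jac (?v(Some r := ?u s)))))"
        by (rule D.jac_fundamental)
      also have "\<dots> = (\<Sum>s\<in>UNIV. D.jac (?u(Some s := D.jac (?v(Some r := u s)))))"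
        unfolding sum_UNIV_option 0 by (simp only: option.case add_0_left)
      also have "\<dots> = (\<Sum>s\<in>UNIV. Q_jac \<Omega> (u(s := Q_jac \<Omega> (v(r := u s)))))"
        by (simp only: upd)
      also have "\<dots> = (\<Oplus>\<^bsub>frac_alg (Q_jac \<Omega>)\<^esub>s\<in>UNIV. Q_jac \<Omega> (u(s := Q_jac \<Omega> (v(r := u s)))))"
        by (rule finsum_type_sum[symmetric, OF module.axioms(2)[OF algebra.axioms(1)[OF algebra_frac_alg], THEN abelian_group.axioms(1)]])
          (simp_all add: frac_alg_def)
      finally show ?thesis by (simp only: frac_alg_simps)
    qed
  qed (simp add: frac_alg_simps)
qed

text \<open>Uniqueness follows from the Leibniz rule through \<open>multiderivation_eqI\<close>,
  existence is \<open>nambu_poisson_Q_jac\<close>.\<close>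

lemma Q_bracket_eq:
  fixes \<Omega> :: "('k::field_char_0, 'n::{finite,linorder} option) mpoly"
  shows "Q_bracket \<Omega> = Q_jac \<Omega>"
  unfolding Q_bracket_def
proof (rule the_equality)
  have leib: "B (u(i := x * y)) = x * B (u(i := y)) + B (u(i := x)) * y"
    if "nambu_poisson_algebra ring_of_type_algebra (frac_alg B)" for B and u :: "'n \<Rightarrow> ('k, 'n option) mpoly fract" and i x y
    using nambu_poisson_algebra.leibniz[OF that, where u = u and x = x and y = y and i = i] by (simp add: frac_alg_simps)
  fix B :: "('n \<Rightarrow> ('k, 'n option) mpoly fract) \<Rightarrow> ('k, 'n option) mpoly fract"
  assume B: "nambu_poisson_algebra ring_of_type_algebra (frac_alg B) \<and>
    (\<forall>f. B (\<lambda>i. emb (f i)) = emb (jacobian_bracket \<Omega> f))"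
  show "B = Q_jac \<Omega>"
  proof
    fix u
    show "B u = Q_jac \<Omega> u"
      by (rule multiderivation_eqI[OF rhom_id leib leib])
        (use B nambu_poisson_Q_jac in \<open>simp_all add: Q_jac_emb\<close>)
  qed
qed (simp add: nambu_poisson_Q_jac Q_jac_emb)

lemma Q_jac_mult:
  fixes \<Omega> :: "('k::field_char_0, 'n::{finite,linorder} option) mpoly"
  shows "Q_jac \<Omega> (u(i := x * y)) = x * Q_jac \<Omega> (u(i := y)) + Q_jac \<Omega> (u(i := x)) * y"
  using nambu_poisson_algebra.leibniz[OF nambu_poisson_Q_jac, where u = u and x = x and y = y and i = i] by (simp add: frac_alg_simps)

lemma np_auto_Q_alg:
  fixes \<Omega> :: "('k::field_char_0, 'n::{finite,linorder} option) mpoly"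
  shows "F \<in> np_auto (Q_alg \<Omega>) \<longleftrightarrow> bij F \<and> rhom F \<and> (\<forall>c p. F (emb (const c) * p) = emb (const c) * F p) \<and>
    (\<forall>f. F (Q_jac \<Omega> f) = Q_jac \<Omega> (\<lambda>i. F (f i)))"
  by (auto simp: np_auto_def Q_alg_def frac_alg_simps Bij_def ring_hom_def rhom_def Q_bracket_eq)

lemma inj_phi: "M \<in> linear_auts \<Omega> \<Longrightarrow> inj (phi M)"
  by (rule bij_is_inj[OF bij_phi])

lemma phi_eq_0:
  assumes "M \<in> linear_auts \<Omega>" "phi M a = 0"
  shows "a = 0"
  using inj_phi[OF assms(1)] assms(2) rhom.hom_0[OF phi_hom] by (metis injD)

lemma frac_map_phi_phi:
  assumes "M \<in> linear_auts \<Omega>" "N \<in> linear_auts \<Omega>"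
  shows "frac_map (phi M) (frac_map (phi N) q) = frac_map (phi (M ** N)) q"
proof -
  obtain a b where q: "q = Fract a b" "b \<noteq> 0" by (meson Fract_cases)
  have "phi N b \<noteq> 0" using phi_eq_0[OF assms(2)] q(2) by blast
  then show ?thesis
    unfolding q(1) frac_map_Fract[OF phi_hom inj_phi[OF assms(2)] q(2)]
      frac_map_Fract[OF phi_hom inj_phi[OF linear_auts_mult[OF assms]] q(2)]
    by (subst frac_map_Fract[OF phi_hom inj_phi[OF assms(1)]]) (simp_all only: phi_phi not_False_eq_True)
qed

lemma frac_map_phi_1: "frac_map (phi (mat 1)) q = q"
proof -
  obtain a b where q: "q = Fract a b" "b \<noteq> 0" by (meson Fract_cases)
  show ?thesis
    unfolding q(1) by (subst frac_map_Fract[OF phi_hom]) (use q(2) in \<open>simp_all add: inj_def\<close>)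
qed

lemma frac_map_phi_emb:
  assumes "M \<in> linear_auts \<Omega>"
  shows "frac_map (phi M) (emb p) = emb (phi M p)"
  by (subst frac_map_Fract[OF phi_hom inj_phi[OF assms]]) (simp_all add: rhom.hom_1[OF phi_hom])

context potential begin

lemma np_auto_Q: "np_auto (Q_alg \<Omega>) = (\<lambda>M. frac_map (phi M)) ` linear_auts \<Omega>"
proof (intro equalityI subsetI)
  fix F assume "F \<in> np_auto (Q_alg \<Omega>)"
  then have F: "bij F" "rhom F" "\<And>c p. F (emb (const c) * p) = emb (const c) * F p"
      "\<And>f. F (Q_jac \<Omega> f) = Q_jac \<Omega> (\<lambda>i. F (f i))"
    by (auto simp: np_auto_Q_alg)
  interpret F: rhom F by fact
  define x where "x = (\<lambda>j. F (emb (var j)))"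
  let ?\<kappa> = "\<lambda>c. emb (const c)"
  have \<kappa>: "rhom ?\<kappa>" by (rule rhom_comp[OF emb_hom const_hom])
  have const: "F (emb (const c)) = emb (const c)" for c using F(3)[of c 1] by (simp add: F.hom_1)
  have sub: "F (emb p) = subst ?\<kappa> x p" for p
    by (rule hom_eqI[OF rhom_comp[OF F(2) emb_hom] subst_hom[OF \<kappa>]]) (simp_all add: const \<kappa> x_def)
  have rel: "sg i * subst ?\<kappa> x (partial i \<Omega>) = Q_jac \<Omega> (\<lambda>k. x (coords i k))" for i
  proof -
    have "Q_jac \<Omega> (\<lambda>k. x (coords i k)) = F (emb (sg i * partial i \<Omega>))"
      using F(4)[of "\<lambda>k. emb (var (coords i k))"] unfolding Q_jac_emb jacobian_bracket_coords x_def by (rule sym)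
    also have "\<dots> = sg i * F (emb (partial i \<Omega>))"
      by (simp only: rhom.hom_mult[OF emb_hom] rhom.hom_sg[OF emb_hom] F.hom_mult F.hom_sg)
    finally show ?thesis unfolding sub by (rule sym)
  qed
  \<comment> \<open>The pole estimate enters: F maps variables to polynomials, and the argument for
    \<open>A_alg\<close> takes over.\<close>
  have "\<forall>j. \<exists>a. x j = emb a" using polynomial_if_rel[OF rel] by blast
  then obtain y where y: "\<And>j. x j = emb (y j)" by metis
  have sub': "F (emb p) = emb (subst const y p)" for p
    unfolding sub hom_subst[OF emb_hom] y ..
  have "rel 0 y"
    unfolding rel_def
  proof
    fix i
    have "emb (sg i * subst const y (partial i \<Omega>)) = emb (jacobian_bracket \<Omega> (\<lambda>k. y (coords i k)))"
      using rel[of i] unfolding sub[symmetric] sub' y Q_jac_emb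
      by (simp only: rhom.hom_mult[OF emb_hom] rhom.hom_sg[OF emb_hom])
    then show "0 dvd sg i * subst const y (partial i \<Omega>) - jacobian_bracket \<Omega> (\<lambda>k. y (coords i k))"
      by simp
  qed
  moreover have "p = 0" if "0 dvd subst const y p" for p
  proof -
    have "F (emb p) = F 0" using that by (simp add: sub' F.hom_0)
    then show ?thesis using bij_is_inj[OF F(1)] by (simp add: inj_eq)
  qed
  ultimately obtain M where M: "M \<in> linear_auts \<Omega>" "\<forall>p. 0 dvd subst const y p - phi M p"
    using linear_if_rel[of 0 y] by blast
  then have FM: "F (emb p) = emb (phi M p)" for p by (simp add: sub')
  have "F q = frac_map (phi M) q" for q
  proof -
    obtain a b where q: "q = Fract a b" "b \<noteq> 0" by (meson Fract_cases)
    have ne: "emb (phi M b) \<noteq> 0" using phi_eq_0[OF M(1)] q(2) by auto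
    have "emb (phi M b) * F q = emb (phi M a)"
      unfolding FM[symmetric] F.hom_mult[symmetric] q(1) Fract_mult_emb[OF q(2)] ..
    moreover have "emb (phi M b) * frac_map (phi M) q = emb (phi M a)"
      unfolding q(1) frac_map_Fract[OF phi_hom inj_phi[OF M(1)] q(2)]
      by (rule Fract_mult_emb) (use ne in simp)
    ultimately show ?thesis using ne by (metis mult_left_cancel)
  qed
  then have "F = frac_map (phi M)" by (rule ext)
  then show "F \<in> (\<lambda>M. frac_map (phi M)) ` linear_auts \<Omega>" using M(1) by blast
next
  fix F assume "F \<in> (\<lambda>M. frac_map (phi M)) ` linear_auts \<Omega>"
  then obtain M where M: "M \<in> linear_auts \<Omega>" "F = frac_map (phi M)" by blast
  obtain N where N: "N \<in> linear_auts \<Omega>" "M ** N = mat 1" "N ** M = mat 1"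
    using phi_inverse[OF M(1)] by blast
  have hom: "rhom F" unfolding M(2) by (rule frac_map_hom[OF phi_hom inj_phi[OF M(1)]])
  have "bij F"
    unfolding M(2) using M(1) N
    by (intro o_bij[of "frac_map (phi N)"]) (auto simp: fun_eq_iff frac_map_phi_phi frac_map_phi_1)
  \<comment> \<open>Both sides obey a Leibniz rule twisted by F, so they may be compared on
    polynomials.\<close>
  moreover have "F (Q_jac \<Omega> f) = Q_jac \<Omega> (\<lambda>i. F (f i))" for f
  proof (rule multiderivation_eqI[OF hom, where u = f and ?B1.0 = "\<lambda>f. F (Q_jac \<Omega> f)" and ?B2.0 = "\<lambda>f. Q_jac \<Omega> (\<lambda>i. F (f i))"])
    fix u i x y
    show "F (Q_jac \<Omega> (u(i := x * y))) = F x * F (Q_jac \<Omega> (u(i := y))) + F (Q_jac \<Omega> (u(i := x))) * F y"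
      unfolding Q_jac_mult by (simp add: rhom.homs[OF hom])
    have upd: "(\<lambda>j. F ((u(i := z)) j)) = (\<lambda>j. F (u j))(i := F z)" for z by auto
    show "Q_jac \<Omega> (\<lambda>j. F ((u(i := x * y)) j)) = F x * Q_jac \<Omega> (\<lambda>j. F ((u(i := y)) j)) + Q_jac \<Omega> (\<lambda>j. F ((u(i := x)) j)) * F y"
      unfolding upd rhom.hom_mult[OF hom] by (rule Q_jac_mult)
  next
    fix f
    show "F (Q_jac \<Omega> (\<lambda>i. emb (f i))) = Q_jac \<Omega> (\<lambda>i. F (emb (f i)))"
      unfolding M(2) frac_map_phi_emb[OF M(1)] Q_jac_emb jacobian_bracket_phi[OF M(1)] ..
  qed
  moreover have "F (emb (const c) * p) = emb (const c) * F p" for c p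
    unfolding rhom.hom_mult[OF hom] using frac_map_phi_emb[OF M(1), of "const c"] by (simp add: M(2))
  ultimately show "F \<in> np_auto (Q_alg \<Omega>)" using hom by (simp add: np_auto_Q_alg)
qed

end

section \<open>The quotient algebra\<close>

definition pcoset :: "('k::field, 'n::finite option) mpoly \<Rightarrow> ('k, 'n option) mpoly \<Rightarrow> ('k, 'n option) mpoly set" where
  "pcoset \<Omega> p = {q. \<Omega> dvd q - p}"

lemma pcoset_self: "p \<in> pcoset \<Omega> p"
  by (simp add: pcoset_def)

lemma pcoset_eq_iff: "pcoset \<Omega> p = pcoset \<Omega> q \<longleftrightarrow> \<Omega> dvd p - q"
proof
  assume "pcoset \<Omega> p = pcoset \<Omega> q"
  then show "\<Omega> dvd p - q" using pcoset_self[of p \<Omega>] by (simp add: pcoset_def)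
next
  assume pq: "\<Omega> dvd p - q"
  have "\<Omega> dvd r - p \<longleftrightarrow> \<Omega> dvd r - q" for r
    using dvd_add[of \<Omega> "r - p" "p - q"] dvd_diff[of \<Omega> "r - q" "p - q"] pq by auto
  then show "pcoset \<Omega> p = pcoset \<Omega> q" by (simp add: pcoset_def)
qed

lemma UN_pcoset: "u \<in> S \<Longrightarrow> (\<And>v. v \<in> S \<Longrightarrow> \<Omega> dvd f v - f u) \<Longrightarrow> (\<Union>v\<in>S. pcoset \<Omega> (f v)) = pcoset \<Omega> (f u)"
  using pcoset_eq_iff[of \<Omega>] by blast

lemma A_alg_simps:
  "carrier (A_alg \<Omega>) = UNIV" "x \<oplus>\<^bsub>A_alg \<Omega>\<^esub> y = x + y" "x \<otimes>\<^bsub>A_alg \<Omega>\<^esub> y = x * y"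
  "\<one>\<^bsub>A_alg \<Omega>\<^esub> = 1" "c \<odot>\<^bsub>A_alg \<Omega>\<^esub> x = const c * x" "nbracket (A_alg \<Omega>) = jacobian_bracket \<Omega>"
  by (simp_all add: A_alg_def)

lemma PIdl_A_alg: "PIdl\<^bsub>A_alg \<Omega>\<^esub> \<Omega> = {q. \<Omega> dvd q}"
  by (auto simp: cgenideal_def A_alg_simps dvd_def mult.commute)

lemma coset_A_alg: "PIdl\<^bsub>A_alg \<Omega>\<^esub> \<Omega> +>\<^bsub>A_alg \<Omega>\<^esub> p = pcoset \<Omega> p"
  unfolding PIdl_A_alg
proof (intro equalityI subsetI)
  fix q assume "q \<in> pcoset \<Omega> p"
  then show "q \<in> {q. \<Omega> dvd q} +>\<^bsub>A_alg \<Omega>\<^esub> p"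
    by (auto simp: a_r_coset_def' A_alg_simps pcoset_def intro!: exI[of _ "q - p"])
qed (auto simp: a_r_coset_def' A_alg_simps pcoset_def)

lemma carrier_P: "carrier (P_alg \<Omega>) = range (pcoset \<Omega>)"
  by (auto simp: P_alg_def np_quot_def FactRing_def A_RCOSETS_def' coset_A_alg A_alg_simps)

lemma mult_P: "pcoset \<Omega> p \<otimes>\<^bsub>P_alg \<Omega>\<^esub> pcoset \<Omega> q = pcoset \<Omega> (p * q)"
proof -
  have "\<Omega> dvd a * b - p * q" if "\<Omega> dvd a - p" "\<Omega> dvd b - q" for a b
  proof -
    have "a * b - p * q = a * (b - q) + (a - p) * q" by (simp add: algebra_simps)
    then show ?thesis using that by simp
  qed
  then have "(\<Union>a\<in>pcoset \<Omega> p. \<Union>b\<in>pcoset \<Omega> q. pcoset \<Omega> (a * b)) = (\<Union>a\<in>pcoset \<Omega> p. \<Union>b\<in>pcoset \<Omega> q. pcoset \<Omega> (p * q))"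
    by (intro SUP_cong refl) (simp add: pcoset_eq_iff, simp add: pcoset_def)
  also have "\<dots> = pcoset \<Omega> (p * q)" using pcoset_self by blast
  finally show ?thesis
    by (simp add: P_alg_def np_quot_def FactRing_def rcoset_mult_def coset_A_alg A_alg_simps)
qed

lemma add_P: "pcoset \<Omega> p \<oplus>\<^bsub>P_alg \<Omega>\<^esub> pcoset \<Omega> q = pcoset \<Omega> (p + q)"
proof -
  have "(\<Union>a\<in>pcoset \<Omega> p. \<Union>b\<in>pcoset \<Omega> q. {a + b}) = pcoset \<Omega> (p + q)"
  proof (intro equalityI subsetI)
    fix r assume "r \<in> pcoset \<Omega> (p + q)"
    then have "r - q \<in> pcoset \<Omega> p" by (simp add: pcoset_def algebra_simps)
    moreover have "r = (r - q) + q" by simp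
    ultimately show "r \<in> (\<Union>a\<in>pcoset \<Omega> p. \<Union>b\<in>pcoset \<Omega> q. {a + b})" using pcoset_self by blast
  next
    fix r assume "r \<in> (\<Union>a\<in>pcoset \<Omega> p. \<Union>b\<in>pcoset \<Omega> q. {a + b})"
    then obtain a b where ab: "r = a + b" "\<Omega> dvd a - p" "\<Omega> dvd b - q" by (auto simp: pcoset_def)
    have "r - (p + q) = (a - p) + (b - q)" by (simp add: ab(1))
    then show "r \<in> pcoset \<Omega> (p + q)" using dvd_add[OF ab(2,3)] by (simp only: pcoset_def mem_Collect_eq)
  qed
  then show ?thesis
    by (simp add: P_alg_def np_quot_def FactRing_def set_add_def' A_alg_simps)
qed

lemma one_P: "\<one>\<^bsub>P_alg \<Omega>\<^esub> = pcoset \<Omega> 1"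
  by (simp add: P_alg_def np_quot_def FactRing_def coset_A_alg A_alg_simps)

lemma smult_P: "c \<odot>\<^bsub>P_alg \<Omega>\<^esub> pcoset \<Omega> p = pcoset \<Omega> (const c * p)"
proof -
  have "(\<Union>x\<in>pcoset \<Omega> p. pcoset \<Omega> (const c * x)) = pcoset \<Omega> (const c * p)"
    by (intro UN_pcoset pcoset_self) (simp add: pcoset_def right_diff_distrib[symmetric])
  then show ?thesis by (simp add: P_alg_def np_quot_def coset_A_alg A_alg_simps)
qed

lemma nbracket_P: "nbracket (P_alg \<Omega>) (\<lambda>i. pcoset \<Omega> (f i)) = pcoset \<Omega> (jacobian_bracket \<Omega> f)"
proof -
  have "(\<Union>u\<in>{u. \<forall>i. u i \<in> pcoset \<Omega> (f i)}. pcoset \<Omega> (jacobian_bracket \<Omega> u)) = pcoset \<Omega> (jacobian_bracket \<Omega> f)"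
  proof (rule UN_pcoset)
    show "f \<in> {u. \<forall>i. u i \<in> pcoset \<Omega> (f i)}" by (simp add: pcoset_self)
    fix v assume "v \<in> {u. \<forall>i. u i \<in> pcoset \<Omega> (f i)}"
    then show "\<Omega> dvd jacobian_bracket \<Omega> v - jacobian_bracket \<Omega> f"
      by (intro jacobian_bracket_cong_mod) (simp add: pcoset_def)
  qed
  then show ?thesis by (simp add: P_alg_def np_quot_def coset_A_alg A_alg_simps)
qed

lemmas P_alg_simps = mult_P add_P one_P smult_P nbracket_P

lemma dvd_phi_iff:
  fixes \<Omega> :: "('k::field, 'v::finite) mpoly"
  assumes "M \<in> linear_auts \<Omega>"
  shows "\<Omega> dvd phi M p \<longleftrightarrow> \<Omega> dvd p"
proof -
  have "\<Omega> dvd phi M p" if "M \<in> linear_auts \<Omega>" "\<Omega> dvd p" for M p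
  proof -
    have "phi M \<Omega> dvd phi M p" by (rule rhom.hom_dvd[OF phi_hom that(2)])
    moreover have "\<Omega> dvd phi M \<Omega>" using that(1) by (simp add: linear_auts_def)
    ultimately show ?thesis by (rule dvd_trans[rotated])
  qed
  moreover obtain N where "N \<in> linear_auts \<Omega>" "N ** M = mat 1" using phi_inverse[OF assms] by blast
  ultimately show ?thesis using assms phi_phi[of N M p] by (metis phi_mat_1)
qed

lemma phi_image_pcoset:
  fixes \<Omega> :: "('k::field, 'n::finite option) mpoly"
  assumes "M \<in> linear_auts \<Omega>"
  shows "phi M ` pcoset \<Omega> p = pcoset \<Omega> (phi M p)"
proof (intro equalityI subsetI)
  fix q assume "q \<in> phi M ` pcoset \<Omega> p"
  then obtain r where r: "q = phi M r" "\<Omega> dvd r - p" by (auto simp: pcoset_def)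
  then have "\<Omega> dvd phi M (r - p)" by (simp only: dvd_phi_iff[OF assms])
  then show "q \<in> pcoset \<Omega> (phi M p)"
    unfolding pcoset_def r(1) rhom.hom_diff[OF phi_hom] by simp
next
  fix q assume q: "q \<in> pcoset \<Omega> (phi M p)"
  obtain r where r: "q = phi M r" using surjD[OF bij_is_surj[OF bij_phi[OF assms]]] by blast
  have "\<Omega> dvd phi M (r - p)"
    using q unfolding pcoset_def r rhom.hom_diff[OF phi_hom] by simp
  then have "r \<in> pcoset \<Omega> p" unfolding pcoset_def dvd_phi_iff[OF assms] by simp
  then show "q \<in> phi M ` pcoset \<Omega> p" unfolding r by (rule imageI)
qed

abbreviation qmap :: "('k::field, 'n::finite option) mpoly \<Rightarrow> 'k ^ 'n option ^ 'n option \<Rightarrow> ('k, 'n option) mpoly set \<Rightarrow> ('k, 'n option) mpoly set" where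
  "qmap \<Omega> M \<equiv> quot_map (A_alg \<Omega>) (PIdl\<^bsub>A_alg \<Omega>\<^esub> \<Omega>) (phi M)"

lemma qmap_pcoset:
  assumes "M \<in> linear_auts \<Omega>"
  shows "qmap \<Omega> M (pcoset \<Omega> p) = pcoset \<Omega> (phi M p)"
  using phi_image_pcoset[OF assms] carrier_P[of \<Omega>]
  by (simp add: quot_map_def P_alg_def[symmetric])

lemma qmap_extensional: "qmap \<Omega> M \<in> extensional (range (pcoset \<Omega>))"
  using carrier_P[of \<Omega>] by (simp add: quot_map_def P_alg_def[symmetric])

lemma np_auto_P_alg:
  fixes \<Omega> :: "('k::field, 'n::finite option) mpoly"
  shows "F \<in> np_auto (P_alg \<Omega>) \<longleftrightarrow> F \<in> extensional (range (pcoset \<Omega>)) \<and> bij_betw F (range (pcoset \<Omega>)) (range (pcoset \<Omega>)) \<and>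
    (\<forall>p q. F (pcoset \<Omega> (p * q)) = F (pcoset \<Omega> p) \<otimes>\<^bsub>P_alg \<Omega>\<^esub> F (pcoset \<Omega> q)) \<and>
    (\<forall>p q. F (pcoset \<Omega> (p + q)) = F (pcoset \<Omega> p) \<oplus>\<^bsub>P_alg \<Omega>\<^esub> F (pcoset \<Omega> q)) \<and>
    F (pcoset \<Omega> 1) = pcoset \<Omega> 1 \<and> (\<forall>c p. F (pcoset \<Omega> (const c * p)) = c \<odot>\<^bsub>P_alg \<Omega>\<^esub> F (pcoset \<Omega> p)) \<and>
    (\<forall>f. F (pcoset \<Omega> (jacobian_bracket \<Omega> f)) = nbracket (P_alg \<Omega>) (\<lambda>i. F (pcoset \<Omega> (f i))))"
proof -
  have fam: "(\<forall>u\<in>UNIV \<rightarrow> range (pcoset \<Omega>). Q u) \<longleftrightarrow> (\<forall>f. Q (\<lambda>i. pcoset \<Omega> (f i)))" for Q :: "('n \<Rightarrow> _) \<Rightarrow> bool"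
  proof (intro iffI ballI allI)
    fix u :: "'n \<Rightarrow> _" assume *: "\<forall>f. Q (\<lambda>i. pcoset \<Omega> (f i))" "u \<in> UNIV \<rightarrow> range (pcoset \<Omega>)"
    then have "\<forall>i. \<exists>p. u i = pcoset \<Omega> p" by blast
    then obtain f where "\<And>i. u i = pcoset \<Omega> (f i)" by metis
    then have "u = (\<lambda>i. pcoset \<Omega> (f i))" by (rule ext)
    then show "Q u" using *(1) by simp
  qed auto
  have ch: "F \<in> range (pcoset \<Omega>) \<rightarrow> range (pcoset \<Omega>)" if "bij_betw F (range (pcoset \<Omega>)) (range (pcoset \<Omega>))" for F
    using that by (auto simp: bij_betw_def)
  have two: "(\<forall>C E. C \<in> range (pcoset \<Omega>) \<and> E \<in> range (pcoset \<Omega>) \<longrightarrow> R C E) \<longleftrightarrow>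
      (\<forall>p q. R (pcoset \<Omega> p) (pcoset \<Omega> q))" for R
    by blast
  show ?thesis
    unfolding np_auto_def Bij_def ring_hom_def carrier_P fam nbracket_P two
    by (auto simp: P_alg_simps dest: ch)
qed

context potential begin

lemma np_auto_P: "np_auto (P_alg \<Omega>) = qmap \<Omega> ` linear_auts \<Omega>"
proof (intro equalityI subsetI)
  fix F assume "F \<in> np_auto (P_alg \<Omega>)"
  then have F: "F \<in> extensional (range (pcoset \<Omega>))" "bij_betw F (range (pcoset \<Omega>)) (range (pcoset \<Omega>))"
      "\<And>p q. F (pcoset \<Omega> (p * q)) = F (pcoset \<Omega> p) \<otimes>\<^bsub>P_alg \<Omega>\<^esub> F (pcoset \<Omega> q)"
      "\<And>p q. F (pcoset \<Omega> (p + q)) = F (pcoset \<Omega> p) \<oplus>\<^bsub>P_alg \<Omega>\<^esub> F (pcoset \<Omega> q)"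
      "F (pcoset \<Omega> 1) = pcoset \<Omega> 1" "\<And>c p. F (pcoset \<Omega> (const c * p)) = c \<odot>\<^bsub>P_alg \<Omega>\<^esub> F (pcoset \<Omega> p)"
      "\<And>f. F (pcoset \<Omega> (jacobian_bracket \<Omega> f)) = nbracket (P_alg \<Omega>) (\<lambda>i. F (pcoset \<Omega> (f i)))"
    unfolding np_auto_P_alg by blast+
  have "F (pcoset \<Omega> p) \<in> range (pcoset \<Omega>)" for p using bij_betwE[OF F(2)] by blast
  then have "\<forall>j. \<exists>p. F (pcoset \<Omega> (var j)) = pcoset \<Omega> p" by blast
  \<comment> \<open>Arbitrary representatives; modulo \<Omega>, F is the substitution of x.\<close>
  then obtain x where x: "\<And>j. F (pcoset \<Omega> (var j)) = pcoset \<Omega> (x j)" by metis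
  interpret s: rhom "subst const x" by (rule subst_hom[OF const_hom])
  have sub: "F (pcoset \<Omega> p) = pcoset \<Omega> (subst const x p)" for p
  proof (induction p rule: mpoly_induct)
    case (const c)
    then show ?case using F(6)[of c 1] F(5) by (simp add: smult_P const_hom)
  qed (simp_all add: const_hom x F(3,4) s.homs mult_P add_P)
  have "rel \<Omega> x"
    unfolding rel_def
  proof
    fix i
    have "pcoset \<Omega> (subst const x (sg i * partial i \<Omega>)) = pcoset \<Omega> (jacobian_bracket \<Omega> (\<lambda>k. x (coords i k)))"
      using F(7)[of "\<lambda>k. var (coords i k)"] unfolding jacobian_bracket_coords x unfolding sub nbracket_P .
    then show "\<Omega> dvd sg i * subst const x (partial i \<Omega>) - jacobian_bracket \<Omega> (\<lambda>k. x (coords i k))"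
      unfolding pcoset_eq_iff s.hom_mult s.hom_sg .
  qed
  moreover have "p = 0" if "homogeneous 1 p" "\<Omega> dvd subst const x p" for p
  proof -
    have "F (pcoset \<Omega> p) = F (pcoset \<Omega> 0)"
      unfolding sub pcoset_eq_iff s.hom_0 using that(2) by simp
    then have "pcoset \<Omega> p = pcoset \<Omega> 0"
      using F(2) by (auto simp: bij_betw_def inj_on_def)
    then have "\<Omega> dvd p" by (simp add: pcoset_eq_iff)
    then show ?thesis by (rule homogeneous_dvd_0[OF hom\<Omega> that(1) d_gt(4)])
  qed
  ultimately obtain M where M: "M \<in> linear_auts \<Omega>" "\<forall>p. \<Omega> dvd subst const x p - phi M p"
    using linear_if_rel[of \<Omega> x] by blast
  have "F C = qmap \<Omega> M C" for C
  proof (cases "C \<in> range (pcoset \<Omega>)")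
    case True
    then obtain p where "C = pcoset \<Omega> p" by blast
    then show ?thesis using M by (simp add: sub qmap_pcoset pcoset_eq_iff)
  next
    case False
    then show ?thesis using F(1) qmap_extensional[of \<Omega> M] by (simp add: extensional_def)
  qed
  then have "F = qmap \<Omega> M" by (rule ext)
  then show "F \<in> qmap \<Omega> ` linear_auts \<Omega>" using M(1) by blast
next
  fix F assume "F \<in> qmap \<Omega> ` linear_auts \<Omega>"
  then obtain M where M: "M \<in> linear_auts \<Omega>" "F = qmap \<Omega> M" by blast
  have F: "F (pcoset \<Omega> p) = pcoset \<Omega> (phi M p)" for p
    unfolding M(2) by (rule qmap_pcoset[OF M(1)])
  have "bij_betw F (range (pcoset \<Omega>)) (range (pcoset \<Omega>))"
    unfolding bij_betw_def
  proof
    show "inj_on F (range (pcoset \<Omega>))"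
      by (auto simp: inj_on_def F pcoset_eq_iff rhom.hom_diff[OF phi_hom, symmetric] dvd_phi_iff[OF M(1)])
    have "F ` range (pcoset \<Omega>) = pcoset \<Omega> ` range (phi M)" by (auto simp: F image_image)
    then show "F ` range (pcoset \<Omega>) = range (pcoset \<Omega>)"
      using bij_is_surj[OF bij_phi[OF M(1)]] by simp
  qed
  moreover have "F \<in> extensional (range (pcoset \<Omega>))" unfolding M(2) by (rule qmap_extensional)
  ultimately show "F \<in> np_auto (P_alg \<Omega>)"
    by (simp add: np_auto_P_alg F P_alg_simps rhom.homs[OF phi_hom] jacobian_bracket_phi[OF M(1)])
qed

end

section \<open>Matrices over an algebraically closed field\<close>

definition eigv :: "'k::field ^ 'v::finite ^ 'v \<Rightarrow> 'k \<Rightarrow> bool" where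
  "eigv A x \<longleftrightarrow> (\<exists>v. v \<noteq> 0 \<and> A *v v = x *s v)"

text \<open>The characteristic polynomial det(X - A).\<close>

definition chi :: "'k::field ^ 'v::finite ^ 'v \<Rightarrow> 'k poly" where
  "chi A = fdet (\<lambda>i j. [:- (A $ i $ j), unit_row i j:])"

lemma mat_mult_vec: "mat x *v v = x *s (v :: 'k::field ^ 'v::finite)"
proof -
  have "(\<Sum>j\<in>UNIV. (if i = j then x else 0) * v $ j) = (\<Sum>j\<in>UNIV. if i = j then x * v $ j else 0)" for i
    by (intro sum.cong) auto
  then show ?thesis by (simp add: vec_eq_iff matrix_vector_mult_def mat_def)
qed

lemma poly_chi: "poly (chi A) x = det (mat x - A)"
proof -
  interpret rhom "\<lambda>p. poly p x" by unfold_locales auto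
  show ?thesis
    unfolding chi_def hom_fdet unfolding fdet_def
    by (rule arg_cong[where f = det]) (simp add: vec_eq_iff mat_def unit_row_def)
qed

lemma singular_iff: "det (B :: 'k::field ^ 'v::finite ^ 'v) = 0 \<longleftrightarrow> (\<exists>v. v \<noteq> 0 \<and> B *v v = 0)"
  using matrix_left_invertible_ker[of B] invertible_left_inverse[of B] invertible_det_nz[of B] by blast

lemma poly_chi_eq_0_iff: "poly (chi A) x = 0 \<longleftrightarrow> eigv A x"
  unfolding poly_chi singular_iff eigv_def
  by (auto simp: matrix_vector_mult_diff_rdistrib mat_mult_vec)

lemma eigv_transpose: "eigv (transpose A) x \<longleftrightarrow> eigv A x"
proof -
  have "det (mat x - transpose A) = det (transpose (mat x - A))"
    by (rule arg_cong[where f = det]) (auto simp: vec_eq_iff transpose_def mat_def)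
  then show ?thesis by (simp only: poly_chi_eq_0_iff[symmetric] poly_chi det_transpose)
qed

lemma linear_factors:
  fixes R :: "'k::field multiset"
  shows "degree (\<Prod>x\<in>#R. [:- x, 1:]) = size R"
    and "lead_coeff (\<Prod>x\<in>#R. [:- x, 1:]) = 1"
    and "R \<noteq> {#} \<Longrightarrow> coeff (\<Prod>x\<in>#R. [:- x, 1:]) (size R - 1) = - sum_mset R"
proof -
  have deg: "degree (\<Prod>x\<in>#R. [:- x, 1:]) = size R \<and> (\<Prod>x\<in>#R. [:- x, 1:]) \<noteq> 0 \<and>
      lead_coeff (\<Prod>x\<in>#R. [:- x, 1:]) = 1" for R :: "'k multiset"
  proof (induction R)
    case (add x R)
    let ?Q = "\<Prod>x\<in>#R. [:- x, 1:]"
    have l: "lead_coeff ?Q = 1" using add by blast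
    have "lead_coeff ([:- x, 1:] * ?Q) = 1"
      unfolding lead_coeff_mult l by simp
    moreover have "degree ([:- x, 1:] * ?Q) = Suc (size R)"
      using add by (simp add: degree_mult_eq del: mult_pCons_left)
    moreover have "[:- x, 1:] * ?Q \<noteq> 0" using add by (simp del: mult_pCons_left)
    ultimately show ?case by (simp del: mult_pCons_left)
  qed simp
  then show "degree (\<Prod>x\<in>#R. [:- x, 1:]) = size R" "lead_coeff (\<Prod>x\<in>#R. [:- x, 1:]) = 1"
    by blast+
  show "R \<noteq> {#} \<Longrightarrow> coeff (\<Prod>x\<in>#R. [:- x, 1:]) (size R - 1) = - sum_mset R"
  proof (induction R)
    case (add x R)
    show ?case
    proof (cases "R = {#}")
      case False
      then obtain k where k: "size R = Suc k" by (cases "size R") auto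
      have "coeff (\<Prod>x\<in>#R. [:- x, 1:]) (Suc k) = 1" using deg[of R] k by metis
      then show ?thesis using add.IH False k by simp
    qed simp
  qed simp
qed

text \<open>A permutation other than the identity moves two points at least, so its product has
  degree at most N - 2 for N = \<open>CARD('v)\<close>. The coefficients from N - 1 on come from the
  diagonal.\<close>

lemma chi_coeffs:
  fixes A :: "'k::field ^ 'v::finite ^ 'v"
  assumes "k \<ge> CARD('v) - 1"
  shows "coeff (chi A) k = coeff (\<Prod>i\<in>UNIV. [:- (A $ i $ i), 1:]) k"
proof -
  define P where "P = (\<lambda>p :: 'v \<Rightarrow> 'v. \<Prod>i\<in>UNIV. [:- (A $ i $ p i), unit_row i (p i):])"
  have deg: "coeff (of_int (sign p) * P p) k = 0" if p: "p permutes UNIV" "p \<noteq> id" for p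
  proof -
    obtain i where i: "p i \<noteq> i" using p(2) by (auto simp: fun_eq_iff)
    have pi: "p (p i) \<noteq> p i" using i permutes_inj[OF p(1)] by (auto simp: inj_eq)
    have c: "card ({i, p i} :: 'v set) = 2" "card {i, p i} \<le> CARD('v)"
      using i card_mono[OF finite subset_UNIV, of "{i, p i}"] by simp_all
    have "degree (P p) \<le> (\<Sum>i\<in>UNIV. degree [:- (A $ i $ p i), unit_row i (p i):])"
      unfolding P_def by (rule degree_prod_sum_le[OF finite, unfolded o_def])
    also have "\<dots> \<le> (\<Sum>j\<in>UNIV. if j \<in> UNIV - {i, p i} then 1 else 0)"
      using i pi by (intro sum_mono) (auto simp: unit_row_def)
    also have "\<dots> = card (UNIV - {i, p i})"
      by (simp only: sum.inter_restrict[OF finite, symmetric] card_eq_sum Int_UNIV_left)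
    also have "\<dots> = CARD('v) - 2"
      using c by (simp add: card_Diff_subset)
    also have "\<dots> < k" using assms c by linarith
    finally have "coeff (P p) k = 0" by (rule coeff_eq_0)
    then show ?thesis by (simp add: of_int_poly)
  qed
  have id: "id \<in> {p :: 'v \<Rightarrow> 'v. p permutes UNIV}" by (simp add: permutes_id)
  have "chi A = (\<Sum>p | p permutes UNIV. of_int (sign p) * P p)"
    unfolding chi_def fdet_expand P_def ..
  also have "\<dots> = of_int (sign (id :: 'v \<Rightarrow> 'v)) * P id + (\<Sum>p\<in>{p. p permutes UNIV} - {id}. of_int (sign p) * P p)"
    by (rule sum.remove[OF finite_permutations[OF finite] id])
  finally have "chi A = P id + (\<Sum>p\<in>{p. p permutes UNIV} - {id}. of_int (sign p) * P p)"
    by simp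
  then have "coeff (chi A) k = coeff (P id) k + (\<Sum>p\<in>{p. p permutes UNIV} - {id}. coeff (of_int (sign p) * P p) k)"
    by (simp only: coeff_add coeff_sum)
  also have "(\<Sum>p\<in>{p. p permutes UNIV} - {id}. coeff (of_int (sign p) * P p) k) = 0"
    using deg by (intro sum.neutral) auto
  finally show ?thesis by (simp add: P_def unit_row_def)
qed

text \<open>\<open>R\<close> consists of the roots of \<open>chi A\<close> with multiplicity. The
  coefficient below the leading one gives the trace, the value at 0 the determinant.\<close>

lemma eigenvalues:
  fixes A :: "'k::alg_closed_field ^ 'v::finite ^ 'v"
  shows "\<exists>R. size R = CARD('v) \<and> (\<forall>x. x \<in># R \<longleftrightarrow> eigv A x) \<and> trace A = sum_mset R \<and> det A = prod_mset R"
proof -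
  let ?N = "CARD('v)"
  define D where "D = image_mset (\<lambda>i. A $ i $ i) (mset_set (UNIV :: 'v set))"
  have D: "(\<Prod>i\<in>UNIV. [:- (A $ i $ i), 1:]) = (\<Prod>x\<in>#D. [:- x, 1:])" "size D = ?N" "sum_mset D = trace A"
    by (simp_all add: D_def prod_unfold_prod_mset sum_unfold_sum_mset trace_def image_mset.compositionality o_def)
  have N: "?N > 0" by simp
  then have "D \<noteq> {#}" using D(2) by auto
  have top: "coeff (chi A) ?N = 1"
    using chi_coeffs[of ?N A] linear_factors(1,2)[of D] by (simp add: D)
  have "coeff (chi A) k = 0" if "k > ?N" for k
    using that chi_coeffs[of k A] linear_factors(1)[of D] by (simp add: D coeff_eq_0)
  then have "degree (chi A) \<le> ?N" by (intro degree_le) auto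
  then have deg: "degree (chi A) = ?N" using top le_degree[of "chi A" ?N] by simp
  then have "chi A \<noteq> 0" using top by auto
  then obtain R where R: "size R = ?N" "chi A = (\<Prod>x\<in>#R. [:- x, 1:])"
    using alg_closed_imp_factorization[of "chi A"] deg top by auto
  then have "R \<noteq> {#}" using N by auto
  have "- sum_mset R = - trace A"
    using chi_coeffs[of "?N - 1" A] linear_factors(3)[OF \<open>R \<noteq> {#}\<close>] linear_factors(3)[OF \<open>D \<noteq> {#}\<close>]
    by (simp add: D R)
  moreover have "eigv A x \<longleftrightarrow> x \<in># R" for x
    unfolding poly_chi_eq_0_iff[symmetric] R(2) by (auto simp: poly_prod_mset prod_mset_zero_iff image_iff)
  moreover have "det A = prod_mset R"
  proof -
    have neg: "(- 1) ^ ?N * poly (chi A) 0 = prod_mset R"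
    proof -
      have "(- 1) ^ size R * (\<Prod>x\<in>#R. - x) = prod_mset R" by (induction R) (auto simp: algebra_simps)
      then show ?thesis unfolding R(2) by (simp add: poly_prod_mset R(1))
    qed
    have "(- 1) ^ ?N * det (mat 0 - A) = det A"
    proof -
      have "det (mat 0 - A) = fdet (\<lambda>i j. (- 1) * A $ i $ j)"
        unfolding fdet_def by (rule arg_cong[where f = det]) (simp add: vec_eq_iff mat_def)
      also have "\<dots> = (- 1) ^ ?N * det A"
        using fdet_scale_rows[of "\<lambda>_. - 1" "\<lambda>i j. A $ i $ j"] by (simp add: fdet_def)
      finally show ?thesis by (simp add: power_mult_distrib[symmetric] mult.assoc[symmetric])
    qed
    then show ?thesis using neg by (simp add: poly_chi)
  qed
  ultimately show ?thesis using R(1) by (intro exI[of _ R]) simp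
qed

section \<open>Polynomials in a matrix, applied to a vector: p(A) v\<close>

definition act :: "'k::field ^ 'v::finite ^ 'v \<Rightarrow> 'k poly \<Rightarrow> 'k ^ 'v \<Rightarrow> 'k ^ 'v" where
  "act A p v = (\<Sum>i\<le>degree p. coeff p i *s (((*v) A) ^^ i) v)"

lemma act_bound: "degree p \<le> n \<Longrightarrow> act A p v = (\<Sum>i\<le>n. coeff p i *s (((*v) A) ^^ i) v)"
  unfolding act_def by (intro sum.mono_neutral_left) (auto simp: coeff_eq_0)

lemma act_0 [simp]: "act A 0 v = 0"
  by (simp add: act_def)

lemma act_add: "act A (p + q) v = act A p v + act A q v"
proof -
  define n where "n = max (degree p) (degree q)"
  have "degree (p + q) \<le> n" unfolding n_def by (rule degree_add_le_max)
  then show ?thesis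
    by (simp add: act_bound[of _ n] n_def[symmetric] vec.scale_left_distrib sum.distrib)
      (simp add: act_bound[of p n] act_bound[of q n] n_def)
qed

lemma act_smult: "act A (smult c p) v = c *s act A p v"
  by (simp add: act_bound[OF degree_smult_le] act_def vec.scale_sum_right)

lemma matrix_vector_mult_sum: "A *v (\<Sum>i\<in>S. f i) = (\<Sum>i\<in>S. A *v (f i :: 'k::field ^ 'v::finite))"
  by (induction S rule: infinite_finite_induct) (simp_all add: matrix_vector_right_distrib)

lemma act_pCons: "act A (pCons a p) v = a *s v + A *v act A p v"
proof -
  have "act A (pCons a p) v = (\<Sum>i\<le>Suc (degree p). coeff (pCons a p) i *s (((*v) A) ^^ i) v)"
    by (rule act_bound) (simp add: degree_pCons_le)
  also have "\<dots> = a *s v + (\<Sum>i\<le>degree p. coeff p i *s (A *v (((*v) A) ^^ i) v))"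
    by (subst sum.atMost_Suc_shift) simp
  also have "(\<Sum>i\<le>degree p. coeff p i *s (A *v (((*v) A) ^^ i) v)) = A *v act A p v"
    by (simp add: act_def matrix_vector_mult_sum vector_scalar_commute)
  finally show ?thesis .
qed

lemma act_mult: "act A (p * q) v = act A p (act A q v)"
proof (induction p)
  case (pCons a p)
  then show ?case by (simp add: act_add act_smult act_pCons)
qed simp

lemma act_linear_factor: "act A [:- x, 1:] v = A *v v - x *s v"
  by (simp add: act_pCons)

text \<open>The vectors v, A v, ..., A^N v are more than the dimension N, so they satisfy a linear
  relation.\<close>

lemma annihilating_poly:
  fixes A :: "'k::field ^ 'v::finite ^ 'v"
  shows "\<exists>p. p \<noteq> 0 \<and> act A p v = 0"
proof -
  define f where "f = (\<lambda>i. (((*v) A) ^^ i) v)"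
  have act: "act A (\<Sum>i\<in>S. monom (c i) i) v = (\<Sum>i\<in>S. c i *s f i)" if "finite S" for c S
    using that
  proof (induction S)
    case (insert i S)
    have "act A (monom (c i) i) v = c i *s f i"
    proof -
      have "act A (monom (c i) i) v = (\<Sum>j\<le>i. if j = i then c i *s f i else 0)"
        by (subst act_bound[OF degree_monom_le], intro sum.cong) (auto simp: f_def)
      then show ?thesis by simp
    qed
    then show ?case using insert by (simp add: act_add)
  qed simp
  have co: "coeff (\<Sum>i\<in>S. monom (c i) i) j = (if j \<in> S then c j else 0)" if "finite S" for S and c :: "nat \<Rightarrow> 'k" and j
    using that by (simp add: coeff_sum if_distrib cong: if_cong)
  let ?S = "{..CARD('v)}"
  show ?thesis
  proof (cases "inj_on f ?S")
    case True
    have "vec.dim (f ` ?S) \<le> CARD('v)"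
      using vec.dim_subset[of "f ` ?S" UNIV] by (simp only: vec_dim_card subset_UNIV)
    then have "vec.dependent (f ` ?S)"
      using card_image[OF True] by (intro vec.dependent_biggerset_general) simp
    then obtain u w where u: "w \<in> f ` ?S" "u w \<noteq> 0" "(\<Sum>w\<in>f ` ?S. u w *s w) = 0"
      by (auto simp: vec.dependent_finite)
    then obtain j where j: "j \<in> ?S" "u (f j) \<noteq> 0" by blast
    have "act A (\<Sum>i\<in>?S. monom (u (f i)) i) v = 0"
      unfolding act[OF finite_atMost] using u(3) by (simp add: sum.reindex[OF True])
    moreover have "coeff (\<Sum>i\<in>?S. monom (u (f i)) i) j \<noteq> 0"
      using j by (simp add: co)
    ultimately show ?thesis by (intro exI[of _ "\<Sum>i\<in>?S. monom (u (f i)) i"]) auto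
  next
    \<comment> \<open>Dependence concerns the set of iterates; a repeated iterate gives its relation
      directly.\<close>
    case False
    then obtain i j where ij: "i \<noteq> j" "f i = f j" by (auto simp: inj_on_def)
    define c :: "nat \<Rightarrow> 'k" where "c = (\<lambda>k. if k = i then 1 else - 1)"
    have "act A (\<Sum>k\<in>{i, j}. monom (c k) k) v = 0"
      unfolding act[OF finite.insertI[OF finite.insertI[OF finite.emptyI]]] using ij by (simp add: c_def)
    moreover have "coeff (\<Sum>k\<in>{i, j}. monom (c k) k) i \<noteq> 0"
      by (subst co) (auto simp: c_def)
    ultimately show ?thesis by (intro exI[of _ "\<Sum>k\<in>{i, j}. monom (c k) k"]) auto
  qed
qed

text \<open>Work through the linear factors of an annihilating polynomial of v. After P(A)^k, with P
  = X^E - 1, the vector is killed by A - x; then it is 0, or x is an eigenvalue and so a root of P,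
  and one more application of P(A) kills it.\<close>

lemma power_minus_one_nilpotent:
  fixes A :: "'k::alg_closed_field ^ 'v::finite ^ 'v"
  assumes ev: "\<And>x. eigv A x \<Longrightarrow> x ^ E = 1"
  shows "\<exists>k. act A ((monom 1 E - 1) ^ k) v = 0"
proof -
  let ?P = "monom 1 E - 1 :: 'k poly"
  have P: "act A ?P y = (x ^ E - 1) *s y" if "A *v y = x *s y" for x y
  proof -
    have "(((*v) A) ^^ i) y = x ^ i *s y" for i
      by (induction i) (simp_all add: that vector_scalar_commute mult.commute)
    then have "act A p y = poly p x *s y" for p
      by (simp add: act_def poly_altdef vec.scale_sum_left)
    then show ?thesis by (simp add: poly_monom)
  qed
  obtain p where p: "p \<noteq> 0" "act A p v = 0" using annihilating_poly by blast
  obtain R where R: "p = smult (lead_coeff p) (\<Prod>x\<in>#R. [:- x, 1:])"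
    using alg_closed_imp_factorization[OF p(1)] by blast
  have "lead_coeff p *s act A (\<Prod>x\<in>#R. [:- x, 1:]) v = 0"
    using p(2) by (subst (asm) R) (simp only: act_smult)
  then have "act A (\<Prod>x\<in>#R. [:- x, 1:]) v = 0" using p(1) by simp
  then show ?thesis
  proof (induction R arbitrary: v)
    case empty
    then show ?case by (intro exI[of _ 0]) simp
  next
    case (add x R)
    have "act A (\<Prod>x\<in>#R. [:- x, 1:]) (act A [:- x, 1:] v) = 0"
      using add.prems by (simp only: act_mult[symmetric] image_mset_add_mset prod_mset.add_mset mult.commute)
    then obtain k where "act A (?P ^ k) (act A [:- x, 1:] v) = 0" using add.IH by blast
    then have "act A [:- x, 1:] (act A (?P ^ k) v) = 0"
      by (simp only: act_mult[symmetric] mult.commute)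
    then have y: "A *v act A (?P ^ k) v = x *s act A (?P ^ k) v" by (simp add: act_linear_factor)
    show ?case
    proof (cases "act A (?P ^ k) v = 0")
      case False
      then have "x ^ E = 1" using y ev unfolding eigv_def by blast
      then have "act A (?P ^ Suc k) v = 0" using P[OF y] by (simp only: power_Suc act_mult) simp
      then show ?thesis by blast
    qed blast
  qed
qed

section \<open>Groups of matrices of finite exponent\<close>

definition mpw :: "'k::field ^ 'v::finite ^ 'v \<Rightarrow> nat \<Rightarrow> 'k ^ 'v ^ 'v" where
  "mpw A n = (((**) A) ^^ n) (mat 1)"

lemma mpw_0 [simp]: "mpw A 0 = mat 1" and mpw_Suc: "mpw A (Suc n) = A ** mpw A n"
  by (simp_all add: mpw_def)

lemma mpw_vec: "mpw A n *v v = (((*v) A) ^^ n) v"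
  by (induction n) (simp_all add: mpw_Suc matrix_vector_mul_assoc[symmetric])

lemma mpw_in: "mat 1 \<in> H \<Longrightarrow> (\<And>A B. A \<in> H \<Longrightarrow> B \<in> H \<Longrightarrow> A ** B \<in> H) \<Longrightarrow> A \<in> H \<Longrightarrow> mpw A n \<in> H"
  by (induction n) (simp_all add: mpw_Suc)

lemma mat_mult_left: "mat c ** A = (\<chi> i j. c * (A :: 'k::field ^ 'v::finite ^ 'v) $ i $ j)"
proof -
  have "(\<Sum>k\<in>UNIV. (if i = k then c else 0) * A $ k $ j) = (\<Sum>k\<in>UNIV. if i = k then c * A $ k $ j else 0)" for i j
    by (intro sum.cong) auto
  then show ?thesis by (simp add: vec_eq_iff matrix_matrix_mult_def mat_def)
qed

lemma mat_mult_right: "A ** mat c = mat c ** (A :: 'k::field ^ 'v::finite ^ 'v)"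
proof -
  have "(\<Sum>k\<in>UNIV. A $ i $ k * (if k = j then c else 0)) = (\<Sum>k\<in>UNIV. if k = j then c * A $ i $ k else 0)" for i j
    by (intro sum.cong) auto
  then show ?thesis unfolding mat_mult_left by (simp add: vec_eq_iff matrix_matrix_mult_def mat_def)
qed

lemma trace_mat_mult: "trace (mat c ** A) = c * trace (A :: 'k::field ^ 'v::finite ^ 'v)"
  by (simp add: mat_mult_left trace_def sum_distrib_left)

lemma trace_sum: "trace (\<Sum>i\<in>S. f i) = (\<Sum>i\<in>S. trace (f i :: 'k::field ^ 'v::finite ^ 'v))"
  by (induction S rule: infinite_finite_induct) (simp_all add: trace_def sum.distrib)

lemma matrix_mult_sum: "A ** (\<Sum>i\<in>S. f i) = (\<Sum>i\<in>S. A ** (f i :: 'k::field ^ 'v::finite ^ 'v))"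
  by (induction S rule: infinite_finite_induct) (simp_all add: matrix_add_ldistrib)

lemma matrix_sum_mult: "(\<Sum>i\<in>S. f i) ** A = (\<Sum>i\<in>S. (f i :: 'k::field ^ 'v::finite ^ 'v) ** A)"
  by (induction S rule: infinite_finite_induct)
    (simp_all add: matrix_matrix_mult_def vec_eq_iff distrib_right sum.distrib)

lemma matrix_eq_0_iff: "A = 0 \<longleftrightarrow> (\<forall>v. A *v v = (0 :: 'k::field ^ 'v::finite))"
  using matrix_eq[of A 0] by simp

text \<open>The trace of an idempotent counts the eigenvalue 1 with multiplicity, and characteristic
  0 makes this count visible.\<close>

lemma idempotent_trace_0:
  fixes F :: "'k::{alg_closed_field, field_char_0} ^ 'v::finite ^ 'v"
  assumes "F ** F = F" "trace F = 0"
  shows "F = 0"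
proof (rule ccontr)
  assume "F \<noteq> 0"
  then obtain v where v: "F *v v \<noteq> 0" by (auto simp: matrix_eq_0_iff)
  have FF: "F *v (F *v u) = F *v u" for u by (simp add: matrix_vector_mul_assoc assms(1))
  then have "eigv F 1" unfolding eigv_def using v by (intro exI[of _ "F *v v"]) simp
  have ev: "x = 0 \<or> x = 1" if x: "eigv F x" for x
  proof -
    obtain u where u: "u \<noteq> 0" "F *v u = x *s u" using x by (auto simp: eigv_def)
    then have "(x * x) *s u = x *s u" using FF[of u] by (simp add: vector_scalar_commute)
    then have "(x * x - x) *s u = 0" by (simp add: vec.scale_left_diff_distrib)
    then have "x * (x - 1) = 0" using u(1) by (simp add: algebra_simps)
    then show ?thesis by simp
  qed
  obtain R where R: "\<And>x. x \<in># R \<longleftrightarrow> eigv F x" "trace F = sum_mset R"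
    using eigenvalues[of F] by blast
  have "sum_mset R = of_nat (count R 1)" if "\<And>x. x \<in># R \<Longrightarrow> x = 0 \<or> x = 1" for R :: "'k multiset"
    using that
  proof (induction R)
    case (add x R)
    then have "sum_mset R = of_nat (count R 1)" "x = 0 \<or> x = 1" by auto
    then show ?case by auto
  qed simp
  then have "count R 1 = 0" using R ev assms(2) by (metis of_nat_eq_0_iff)
  then show False using R(1)[of 1] \<open>eigv F 1\<close> by (simp add: count_eq_zero_iff)
qed

text \<open>The average e of the powers of A is an idempotent with A e = e. Its trace is the full
  dimension, so 1 - e is an idempotent of trace 0, and e = 1.\<close>

lemma trace_powers_imp_1:
  fixes A :: "'k::{alg_closed_field, field_char_0} ^ 'v::finite ^ 'v"
  assumes E: "E > 0" "mpw A E = mat 1" and tr: "\<And>k. trace (mpw A k) = of_nat CARD('v)"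
  shows "A = mat 1"
proof -
  define S where "S = (\<Sum>k<E. mpw A k)"
  have AS: "A ** S = S"
  proof -
    have "A ** S = (\<Sum>k<E. mpw A (Suc k))" by (simp add: S_def matrix_mult_sum mpw_Suc)
    moreover have "(\<Sum>k<E. mpw A (Suc k)) + mpw A 0 = S + mpw A E"
      unfolding S_def by (induction E) (simp_all add: algebra_simps)
    ultimately show ?thesis using E(2) by simp
  qed
  have "mpw A k ** S = S" for k
    by (induction k) (simp_all add: mpw_Suc matrix_mul_assoc[symmetric] AS)
  then have "S ** S = (\<Sum>k<E. S)" by (subst (1) S_def) (simp add: matrix_sum_mult)
  also have "\<dots> = mat (of_nat E) ** S"
    by (induction E) (simp_all add: mat_mult_left vec_eq_iff algebra_simps)
  finally have SS: "S ** S = mat (of_nat E) ** S" .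
  define c :: 'k where "c = inverse (of_nat E)"
  have cE: "c * of_nat E = 1" using E(1) by (simp add: c_def)
  define e where "e = mat c ** S"
  have "e ** e = mat c ** (mat c ** (S ** S))"
    unfolding e_def by (metis matrix_mul_assoc mat_mult_right)
  also have "\<dots> = e"
    unfolding SS e_def mat_mult_left using cE by (simp add: vec_eq_iff mult.assoc[symmetric])
  finally have ee: "e ** e = e" .
  have "trace e = of_nat CARD('v)"
    unfolding e_def trace_mat_mult S_def trace_sum tr using cE by (simp add: mult.assoc[symmetric])
  then have "trace (mat 1 - e) = 0"
    by (simp add: trace_def mat_def sum_subtractf)
  moreover have "(mat 1 - e) ** (mat 1 - e) = mat 1 - e"
  proof -
    have diff: "(U - V) ** W = U ** W - V ** W" "W ** (U - V) = W ** U - W ** V" for U V W :: "'k ^ 'v ^ 'v"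
      by (simp_all add: matrix_matrix_mult_def vec_eq_iff algebra_simps sum_subtractf)
    show ?thesis by (simp add: diff ee)
  qed
  ultimately have "e = mat 1" using idempotent_trace_0[of "mat 1 - e"] by simp
  have "A = A ** e" by (simp add: \<open>e = mat 1\<close>)
  also have "\<dots> = mat c ** (A ** S)" unfolding e_def by (metis matrix_mul_assoc mat_mult_right)
  also have "\<dots> = mat 1" unfolding AS e_def[symmetric] by fact
  finally show ?thesis .
qed

text \<open>Burnside's argument: an element of the group is determined by the traces of its products with a
  basis of the linear span of the group.\<close>

lemma finite_matrix_group:
  fixes H :: "('k::{alg_closed_field, field_char_0} ^ 'v::finite ^ 'v) set"
  assumes one: "mat 1 \<in> H" and mult: "\<And>A B. A \<in> H \<Longrightarrow> B \<in> H \<Longrightarrow> A ** B \<in> H"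
    and inv: "\<And>A. A \<in> H \<Longrightarrow> \<exists>B\<in>H. A ** B = mat 1"
    and ev: "\<And>A x. A \<in> H \<Longrightarrow> eigv A x \<Longrightarrow> x ^ E = 1"
    and E: "E > 0" "\<And>A. A \<in> H \<Longrightarrow> mpw A E = mat 1"
  shows "finite H"
proof -
  define T where "T = trace ` H"
  \<comment> \<open>A trace is a sum of \<open>CARD('v)\<close> roots of X^E - 1.\<close>
  have "finite T"
  proof -
    let ?L = "{x :: 'k. x ^ E = 1}"
    have "monom 1 E - 1 \<noteq> (0 :: 'k poly)"
      using E(1) by (auto simp: poly_eq_iff intro!: exI[of _ E])
    from poly_roots_finite[OF this] have "finite ?L" by (simp add: poly_monom)
    then have "finite (sum_list ` {xs. set xs \<subseteq> ?L \<and> length xs = CARD('v)})"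
      by (intro finite_imageI finite_lists_length_eq)
    moreover have "T \<subseteq> sum_list ` {xs. set xs \<subseteq> ?L \<and> length xs = CARD('v)}"
    proof
      fix t assume "t \<in> T"
      then obtain A where A: "A \<in> H" "t = trace A" by (auto simp: T_def)
      obtain R where R: "size R = CARD('v)" "\<And>x. x \<in># R \<longleftrightarrow> eigv A x" "trace A = sum_mset R"
        using eigenvalues[of A] by blast
      obtain xs where xs: "mset xs = R" using ex_mset by blast
      have "set xs \<subseteq> ?L" using ev[OF A(1)] R(2) xs by auto
      moreover have "length xs = CARD('v)" using R(1) xs by auto
      moreover have "t = sum_list xs" using A(2) R(3) xs sum_mset_sum_list by metis
      ultimately show "t \<in> sum_list ` {xs. set xs \<subseteq> ?L \<and> length xs = CARD('v)}" by blast
    qed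
    ultimately show ?thesis by (rule finite_subset[rotated])
  qed
  \<comment> \<open>Matrices as vectors, for which bases and spans are available.\<close>
  define flat :: "'k ^ 'v ^ 'v \<Rightarrow> 'k ^ ('v \<times> 'v)" where "flat = (\<lambda>A. \<chi> q. A $ fst q $ snd q)"
  define unflat :: "'k ^ ('v \<times> 'v) \<Rightarrow> 'k ^ 'v ^ 'v" where "unflat = (\<lambda>b. \<chi> i j. b $ (i, j))"
  have uf: "unflat (flat A) = A" for A by (simp add: flat_def unflat_def vec_eq_iff)
  obtain B where B: "B \<subseteq> flat ` H" "vec.independent B" "flat ` H \<subseteq> vec.span B"
    using vec.basis_exists by metis
  have "finite B" using vec.independent_bound_general[OF B(2)] by blast
  define \<tau> where "\<tau> = (\<lambda>A. \<lambda>b\<in>B. trace (A ** unflat b))"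
  have "\<tau> ` H \<subseteq> B \<rightarrow>\<^sub>E T"
  proof
    fix f assume "f \<in> \<tau> ` H"
    then obtain A where A: "A \<in> H" "f = \<tau> A" by blast
    have "trace (A ** unflat b) \<in> T" if b: "b \<in> B" for b
    proof -
      obtain C where "C \<in> H" "b = flat C" using B(1) b by blast
      then show ?thesis using mult[OF A(1)] by (simp add: uf T_def)
    qed
    then show "f \<in> B \<rightarrow>\<^sub>E T" by (simp add: A(2) \<tau>_def)
  qed
  then have "finite (\<tau> ` H)"
    using finite_PiE[OF \<open>finite B\<close>, of "\<lambda>_. T"] \<open>finite T\<close> by (blast intro: finite_subset)
  moreover have "inj_on \<tau> H"
  proof (rule inj_onI)
    fix A1 A2 assume A: "A1 \<in> H" "A2 \<in> H" "\<tau> A1 = \<tau> A2"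
    \<comment> \<open>A linear functional that vanishes on the basis, hence on the whole
      group.\<close>
    define l where "l = (\<lambda>b. trace (A1 ** unflat b) - trace (A2 ** unflat b))"
    have add: "l (x + y) = l x + l y" and smult: "l (c *s x) = c * l x" for x y c
      by (simp_all add: l_def unflat_def trace_def matrix_matrix_mult_def algebra_simps sum.distrib
          sum_subtractf sum_distrib_left)
    have "vec.subspace {x. l x = 0}"
      by (rule vec.subspaceI) (simp_all add: add smult, use smult[of 0 0] in simp)
    moreover have "B \<subseteq> {x. l x = 0}"
    proof
      fix b assume "b \<in> B"
      then have "trace (A1 ** unflat b) = trace (A2 ** unflat b)"
        using fun_cong[OF A(3), of b] by (simp add: \<tau>_def)
      then show "b \<in> {x. l x = 0}" by (simp add: l_def)
    qed
    ultimately have "vec.span B \<subseteq> {x. l x = 0}" by (intro vec.span_minimal)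
    then have tr: "trace (A1 ** U) = trace (A2 ** U)" if "U \<in> H" for U
      using B(3) that uf[of U] unfolding l_def by force
    obtain C where C: "C \<in> H" "A2 ** C = mat 1" using inv[OF A(2)] by blast
    then have CA: "C ** A2 = mat 1" by (simp add: matrix_left_right_inverse)
    define a where "a = A1 ** C"
    have a: "a \<in> H" unfolding a_def using A(1) C(1) by (rule mult)
    \<comment> \<open>a^(k + 1) = A1 U with U = C a^k in the group, so its trace is that of A2 U =
      a^k.\<close>
    have "trace (mpw a k) = of_nat CARD('v)" for k
    proof (induction k)
      case 0
      show ?case by (simp add: trace_def mat_def)
    next
      case (Suc k)
      have "mpw a k \<in> H" by (rule mpw_in[OF one mult a])
      then have "trace (A1 ** (C ** mpw a k)) = trace (A2 ** (C ** mpw a k))"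
        by (intro tr mult C(1))
      then show ?case using Suc C(2) by (simp add: mpw_Suc a_def matrix_mul_assoc)
    qed
    then have "a = mat 1" using trace_powers_imp_1[OF E(1) E(2)[OF a]] by blast
    then have "A1 ** (C ** A2) = A2" by (simp add: a_def matrix_mul_assoc)
    then show "A1 = A2" by (simp add: CA)
  qed
  ultimately show ?thesis by (rule finite_imageD)
qed

section \<open>Finiteness\<close>

lemma to_ac_hom: "rhom to_ac"
  by unfold_locales simp_all

text \<open>The binomial coefficient of X over i as a polynomial, so that powers of a unipotent
  matrix depend polynomially on the exponent.\<close>

definition bin :: "nat \<Rightarrow> 'k::field_char_0 poly" where
  "bin i = smult (inverse (fact i)) (\<Prod>j<i. [:- of_nat j, 1:])"

lemma poly_bin: "poly (bin i) (of_nat m) = of_nat (m choose i)"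
  by (simp add: bin_def poly_prod binomial_gbinomial gbinomial_prod_rev atLeast0LessThan divide_inverse mult.commute)

lemma bin_bounds: "degree (bin i :: 'k::field_char_0 poly) \<le> i" "coeff (bin i :: 'k poly) i \<noteq> 0"
proof -
  have "degree (\<Prod>j<i. [:- of_nat j, 1:] :: 'k poly) \<le> i \<and> coeff (\<Prod>j<i. [:- of_nat j, 1:] :: 'k poly) i = 1"
    using prod_bounds[of "{..<i}" "\<lambda>j. [:- of_nat j, 1:] :: 'k poly" "\<lambda>_. 1"] by simp
  then show "degree (bin i :: 'k poly) \<le> i" "coeff (bin i :: 'k poly) i \<noteq> 0"
    by (auto simp: bin_def)
qed

lemma poly_eqI_of_nat:
  fixes p q :: "'k::field_char_0 poly"
  assumes "\<And>m. poly p (of_nat m) = poly q (of_nat m)"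
  shows "p = q"
proof (rule ccontr)
  assume "p \<noteq> q"
  then have "finite {x. poly (p - q) x = 0}" by (intro poly_roots_finite) simp
  moreover have "range of_nat \<subseteq> {x. poly (p - q) x = 0}" using assms by auto
  ultimately have "finite (range (of_nat :: nat \<Rightarrow> 'k))" by (rule finite_subset[rotated])
  moreover have "inj (of_nat :: nat \<Rightarrow> 'k)" by (simp add: inj_def)
  ultimately show False using finite_imageD by blast
qed

text \<open>The binomial theorem for 1 + T, cut off by nilpotency.\<close>

lemma unipotent_power:
  fixes T :: "'k::field_char_0 ^ 'v::finite \<Rightarrow> 'k ^ 'v"
  assumes lin: "\<And>x y. T (x + y) = T x + T y" "\<And>c x. T (c *s x) = c *s T x"
    and nil: "\<And>v. (T ^^ Suc r) v = 0"
  shows "((\<lambda>v. v + T v) ^^ m) v = (\<Sum>i\<le>r. of_nat (m choose i) *s (T ^^ i) v)"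
proof (induction m)
  case 0
  have "(\<Sum>i\<le>r. of_nat (0 choose i) *s (T ^^ i) v) = (\<Sum>i\<le>r. if i = 0 then v else 0)"
    by (intro sum.cong) auto
  then show ?case by simp
next
  case (Suc m)
  have T0: "T 0 = 0" using lin(2)[of 0 0] by simp
  have Tsum: "T (\<Sum>i\<in>S. f i) = (\<Sum>i\<in>S. T (f i))" for f and S :: "nat set"
    by (induction S rule: infinite_finite_induct) (simp_all add: lin T0)
  have shift: "(\<Sum>i\<le>r. of_nat (m choose i) *s (T ^^ Suc i) v) + (\<Sum>i\<le>r. of_nat (m choose i) *s (T ^^ i) v)
      = (\<Sum>i\<le>r. of_nat (Suc m choose i) *s (T ^^ i) v)"
  proof (cases r)
    case 0
    then show ?thesis using nil[of v] by simp
  next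
    case r: (Suc r')
    have "(\<Sum>i\<le>Suc r'. of_nat (m choose i) *s (T ^^ Suc i) v) = (\<Sum>i\<le>r'. of_nat (m choose i) *s (T ^^ Suc i) v)"
      using nil[of v] by (simp only: sum.atMost_Suc r) simp
    moreover have "(\<Sum>i\<le>Suc r'. of_nat (m choose i) *s (T ^^ i) v)
        = v + (\<Sum>i\<le>r'. of_nat (m choose Suc i) *s (T ^^ Suc i) v)"
      by (subst sum.atMost_Suc_shift) simp
    moreover have "(\<Sum>i\<le>Suc r'. of_nat (Suc m choose i) *s (T ^^ i) v)
        = v + (\<Sum>i\<le>r'. of_nat (Suc m choose Suc i) *s (T ^^ Suc i) v)"
      by (subst sum.atMost_Suc_shift) simp
    ultimately show ?thesis
      unfolding r by (simp add: vec.scale_left_distrib sum.distrib del: funpow.simps)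
  qed
  have "((\<lambda>v. v + T v) ^^ Suc m) v
      = (\<Sum>i\<le>r. of_nat (m choose i) *s (T ^^ i) v) + (\<Sum>i\<le>r. of_nat (m choose i) *s (T ^^ Suc i) v)"
    by (simp add: Suc Tsum lin)
  then show ?case using shift by (simp only: add.commute)
qed

lemma mult_add_diff: "m < n \<Longrightarrow> t * m + t * (n - m) = n * (t :: nat)"
  by (simp only: distrib_left[symmetric]) (simp add: mult.commute)

text \<open>The map $\mu \mapsto \mu^{1-d}$ preserves the set of the values $\mu = \lambda^d / \det A$, where $\lambda$ is one
  of the at most $m$ eigenvalues of $A$. With $q = (d - 1)^2$ this gives $\mu^{q^b - q^a} = 1$ for some
  $a < b \le m$, and the exponent divides the factorial.\<close>

definition torsion :: "nat \<Rightarrow> nat \<Rightarrow> nat" where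
  "torsion d m = fact (((d - 1) * (d - 1)) ^ m)"

text \<open>Write t for the torsion number. Each eigenvalue x satisfies x^(d t) = (det A)^t. The
  product over all m eigenvalues gives (det A)^(t (d - m)) = 1, and with this x^(d t (d - m)) =
  1.\<close>

definition expo :: "nat \<Rightarrow> nat \<Rightarrow> nat" where
  "expo d m = d * torsion d m * (d - m)"

section \<open>Equivariance of the gradient over the algebraic closure\<close>

context potential begin

definition nab :: "'k alg_closure ^ 'n option \<Rightarrow> 'k alg_closure ^ 'n option" where
  "nab p = (\<chi> i. subst to_ac (\<lambda>j. p $ j) (partial i \<Omega>))"

text \<open>What differentiating \<Omega>(M t) = det M * \<Omega>(t) gives, imposed at points over
  the algebraic closure, where eigenvectors exist.\<close>

definition isom :: "('k alg_closure ^ 'n option ^ 'n option) set" where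
  "isom = {A. invertible A \<and> (\<forall>p. transpose A *v nab (A *v p) = det A *s nab p)}"

lemma nab_scale: "nab (c *s p) = c ^ (d - 1) *s nab p"
  by (simp add: nab_def vec_eq_iff subst_scale[OF hom_partial])

lemma nab_eq_0: "nab p = 0 \<Longrightarrow> p = 0"
  using zero_if_partials_zero[OF to_ac_hom, of "\<lambda>j. p $ j"] by (simp add: nab_def vec_eq_iff)

lemma isom_1: "mat 1 \<in> isom"
  by (simp add: isom_def invertible_def transpose_mat)

lemma isom_mult:
  assumes "A \<in> isom" "B \<in> isom"
  shows "A ** B \<in> isom"
proof -
  have "transpose (A ** B) *v nab ((A ** B) *v p) = det (A ** B) *s nab p" for p
  proof -
    have "transpose (A ** B) *v nab ((A ** B) *v p) = transpose B *v (transpose A *v nab (A *v (B *v p)))"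
      by (simp only: matrix_transpose_mul matrix_vector_mul_assoc)
    also have "\<dots> = det A *s (transpose B *v nab (B *v p))"
      using assms(1) by (simp only: isom_def mem_Collect_eq vector_scalar_commute)
    also have "\<dots> = det (A ** B) *s nab p"
      using assms(2) by (simp only: isom_def mem_Collect_eq det_mul vec.scale_scale)
    finally show ?thesis .
  qed
  then show ?thesis using assms by (simp add: isom_def invertible_mult)
qed

lemma isom_inv:
  assumes "A \<in> isom"
  shows "\<exists>C\<in>isom. A ** C = mat 1"
proof -
  obtain C where C: "A ** C = mat 1" "C ** A = mat 1"
    using assms by (auto simp: isom_def invertible_def)
  have dt: "det C * det A = 1" using C(2) det_mul[of C A] by simp
  have "transpose C *v nab (C *v p) = det C *s nab p" for p
  proof -
    have Ct: "transpose C ** transpose A = mat 1" using C(1) by (metis matrix_transpose_mul transpose_mat)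
    have "transpose A *v nab (A *v (C *v p)) = det A *s nab (C *v p)"
      using assms by (simp add: isom_def)
    then have "transpose C *v (transpose A *v nab p) = transpose C *v (det A *s nab (C *v p))"
      using C(1) by (simp add: matrix_vector_mul_assoc)
    then have "nab p = det A *s (transpose C *v nab (C *v p))"
      by (simp only: matrix_vector_mul_assoc Ct matrix_vector_mul_lid vector_scalar_commute)
    then have "det C *s nab p = (det C * det A) *s (transpose C *v nab (C *v p))"
      by (metis vec.scale_scale)
    then show ?thesis by (simp add: dt)
  qed
  then show ?thesis using C by (auto simp: isom_def invertible_def intro!: bexI[of _ C])
qed

text \<open>If v is an eigenvector of A, equivariance and homogeneity make the gradient at v an
  eigenvector of the transpose; it is nonzero because the gradient vanishes only at 0.\<close>

lemma isom_eigv: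
  assumes A: "A \<in> isom" and x: "eigv A x"
  shows "x \<noteq> 0" "eigv A (det A / x ^ (d - 1))"
proof -
  obtain v where v: "v \<noteq> 0" "A *v v = x *s v" using x by (auto simp: eigv_def)
  have dt: "det A \<noteq> 0" using A by (simp add: isom_def invertible_det_nz)
  have nz: "nab v \<noteq> 0" using nab_eq_0 v(1) by blast
  have "transpose A *v nab (A *v v) = det A *s nab v" using A by (simp add: isom_def)
  then have eq: "x ^ (d - 1) *s (transpose A *v nab v) = det A *s nab v"
    by (simp add: v(2) nab_scale vector_scalar_commute)
  show "x \<noteq> 0"
  proof
    assume "x = 0"
    then have "det A *s nab v = 0" using eq d_gt(1) by (simp add: zero_power)
    then show False using dt nz by simp
  qed
  have "transpose A *v nab v = inverse (x ^ (d - 1)) *s (x ^ (d - 1) *s (transpose A *v nab v))"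
    using \<open>x \<noteq> 0\<close> by (simp only: vec.scale_scale left_inverse power_eq_0_iff vec.scale_one simp_thms)
  also have "\<dots> = (det A / x ^ (d - 1)) *s nab v"
    unfolding eq vec.scale_scale by (simp only: divide_inverse mult.commute)
  finally show "eigv A (det A / x ^ (d - 1))"
    unfolding eigv_transpose[of A, symmetric] using nz by (auto simp: eigv_def)
qed

lemma isom_eigv_torsion:
  assumes A: "A \<in> isom" and x: "eigv A x"
  shows "x ^ (d * torsion d CARD('n option)) = det A ^ torsion d CARD('n option)"
proof -
  let ?q = "(d - 1) * (d - 1)"
  define f where "f = (\<lambda>x. det A / x ^ (d - 1))"
  \<comment> \<open>f raises \<mu> to the power d - 1 and inverts it; two steps undo the inversion
    and leave the exponent (d - 1)^2.\<close>
  define g where "g = (\<lambda>x. f (f x))"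
  define \<mu> where "\<mu> = (\<lambda>x. x ^ d / det A)"
  have dt: "det A \<noteq> 0" using A by (simp add: isom_def invertible_det_nz)
  have evf: "eigv A y \<Longrightarrow> eigv A (f y)" for y unfolding f_def by (rule isom_eigv(2)[OF A])
  have ev: "eigv A ((g ^^ a) x)" for a
    by (induction a) (simp_all add: x g_def evf)
  have \<mu>f: "\<mu> (f y) = inverse (\<mu> y) ^ (d - 1)" for y
  proof -
    obtain D where D: "d = Suc D" using d_gt(2) by (cases d) auto
    have "(y ^ D) ^ D * y ^ D = (y * y ^ D) ^ D"
      by (simp add: power_mult_distrib mult.commute)
    then show ?thesis using dt
      by (simp add: \<mu>_def f_def D power_divide) (simp add: field_simps power_mult_distrib)
  qed
  have \<mu>g: "\<mu> (g y) = \<mu> y ^ ?q" for y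
    by (simp add: g_def \<mu>f power_inverse power_mult)
  have \<mu>a: "\<mu> ((g ^^ a) x) = \<mu> x ^ (?q ^ a)" for a
    by (induction a) (simp_all add: \<mu>g power_mult[symmetric] mult.commute)
  obtain R where R: "size R = CARD('n option)" "\<And>y. y \<in># R \<longleftrightarrow> eigv A y"
    using eigenvalues[of A] by blast
  \<comment> \<open>Pigeonhole: there is one more iterate than eigenvalues with
    multiplicity.\<close>
  have "\<not> inj_on (\<lambda>a. (g ^^ a) x) {..CARD('n option)}"
  proof
    assume inj: "inj_on (\<lambda>a. (g ^^ a) x) {..CARD('n option)}"
    have "(\<lambda>a. (g ^^ a) x) ` {..CARD('n option)} \<subseteq> set_mset R" using ev R(2) by auto
    then have "card ((\<lambda>a. (g ^^ a) x) ` {..CARD('n option)}) \<le> card (set_mset R)" by (intro card_mono) auto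
    also have "\<dots> \<le> size R" by (induction R) (auto simp: card_insert_if)
    also have "\<dots> = CARD('n option)" by (rule R(1))
    finally show False using card_image[OF inj] by simp
  qed
  then obtain a b where ab: "a < b" "b \<le> CARD('n option)" "(g ^^ a) x = (g ^^ b) x"
    unfolding inj_on_def by (metis atMost_iff linorder_neqE_nat)
  have "2 \<le> d - 1" using d_gt(3) card_ge by linarith
  then have "2 * 2 \<le> ?q" by (rule mult_le_mono[OF _ _]) fact
  then have q: "?q > 1" by linarith
  have lt: "?q ^ a < ?q ^ b" using q ab(1) by (rule power_strict_increasing[rotated])
  have "\<mu> x ^ (?q ^ a) * \<mu> x ^ (?q ^ b - ?q ^ a) = \<mu> x ^ (?q ^ a)"
    using ab(3) \<mu>a[of a] \<mu>a[of b] lt by (simp add: power_add[symmetric])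
  moreover have "\<mu> x \<noteq> 0" using isom_eigv(1)[OF A x] dt by (simp add: \<mu>_def)
  ultimately have one: "\<mu> x ^ (?q ^ b - ?q ^ a) = 1" by simp
  have "?q ^ b - ?q ^ a dvd torsion d CARD('n option)"
    unfolding torsion_def
  proof (rule dvd_fact)
    show "1 \<le> ?q ^ b - ?q ^ a" using lt by simp
    have "?q ^ b \<le> ?q ^ CARD('n option)" by (rule power_increasing[OF ab(2) less_imp_le[OF q]])
    then show "?q ^ b - ?q ^ a \<le> ?q ^ CARD('n option)" by (rule order_trans[OF diff_le_self])
  qed
  then have "\<mu> x ^ torsion d CARD('n option) = 1" using one by (auto simp: dvd_def power_mult)
  then have "(x ^ d) ^ torsion d CARD('n option) = det A ^ torsion d CARD('n option)"
    using dt by (simp add: \<mu>_def power_divide)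
  then show ?thesis by (simp add: power_mult)
qed

lemma nn_less: "CARD('n option) < d"
  using d_ge by simp

lemma expo_pos: "expo d CARD('n option) > 0"
  using nn_less d_gt(2) by (simp add: expo_def torsion_def)

lemma isom_det_torsion:
  assumes A: "A \<in> isom"
  shows "det A ^ (torsion d CARD('n option) * (d - CARD('n option))) = 1"
proof -
  obtain R where R: "size R = CARD('n option)" "\<And>y. y \<in># R \<longleftrightarrow> eigv A y" "det A = prod_mset R"
    using eigenvalues[of A] by blast
  have "prod_mset S ^ m = c ^ size S" if "\<And>y. y \<in># S \<Longrightarrow> y ^ m = c" for S :: "'k alg_closure multiset" and m c
    using that by (induction S) (auto simp: power_mult_distrib)
  from this[of R "d * torsion d CARD('n option)" "det A ^ torsion d CARD('n option)"]
  have "det A ^ (d * torsion d CARD('n option)) = (det A ^ torsion d CARD('n option)) ^ CARD('n option)"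
    using isom_eigv_torsion[OF A] R by simp
  then have "det A ^ (torsion d CARD('n option) * CARD('n option)) * det A ^ (torsion d CARD('n option) * (d - CARD('n option))) = det A ^ (torsion d CARD('n option) * CARD('n option))"
    unfolding power_add[symmetric] power_mult[symmetric] mult_add_diff[OF nn_less] .
  moreover have "det A \<noteq> 0" using A by (simp add: isom_def invertible_det_nz)
  ultimately show ?thesis by simp
qed

lemma isom_eigv_expo:
  assumes "A \<in> isom" "eigv A x"
  shows "x ^ expo d CARD('n option) = 1"
proof -
  have "x ^ expo d CARD('n option) = (x ^ (d * torsion d CARD('n option))) ^ (d - CARD('n option))"
    by (simp only: expo_def power_mult)
  also have "\<dots> = det A ^ (torsion d CARD('n option) * (d - CARD('n option)))"
    unfolding isom_eigv_torsion[OF assms] by (simp only: power_mult)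
  finally show ?thesis unfolding isom_det_torsion[OF assms(1)] .
qed

lemma isom_det_expo:
  assumes "A \<in> isom"
  shows "det A ^ expo d CARD('n option) = 1"
proof -
  have "det A ^ expo d CARD('n option) = (det A ^ (torsion d CARD('n option) * (d - CARD('n option)))) ^ d"
    by (simp add: expo_def power_mult[symmetric] mult_ac)
  then show ?thesis unfolding isom_det_torsion[OF assms] by simp
qed

text \<open>For $A = 1 + T$ with $T$ nilpotent, $T^{r+1} = 0 \<noteq> T^r$, the gradient at $A^m u$ grows like
  $m^{r(d-1)}$ by homogeneity, but at most like $m^r$ by equivariance.\<close>

lemma isom_unipotent:
  assumes A: "A \<in> isom" "det A = 1" and nil: "\<And>v. ((\<lambda>v. A *v v - v) ^^ k) v = 0"
  shows "A = mat 1"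
proof (rule ccontr)
  assume "A \<noteq> mat 1"
  define T where "T = (\<lambda>v. A *v v - v)"
  have lin: "T (x + y) = T x + T y" "T (c *s x) = c *s T x" for x y c
    by (simp_all add: T_def matrix_vector_right_distrib vector_scalar_commute vec.scale_right_diff_distrib)
  have T0: "T 0 = 0" using lin(2)[of 0 0] by simp
  have it0: "(T ^^ i) 0 = 0" for i by (induction i) (simp_all add: T0)
  define P where "P = (\<lambda>k. \<forall>v. (T ^^ k) v = 0)"
  define K where "K = (LEAST k. P k)"
  have "P k" using nil by (simp add: P_def T_def)
  then have PK: "P K" unfolding K_def by (rule LeastI)
  have "K \<noteq> 0" "K \<noteq> 1"
  proof -
    obtain v where "A *v v \<noteq> mat 1 *v v" using \<open>A \<noteq> mat 1\<close> matrix_eq by blast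
    then have v: "T v \<noteq> 0" by (simp add: T_def)
    then show "K \<noteq> 1" using PK by (auto simp: P_def)
    have "v \<noteq> 0" using v T0 by auto
    show "K \<noteq> 0"
    proof
      assume "K = 0"
      then show False using PK \<open>v \<noteq> 0\<close> unfolding P_def by auto
    qed
  qed
  then obtain r where r: "K = Suc r" "r > 0" by (cases K) auto
  have nilr: "(T ^^ Suc r) v = 0" for v using PK r(1) by (simp add: P_def)
  have "\<not> P r" using not_less_Least[of r P] r(1) by (simp add: K_def)
  then obtain u where u: "(T ^^ r) u \<noteq> 0" by (auto simp: P_def)
  have AT: "A *v v = v + T v" for v by (simp add: T_def)
  have pw: "(((*v) A) ^^ m) v = (\<Sum>i\<le>r. of_nat (m choose i) *s (T ^^ i) v)" for m v
  proof -
    have "(\<lambda>v. v + T v) = (*v) A" by (rule ext) (simp add: AT)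
    then show ?thesis using unipotent_power[of T r m v, OF lin nilr] by (simp only:)
  qed
  \<comment> \<open>The coordinates of A^m u as polynomials in m. Their coefficients at r are a
    nonzero multiple of T^r u.\<close>
  define U where "U = (\<lambda>j. \<Sum>i\<le>r. smult (((T ^^ i) u) $ j) (bin i))"
  have U: "poly (U j) (of_nat m) = ((((*v) A) ^^ m) u) $ j" for j m
    by (simp add: U_def poly_sum poly_bin pw mult.commute)
  have degU: "degree (U j) \<le> r" for j
    unfolding U_def
    by (intro degree_sum_le) (auto intro!: order_trans[OF degree_smult_le] order_trans[OF bin_bounds(1)])
  have topU: "coeff (U j) r = coeff (bin r) r * ((T ^^ r) u) $ j" for j
  proof -
    have "coeff (U j) r = (\<Sum>i\<le>r. if i = r then coeff (bin r) r * ((T ^^ r) u) $ j else 0)"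
      unfolding U_def coeff_sum
    proof (intro sum.cong refl)
      fix i assume "i \<in> {..r}"
      then have "i \<noteq> r \<Longrightarrow> coeff (bin i :: 'k alg_closure poly) r = 0"
        by (intro coeff_eq_0 le_less_trans[OF bin_bounds(1)]) auto
      then show "coeff (smult (((T ^^ i) u) $ j) (bin i)) r = (if i = r then coeff (bin r) r * ((T ^^ r) u) $ j else 0)"
        by auto
    qed
    then show ?thesis by simp
  qed
  \<comment> \<open>The gradient along the orbit, again polynomial in m; homogeneity puts the
    gradient at the top coefficients of U in degree (d - 1) r.\<close>
  define G where "G = (\<lambda>j. subst (\<lambda>c. [:to_ac c:]) U (partial j \<Omega>))"
  have G: "poly (G j) (of_nat m) = nab ((((*v) A) ^^ m) u) $ j" for j m
  proof -
    have ev: "rhom (\<lambda>p :: 'k alg_closure poly. poly p (of_nat m))" by unfold_locales auto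
    show ?thesis
      unfolding G_def hom_subst[OF ev] U nab_def by simp
  qed
  have topG: "coeff (G j) ((d - 1) * r) = subst to_ac (\<lambda>j. coeff (U j) r) (partial j \<Omega>)" for j
    unfolding G_def by (rule subst_bounds(2)[OF hom_partial degU])
  define pair where "pair = (\<lambda>(a :: 'k alg_closure ^ 'n option) b. \<Sum>j\<in>UNIV. a $ j * b $ j)"
  have pair_sum: "pair a (\<Sum>i\<in>S. f i *s g i) = (\<Sum>i\<in>S. f i * pair a (g i))" for a f g and S :: "nat set"
    unfolding pair_def by (simp add: sum_distrib_left mult.left_commute) (rule sum.swap)
  have pair_A: "pair (nab (A *v p)) (A *v z) = pair (nab p) z" for p z
  proof -
    have "pair (nab (A *v p)) (A *v z) = (\<Sum>j\<in>UNIV. \<Sum>i\<in>UNIV. nab (A *v p) $ j * (A $ j $ i * z $ i))"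
      by (simp add: pair_def matrix_vector_mult_def sum_distrib_left)
    also have "\<dots> = (\<Sum>i\<in>UNIV. \<Sum>j\<in>UNIV. nab (A *v p) $ j * (A $ j $ i * z $ i))"
      by (rule sum.swap)
    also have "\<dots> = (\<Sum>i\<in>UNIV. (\<Sum>j\<in>UNIV. transpose A $ i $ j * nab (A *v p) $ j) * z $ i)"
      by (simp add: sum_distrib_left sum_distrib_right transpose_def mult_ac)
    also have "\<dots> = pair (transpose A *v nab (A *v p)) z"
      by (simp only: pair_def matrix_vector_mult_def vec_lambda_beta)
    also have "transpose A *v nab (A *v p) = nab p"
      using A by (simp only: isom_def mem_Collect_eq vec.scale_one)
    finally show ?thesis .
  qed
  have pair_m: "pair (nab ((((*v) A) ^^ m) p)) ((((*v) A) ^^ m) z) = pair (nab p) z" for m p z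
    by (induction m) (simp_all add: pair_A)
  \<comment> \<open>The pairing of the gradient at A^m u with A^m z is independent of m. Expanding
    A^m z binomially isolates the pairing with z; the other terms pair with T^i z for i > 0, of
    smaller nilpotency, and the factor \<open>bin i\<close> restores at most the degree i.\<close>
  have growth: "\<exists>q. degree q \<le> l \<and> (\<forall>m. pair (nab ((((*v) A) ^^ m) u)) z = poly q (of_nat m))"
    if "(T ^^ Suc l) z = 0" for l z
    using that
  proof (induction l arbitrary: z rule: less_induct)
    case (less l)
    have step: "\<exists>q. degree (bin i * q) \<le> l \<and>
        (\<forall>m. pair (nab ((((*v) A) ^^ m) u)) ((T ^^ i) z) = poly q (of_nat m))" if i: "i > 0" for i
    proof (cases "i \<le> l")
      case True
      have "(T ^^ Suc (l - i)) ((T ^^ i) z) = (T ^^ Suc l) z"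
        using True by (simp add: funpow_add[symmetric, THEN fun_cong, unfolded o_def] del: funpow.simps)
      then have "(T ^^ Suc (l - i)) ((T ^^ i) z) = 0" using less.prems by simp
      then obtain q where q: "degree q \<le> l - i"
          "\<forall>m. pair (nab ((((*v) A) ^^ m) u)) ((T ^^ i) z) = poly q (of_nat m)"
        using less.IH[of "l - i" "(T ^^ i) z"] i True by auto
      have "degree (bin i * q) \<le> i + (l - i)"
        by (rule degree_mult_bounds[OF bin_bounds(1) q(1)])
      then show ?thesis using q(2) True by auto
    next
      case False
      then have "(T ^^ i) z = (T ^^ (i - Suc l)) ((T ^^ Suc l) z)"
        by (simp add: funpow_add[symmetric, THEN fun_cong, unfolded o_def] del: funpow.simps)
      then have "(T ^^ i) z = 0" using less.prems it0 by simp
      then show ?thesis by (intro exI[of _ 0]) (simp add: pair_def)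
    qed
    then have "\<forall>i. \<exists>q. i > 0 \<longrightarrow> degree (bin i * q) \<le> l \<and>
        (\<forall>m. pair (nab ((((*v) A) ^^ m) u)) ((T ^^ i) z) = poly q (of_nat m))" by blast
    then obtain q where q: "\<And>i. i > 0 \<Longrightarrow> degree (bin i * q i) \<le> l"
        "\<And>i m. i > 0 \<Longrightarrow> pair (nab ((((*v) A) ^^ m) u)) ((T ^^ i) z) = poly (q i) (of_nat m)" by metis
    define Q where "Q = [:pair (nab u) z:] - (\<Sum>i\<in>{1..r}. bin i * q i)"
    have "degree Q \<le> l"
      unfolding Q_def using q(1) by (intro degree_diff_le degree_sum_le) auto
    moreover have "pair (nab ((((*v) A) ^^ m) u)) z = poly Q (of_nat m)" for m
    proof -
      let ?a = "nab ((((*v) A) ^^ m) u)"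
      have "pair (nab u) z = (\<Sum>i\<le>r. of_nat (m choose i) * pair ?a ((T ^^ i) z))"
        using pair_m[of m u z] unfolding pw[of m z] pair_sum by (rule sym)
      also have "{..r} = insert 0 {1..r}" by auto
      also have "(\<Sum>i\<in>insert 0 {1..r}. of_nat (m choose i) * pair ?a ((T ^^ i) z))
          = pair ?a z + (\<Sum>i\<in>{1..r}. of_nat (m choose i) * pair ?a ((T ^^ i) z))"
        by (subst sum.insert) auto
      also have "(\<Sum>i\<in>{1..r}. of_nat (m choose i) * pair ?a ((T ^^ i) z))
          = (\<Sum>i\<in>{1..r}. poly (bin i * q i) (of_nat m))"
        by (intro sum.cong) (auto simp: q(2) poly_bin)
      finally show ?thesis by (simp add: Q_def poly_sum)
    qed
    ultimately show ?case by blast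
  qed
  have "subst to_ac (\<lambda>j. coeff (U j) r) (partial j \<Omega>) = 0" for j
  proof -
    obtain q where q: "degree q \<le> r"
        "\<And>m. pair (nab ((((*v) A) ^^ m) u)) (axis j 1) = poly q (of_nat m)"
      using growth[OF nilr, of "axis j 1"] by blast
    have "pair a (axis j 1) = a $ j" for a
      by (simp add: pair_def axis_def if_distrib cong: if_cong)
    then have "G j = q" using q(2) G by (intro poly_eqI_of_nat) simp
    \<comment> \<open>So the coefficient of \<open>G j\<close> in degree (d - 1) r is 0. It is the
      gradient at the top coefficients of U, which therefore vanish, against the choice of
      u.\<close>
    moreover have "r < (d - 1) * r" using d_gt(3) card_ge r(2) by simp
    ultimately show ?thesis using q(1) topG[of j] by (metis coeff_eq_0 le_less_trans)
  qed
  then have "coeff (U j) r = 0" for j by (rule zero_if_partials_zero[OF to_ac_hom])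
  then have "(T ^^ r) u = 0" using bin_bounds(2)[of r, where 'k = "'k alg_closure"] by (simp add: topU vec_eq_iff)
  then show False using u by simp
qed

text \<open>The eigenvalues of A are roots of X^E - 1, so A^E - 1 is nilpotent, and det A^E = 1 by
  torsion. Hence A^E is trivial by \<open>isom_unipotent\<close>.\<close>

lemma isom_power_expo:
  assumes A: "A \<in> isom"
  shows "mpw A (expo d CARD('n option)) = mat 1"
proof -
  let ?E = "expo d CARD('n option)" and ?P = "monom 1 (expo d CARD('n option)) - 1 :: 'k alg_closure poly"
  let ?B = "mpw A ?E"
  define T where "T = (\<lambda>v. ?B *v v - v)"
  have B: "?B \<in> isom" by (rule mpw_in[OF isom_1 isom_mult A])
  have "det (mpw A m) = det A ^ m" for m by (induction m) (simp_all add: mpw_Suc det_mul)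
  then have det: "det ?B = 1" using isom_det_expo[OF A] by simp
  have lin: "T (x + y) = T x + T y" "T (c *s x) = c *s T x" for x y c
    by (simp_all add: T_def matrix_vector_right_distrib vector_scalar_commute vec.scale_right_diff_distrib)
  have linp: "(T ^^ i) (x + y) = (T ^^ i) x + (T ^^ i) y" "(T ^^ i) (c *s x) = c *s (T ^^ i) x" for i x y c
    by (induction i) (simp_all add: lin)
  have T0: "(T ^^ i) 0 = 0" for i using linp(2)[of i 0 0] by simp
  have mono: "act A (monom 1 m) v = (((*v) A) ^^ m) v" for m v
    by (induction m arbitrary: v) (simp_all add: monom_0 act_pCons monom_Suc)
  have one: "act A (monom 1 m - 1) v = (((*v) A) ^^ m) v - v" for m v
    using act_add[of A "monom 1 m - 1" 1 v] by (simp add: mono one_pCons act_pCons)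
  have PT: "act A ?P v = T v" for v unfolding one mpw_vec T_def ..
  have "act A (?P ^ i) v = (T ^^ i) v" for i v
  proof (induction i)
    case 0
    show ?case by (simp add: one_pCons act_pCons)
  next
    case (Suc i)
    then show ?case by (simp only: power_Suc act_mult PT funpow.simps o_apply)
  qed
  then have "\<forall>v. \<exists>k. (T ^^ k) v = 0"
    using power_minus_one_nilpotent[of A ?E] isom_eigv_expo[OF A] by metis
  then obtain k where k: "\<And>v. (T ^^ k v) v = 0" by metis
  \<comment> \<open>Nilpotency is known vector by vector; a common exponent for the unit vectors
    serves for all.\<close>
  define K where "K = (\<Sum>i\<in>UNIV. k (axis i 1))"
  have ax: "(T ^^ K) (axis i 1) = 0" for i
  proof -
    have "k (axis i 1) \<le> K" unfolding K_def by (intro member_le_sum) auto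
    then have "(T ^^ K) (axis i 1) = (T ^^ (K - k (axis i 1))) ((T ^^ k (axis i 1)) (axis i 1))"
      by (simp add: funpow_add[symmetric, THEN fun_cong, unfolded o_def])
    then show ?thesis by (simp add: k T0)
  qed
  have "(T ^^ K) v = 0" for v
  proof -
    have sum: "(T ^^ K) (\<Sum>i\<in>S. v $ i *s axis i 1) = 0" for S
      by (induction S rule: infinite_finite_induct) (simp_all add: T0 linp ax)
    show ?thesis using sum[of UNIV] by (simp add: basis_expansion)
  qed
  then show ?thesis
    unfolding T_def by (rule isom_unipotent[OF B det])
qed

lemma finite_isom: "finite isom"
  by (rule finite_matrix_group[of isom "expo d CARD('n option)"])
    (use isom_1 isom_mult isom_inv isom_eigv_expo expo_pos isom_power_expo in \<open>blast+\<close>)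

lemma finite_linear_auts: "finite (linear_auts \<Omega>)"
proof -
  \<comment> \<open>The transpose, since \<open>lin M j\<close> takes at p the value of coordinate j
    of the transpose of M applied to p.\<close>
  define h :: "'k ^ 'n option ^ 'n option \<Rightarrow> 'k alg_closure ^ 'n option ^ 'n option"
    where "h = (\<lambda>M. \<chi> i j. to_ac (M $ j $ i))"
  have "h M \<in> isom" if M: "M \<in> linear_auts \<Omega>" for M
  proof -
    have "det (h M) = fdet (\<lambda>i j. to_ac (transpose M $ i $ j))"
      unfolding fdet_def h_def transpose_def by simp
    also have "\<dots> = to_ac (det M)"
      unfolding rhom.hom_fdet[OF to_ac_hom, symmetric] by (simp add: fdet_def det_transpose)
    finally have det: "det (h M) = to_ac (det M)" .
    have "transpose (h M) *v nab (h M *v p) = det (h M) *s nab p" for p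
    proof -
      let ?s = "subst to_ac (\<lambda>j. p $ j)"
      interpret s: rhom ?s by (rule subst_hom[OF to_ac_hom])
      have lin: "?s (lin M j) = (h M *v p) $ j" for j
        by (simp add: lin_def s.homs to_ac_hom h_def matrix_vector_mult_def)
      have "(transpose (h M) *v nab (h M *v p)) $ l = (det (h M) *s nab p) $ l" for l
      proof -
        have "(transpose (h M) *v nab (h M *v p)) $ l = (\<Sum>i\<in>UNIV. to_ac (M $ l $ i) * ?s (phi M (partial i \<Omega>)))"
        proof -
          have "(transpose (h M) *v w) $ l = (\<Sum>i\<in>UNIV. to_ac (M $ l $ i) * w $ i)" for w
            by (simp only: matrix_vector_mult_def transpose_def h_def vec_lambda_beta)
          moreover have "nab (h M *v p) $ i = ?s (phi M (partial i \<Omega>))" for i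
            by (simp only: nab_def phi_def subst_subst[OF to_ac_hom] lin vec_lambda_beta)
          ultimately show ?thesis by (simp only:)
        qed
        also have "\<dots> = ?s (\<Sum>i\<in>UNIV. phi M (partial i \<Omega>) * const (M $ l $ i))"
          by (simp add: s.homs to_ac_hom mult.commute)
        also have "\<dots> = (det (h M) *s nab p) $ l"
          unfolding linear_auts_gradient[OF M] by (simp add: s.homs to_ac_hom det nab_def)
        finally show ?thesis .
      qed
      then show ?thesis unfolding vec_eq_iff by blast
    qed
    moreover have "invertible (h M)"
      using M by (simp add: invertible_det_nz det linear_auts_def)
    ultimately show ?thesis by (simp add: isom_def)
  qed
  then have "h ` linear_auts \<Omega> \<subseteq> isom" by blast
  then have "finite (h ` linear_auts \<Omega>)" using finite_isom by (rule finite_subset)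
  moreover have "inj_on h (linear_auts \<Omega>)"
    by (auto simp: inj_on_def h_def vec_eq_iff)
  ultimately show ?thesis by (rule finite_imageD)
qed

end

section \<open>The automorphism groups\<close>

lemma Aut_Poi_simps:
  "carrier (Aut_Poi P) = np_auto P"
  "F \<in> np_auto P \<Longrightarrow> G \<in> np_auto P \<Longrightarrow> F \<otimes>\<^bsub>Aut_Poi P\<^esub> G = compose (carrier P) F G"
  by (simp_all add: Aut_Poi_def BijGroup_def np_auto_def)

text \<open>All three automorphism groups are images of \<open>linear_auts\<close>, so the natural
  maps need only be compared with the parametrizations.\<close>

lemma iso_by_parametrization:
  assumes "carrier G = a ` S" "carrier H = b ` S" "inj_on b S"
    and "\<And>x y. x \<in> S \<Longrightarrow> y \<in> S \<Longrightarrow> m x y \<in> S"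
    and "\<And>x y. x \<in> S \<Longrightarrow> y \<in> S \<Longrightarrow> a x \<otimes>\<^bsub>G\<^esub> a y = a (m x y)"
    and "\<And>x y. x \<in> S \<Longrightarrow> y \<in> S \<Longrightarrow> b x \<otimes>\<^bsub>H\<^esub> b y = b (m x y)"
    and "\<And>x. x \<in> S \<Longrightarrow> f (a x) = b x"
  shows "f \<in> iso G H"
proof -
  have "f \<in> hom G H"
    using assms by (intro homI) auto
  moreover have "bij_betw f (a ` S) (b ` S)"
    unfolding bij_betw_def using assms(3,7)
    by (auto simp: inj_on_def image_image intro!: image_eqI)
  ultimately show ?thesis by (simp add: iso_def assms(1,2))
qed

lemma invertible_mat_1: "invertible (mat 1 :: 'k::field ^ 'v::finite ^ 'v)"
  by (auto simp: invertible_def intro!: exI[of _ "mat 1"])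

lemma group_GL: "group (GL_group :: ('k::field ^ 'v::finite ^ 'v) monoid)"
proof (rule groupI)
  fix M :: "'k ^ 'v ^ 'v" assume "M \<in> carrier GL_group"
  then obtain N where "M ** N = mat 1" "N ** M = mat 1" by (auto simp: GL_group_def invertible_def)
  then show "\<exists>N\<in>carrier GL_group. N \<otimes>\<^bsub>GL_group\<^esub> M = \<one>\<^bsub>GL_group\<^esub>"
    by (auto simp: GL_group_def invertible_def)
qed (simp_all add: GL_group_def invertible_mult matrix_mul_assoc invertible_mat_1)

lemma subgroup_linear_auts: "subgroup (linear_auts \<Omega>) GL_group"
proof (rule group.subgroupI[OF group_GL])
  show "linear_auts \<Omega> \<subseteq> carrier GL_group" by (auto simp: linear_auts_def GL_group_def)
  show "linear_auts \<Omega> \<noteq> {}" using linear_auts_1 by blast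
  fix M assume M: "M \<in> linear_auts \<Omega>"
  obtain N where N: "N \<in> linear_auts \<Omega>" "N ** M = mat 1" using phi_inverse[OF M] by blast
  have "inv\<^bsub>GL_group\<^esub> M = N"
    using M N by (intro group.inv_equality[OF group_GL]) (auto simp: linear_auts_def GL_group_def)
  then show "inv\<^bsub>GL_group\<^esub> M \<in> linear_auts \<Omega>" using N(1) by simp
  fix N' assume "N' \<in> linear_auts \<Omega>"
  then show "M \<otimes>\<^bsub>GL_group\<^esub> N' \<in> linear_auts \<Omega>"
    using linear_auts_mult[OF M] by (simp add: GL_group_def)
qed

context potential begin

lemma mult_Aut_A:
  assumes "M \<in> linear_auts \<Omega>" "N \<in> linear_auts \<Omega>"
  shows "phi M \<otimes>\<^bsub>Aut_Poi (A_alg \<Omega>)\<^esub> phi N = phi (M ** N)"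
  using assms by (subst Aut_Poi_simps(2)) (auto simp: np_auto_A A_alg_simps compose_def phi_phi)

lemma carrier_Q: "carrier (Q_alg \<Omega>) = UNIV"
  by (simp add: Q_alg_def frac_alg_simps)

lemma mult_Aut_Q:
  assumes "M \<in> linear_auts \<Omega>" "N \<in> linear_auts \<Omega>"
  shows "frac_map (phi M) \<otimes>\<^bsub>Aut_Poi (Q_alg \<Omega>)\<^esub> frac_map (phi N) = frac_map (phi (M ** N))"
  using assms by (subst Aut_Poi_simps(2)) (auto simp: np_auto_Q carrier_Q compose_def frac_map_phi_phi)

lemma mult_Aut_P:
  assumes "M \<in> linear_auts \<Omega>" "N \<in> linear_auts \<Omega>"
  shows "qmap \<Omega> M \<otimes>\<^bsub>Aut_Poi (P_alg \<Omega>)\<^esub> qmap \<Omega> N = qmap \<Omega> (M ** N)"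
proof -
  have "qmap \<Omega> M \<otimes>\<^bsub>Aut_Poi (P_alg \<Omega>)\<^esub> qmap \<Omega> N = compose (range (pcoset \<Omega>)) (qmap \<Omega> M) (qmap \<Omega> N)"
    using assms by (subst Aut_Poi_simps(2)) (auto simp: np_auto_P carrier_P)
  also have "\<dots> = qmap \<Omega> (M ** N)"
  proof (rule extensionalityI[OF compose_extensional qmap_extensional])
    fix C assume "C \<in> range (pcoset \<Omega>)"
    then obtain p where "C = pcoset \<Omega> p" by blast
    then show "compose (range (pcoset \<Omega>)) (qmap \<Omega> M) (qmap \<Omega> N) C = qmap \<Omega> (M ** N) C"
      using assms linear_auts_mult[OF assms] by (simp add: compose_eq qmap_pcoset phi_phi)
  qed
  finally show ?thesis .
qed

lemma inj_frac_map_phi: "inj_on (\<lambda>M. frac_map (phi M)) (linear_auts \<Omega>)"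
proof (rule inj_onI)
  fix M N assume MN: "M \<in> linear_auts \<Omega>" "N \<in> linear_auts \<Omega>" "frac_map (phi M) = frac_map (phi N)"
  have "emb (phi M p) = emb (phi N p)" for p
    using MN by (simp only: frac_map_phi_emb[symmetric])
  then have "phi M = phi N" by (intro ext) simp
  then show "M = N" by (simp add: phi_eq_iff)
qed

text \<open>Linear forms congruent modulo \<Omega> are equal, since d > 1.\<close>

lemma inj_qmap: "inj_on (qmap \<Omega>) (linear_auts \<Omega>)"
proof (rule inj_onI)
  fix M N assume MN: "M \<in> linear_auts \<Omega>" "N \<in> linear_auts \<Omega>" "qmap \<Omega> M = qmap \<Omega> N"
  have "lin M j = lin N j" for j
  proof -
    have "pcoset \<Omega> (phi M (var j)) = pcoset \<Omega> (phi N (var j))"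
      using MN by (simp only: qmap_pcoset[symmetric])
    then have "\<Omega> dvd lin M j - lin N j" by (simp add: pcoset_eq_iff)
    moreover have "homogeneous 1 (lin M j - lin N j)"
      using homogeneous_lin[of M j] homogeneous_lin[of N j]
      by (simp add: homogeneous_iff rhom.homs[OF grad_hom] poly_eq_iff)
    ultimately have "lin M j - lin N j = 0" using homogeneous_dvd_0[OF hom\<Omega> _ d_gt(4)] by blast
    then show ?thesis by simp
  qed
  then show "M = N" using lookup_lin[of M] lookup_lin[of N] by (simp add: vec_eq_iff)
qed

lemma linear_part_image: "linear_part ` np_auto (A_alg \<Omega>) = linear_auts \<Omega>"
  by (simp add: np_auto_A image_image linear_part_phi)

lemma linear_part_mon: "linear_part \<in> mon (Aut_Poi (A_alg \<Omega>)) GL_group"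
proof -
  have "linear_part \<in> hom (Aut_Poi (A_alg \<Omega>)) GL_group"
    by (intro homI)
      (auto simp: Aut_Poi_simps(1) np_auto_A mult_Aut_A linear_part_phi GL_group_def linear_auts_def)
  moreover have "inj_on linear_part (np_auto (A_alg \<Omega>))"
    by (auto simp: inj_on_def np_auto_A linear_part_phi)
  ultimately show ?thesis by (simp add: mon_def Aut_Poi_simps(1))
qed

lemma graded_np_auto_A: "\<phi> \<in> np_auto (A_alg \<Omega>) \<Longrightarrow> graded_map \<phi>"
  by (auto simp: np_auto_A graded_map_def homogeneous_phi)

lemma np_auto_A_PIdl:
  assumes "\<phi> \<in> np_auto (A_alg \<Omega>)"
  shows "\<phi> ` (PIdl\<^bsub>A_alg \<Omega>\<^esub> \<Omega>) = PIdl\<^bsub>A_alg \<Omega>\<^esub> \<Omega>"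
proof -
  obtain M where M: "M \<in> linear_auts \<Omega>" "\<phi> = phi M" using assms by (auto simp: np_auto_A)
  have "PIdl\<^bsub>A_alg \<Omega>\<^esub> \<Omega> = pcoset \<Omega> 0" by (simp add: PIdl_A_alg pcoset_def)
  then show ?thesis
    using phi_image_pcoset[OF M(1), of 0] by (simp add: M(2) rhom.hom_0[OF phi_hom])
qed

end

theorem theorem0p11:
  fixes \<Omega> :: "('k::field_char_0, 'n::{finite,linorder} option) mpoly"
    and d :: nat
  assumes "CARD('n) \<ge> 3"
    and "is_potential \<Omega>"
    and "homogeneous d \<Omega>"
    and "d \<ge> CARD('n) + 3"
  shows "(\<forall>\<phi>\<in>carrier (Aut_Poi (A_alg \<Omega>)). graded_map \<phi>)
    \<and> frac_map \<in> iso (Aut_Poi (A_alg \<Omega>)) (Aut_Poi (Q_alg \<Omega>))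
    \<and> (\<forall>\<phi>\<in>carrier (Aut_Poi (A_alg \<Omega>)). \<phi> ` (PIdl\<^bsub>A_alg \<Omega>\<^esub> \<Omega>) = PIdl\<^bsub>A_alg \<Omega>\<^esub> \<Omega>)
    \<and> quot_map (A_alg \<Omega>) (PIdl\<^bsub>A_alg \<Omega>\<^esub> \<Omega>)
        \<in> iso (Aut_Poi (A_alg \<Omega>)) (Aut_Poi (P_alg \<Omega>))
    \<and> linear_part \<in> mon (Aut_Poi (A_alg \<Omega>)) GL_group
    \<and> subgroup (linear_part ` carrier (Aut_Poi (A_alg \<Omega>))) GL_group
    \<and> finite (linear_part ` carrier (Aut_Poi (A_alg \<Omega>)))"
proof -
  interpret potential \<Omega> d by unfold_locales (fact assms)+
  have "frac_map \<in> iso (Aut_Poi (A_alg \<Omega>)) (Aut_Poi (Q_alg \<Omega>))"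
    by (rule iso_by_parametrization[where a = phi and b = "\<lambda>M. frac_map (phi M)" and m = "(**)" and S = "linear_auts \<Omega>"])
      (simp_all add: Aut_Poi_simps(1) np_auto_A np_auto_Q inj_frac_map_phi linear_auts_mult mult_Aut_A mult_Aut_Q)
  moreover have "quot_map (A_alg \<Omega>) (PIdl\<^bsub>A_alg \<Omega>\<^esub> \<Omega>) \<in> iso (Aut_Poi (A_alg \<Omega>)) (Aut_Poi (P_alg \<Omega>))"
    by (rule iso_by_parametrization[where a = phi and b = "qmap \<Omega>" and m = "(**)" and S = "linear_auts \<Omega>"])
      (simp_all add: Aut_Poi_simps(1) np_auto_A np_auto_P inj_qmap linear_auts_mult mult_Aut_A mult_Aut_P)
  ultimately show ?thesis
    using graded_np_auto_A np_auto_A_PIdl linear_part_mon subgroup_linear_auts[of \<Omega>] finite_linear_auts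
    by (simp add: Aut_Poi_simps(1) linear_part_image)
qed

end
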